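(* Let $G$ be any group of matrices whose entries are computable numbers, such that $SL(4,\mathbb{Z})$ is a subgroup of $G$. Then $\mathfrak{L}(G)=\mathsf{RE}$.
   Context: For a group $G$ with identity $e$, a $G$-automaton is a tuple $(Q,\Sigma,G,\delta,q_0,Q_a)$ where $Q$ is a finite set of states, $\Sigma$ a finite input alphabet, $q_0\in Q$ the initial state, $Q_a\subseteq Q$ the accepting states, and $\delta$ assigns to each $(q,\sigma)\in Q\times(\Sigma\cup\{\varepsilon\})$ a finite set of pairs $(q',m)\in Q\times G$. The register holds an element of $G$, initially $e$; using a transition $(q',m)\in\delta(q,\sigma)$ the automaton reads $\sigma$ (or nothing), moves to $q'$ and replaces the register content $x$ by $xm$. A word is accepted if some computation reads it entirely and ends in an accepting state with register equal to $e$. $\mathfrak{L}(G)$ is the class of languages recognized by $G$-automata. $\mathsf{RE}$ is the class of recursively enumerable languages; $SL(4,\mathbb{Z})$ is the group of $4\times4$ integer matrices of determinant $1$. *)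

theory Defs
  imports "HOL-Analysis.Analysis" "HOL-Algebra.Group" "HOL-Library.Nat_Bijection"
begin

section \<open>Partial recursive functions (the model of computation)\<close>

datatype recf =
    Zr
  | Sc
  | Proj nat
  | Comp recf "recf list"
  | Prim recf recf
  | Mn recf

text \<open>eval f xs y: the partial recursive function f on argument list xs
  terminates with value y.\<close>
inductive eval :: "recf \<Rightarrow> nat list \<Rightarrow> nat \<Rightarrow> bool" where
  ev_Zr: "eval Zr xs 0"
| ev_Sc: "eval Sc (x # xs) (Suc x)"
| ev_Proj: "i < length xs \<Longrightarrow> eval (Proj i) xs (xs ! i)"
| ev_Comp: "list_all2 (\<lambda>g y. eval g xs y) gs ys \<Longrightarrow> eval f ys y \<Longrightarrow> eval (Comp f gs) xs y"
| ev_Prim0: "eval f xs y \<Longrightarrow> eval (Prim f g) (0 # xs) y"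
| ev_PrimS: "eval (Prim f g) (n # xs) r \<Longrightarrow> eval g (r # n # xs) y
             \<Longrightarrow> eval (Prim f g) (Suc n # xs) y"
| ev_Mn: "eval f (n # xs) 0 \<Longrightarrow> (\<forall>m<n. \<exists>y. y > 0 \<and> eval f (m # xs) y)
          \<Longrightarrow> eval (Mn f) xs n"

text \<open>A set of naturals is recursively enumerable iff it is the domain of a
  partial recursive function.\<close>
definition RE_nat :: "nat set \<Rightarrow> bool" where
  "RE_nat A \<longleftrightarrow> (\<exists>f. A = {n. \<exists>y. eval f [n] y})"

text \<open>A language over the finite alphabet 'a is recursively enumerable iff, after
  numbering the letters 0..k-1 and coding words by the standard list coding,
  the set of codes is r.e. (independent of the numbering chosen).\<close>
definition RE_lang :: "('a::finite) list set \<Rightarrow> bool" where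
  "RE_lang L \<longleftrightarrow> (\<exists>e :: 'a \<Rightarrow> nat. bij_betw e UNIV {..<CARD('a)} \<and>
       RE_nat (list_encode ` map e ` L))"

text \<open>Computable real numbers: there is a total recursive function producing
  rationals q_n with |x - q_n| \<le> 2^-n (a rational is coded by a pair
  (integer numerator, denominator - 1)).\<close>
definition computable_real :: "real \<Rightarrow> bool" where
  "computable_real x \<longleftrightarrow> (\<exists>f. \<forall>n. \<exists>m. eval f [n] m \<and>
      \<bar>x - of_int (int_decode (fst (prod_decode m))) / real (Suc (snd (prod_decode m)))\<bar>
        \<le> 1 / 2 ^ n)"

section \<open>G-automata\<close>

text \<open>Transition function: delta q None are the epsilon transitions,
  delta q (Some a) those reading letter a. States are natural numbers.\<close>
inductive steps :: "('g, 'b) monoid_scheme \<Rightarrow> (nat \<Rightarrow> 'a option \<Rightarrow> (nat \<times> 'g) set)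
    \<Rightarrow> nat \<Rightarrow> 'g \<Rightarrow> 'a list \<Rightarrow> nat \<Rightarrow> 'g \<Rightarrow> bool"
  for G delta where
  st_refl: "steps G delta q x [] q x"
| st_eps: "(q1, m) \<in> delta q None \<Longrightarrow> steps G delta q1 (x \<otimes>\<^bsub>G\<^esub> m) w q2 y
           \<Longrightarrow> steps G delta q x w q2 y"
| st_read: "(q1, m) \<in> delta q (Some a) \<Longrightarrow> steps G delta q1 (x \<otimes>\<^bsub>G\<^esub> m) w q2 y
           \<Longrightarrow> steps G delta q x (a # w) q2 y"

definition G_automaton :: "('g, 'b) monoid_scheme \<Rightarrow> nat set
    \<Rightarrow> (nat \<Rightarrow> 'a option \<Rightarrow> (nat \<times> 'g) set) \<Rightarrow> nat \<Rightarrow> nat set \<Rightarrow> bool" where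
  "G_automaton G Q delta q0 Qa \<longleftrightarrow> finite Q \<and> q0 \<in> Q \<and> Qa \<subseteq> Q \<and>
     (\<forall>q\<in>Q. \<forall>s. finite (delta q s) \<and> delta q s \<subseteq> Q \<times> carrier G)"

definition aut_lang :: "('g, 'b) monoid_scheme \<Rightarrow> (nat \<Rightarrow> 'a option \<Rightarrow> (nat \<times> 'g) set)
    \<Rightarrow> nat \<Rightarrow> nat set \<Rightarrow> 'a list set" where
  "aut_lang G delta q0 Qa = {w. \<exists>qf\<in>Qa. steps G delta q0 \<one>\<^bsub>G\<^esub> w qf \<one>\<^bsub>G\<^esub>}"

text \<open>The class L(G) of languages over the alphabet 'a recognised by G-automata.\<close>
definition G_languages :: "('g, 'b) monoid_scheme \<Rightarrow> 'a list set set" where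
  "G_languages G = {L. \<exists>Q delta q0 Qa. G_automaton G Q delta q0 Qa \<and> L = aut_lang G delta q0 Qa}"

section \<open>Matrix groups\<close>

definition matrix_group :: "('r::semiring_1 ^'n ^'n) set \<Rightarrow> ('r ^'n ^'n) monoid" where
  "matrix_group S = \<lparr>carrier = S, mult = (**), one = mat 1\<rparr>"

definition SL4Z :: "(int ^4 ^4) monoid" where
  "SL4Z = matrix_group {A. det A = 1}"

end

(*
  An automaton over a group of real matrices uses only finitely many matrices, whose entries generate
  a ring R = Z[x_0, ..., x_{K-1}].  Equality of ring expressions in the x_k is semi-decidable: adjoin the
  generators one at a time, and record for each x_k that is algebraic over the previous ring a polynomial
  m of least degree with m(x_k) = 0.  By pseudo-division p(x_k) = 0 implies a^j p = q m for the leading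
  coefficient a of m, so the ring axioms, the relations m(x_k) = 0 and the cancellation of the a's derive
  every true equation.  These are finitely many Horn clauses, as are the moves of the automaton, and the
  consequences of a finite Horn program are recursively enumerable.

  Conversely, a recursively enumerable language is accepted by a nondeterministic counter program, that is,
  by a regular expression over increments, decrements, zero tests and reads.  Writing the configurations
  after the steps of a run into one word u and those before the steps into another word v, the run is
  consistent iff c_0 u = v c_0.  Two words can be collected in one register by a block diagonal embedding of
  pairs of words into SL(4,Z), built from a free submonoid of SL(2,Z).  To test them for equality, guess a
  word z and multiply the register by the inverse of the image of (z, z).
*)
theory Submission
  imports Defs
begin

section \<open>Total recursive functions and decidable predicates\<close>

text \<open>Approximations of real entries can refute that a product is the identity but can never
  confirm it, whereas enumerating a language calls for confirmation; hence equality is certified by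
  exact algebra over Z. The relations among the entries are constants of the program, chosen
  nonconstructively: recursive enumerability asks only that some program exists. Adding one
  generator per stage means that each stage deals with polynomials in one variable, and cancelling
  the leading coefficient stands in for division, so that all certificates stay inside a ring. In
  the converse direction the obstacle is that a group register is tested only once, at the end. No
  step of the counter program can be checked when it is made. Each action therefore guesses its own
  configurations before and after, and a single equation of words forces neighbours to agree: the
  shift by c_0 puts the configuration after one step opposite the configuration before the
  next.\<close>

inductive_cases eval_ZrE: "eval Zr xs y"
inductive_cases eval_ScE: "eval Sc xs y"
inductive_cases eval_ProjE: "eval (Proj i) xs y"
inductive_cases eval_CompE: "eval (Comp f gs) xs y"
inductive_cases eval_PrimE: "eval (Prim f g) xs y"
inductive_cases eval_MnE: "eval (Mn f) xs y"

lemma eval_det: "eval f xs y \<Longrightarrow> eval f xs z \<Longrightarrow> y = z"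
proof (induction f xs y arbitrary: z rule: eval.induct)
  case (ev_Zr xs)
  then show ?case by (auto elim: eval_ZrE)
next
  case (ev_Sc x xs)
  then show ?case by (auto elim: eval_ScE)
next
  case (ev_Proj i xs)
  then show ?case by (auto elim: eval_ProjE)
next
  case (ev_Comp xs gs ys f y)
  from ev_Comp.prems obtain zs where zs: "list_all2 (\<lambda>g y. eval g xs y) gs zs" "eval f zs z"
    by (auto elim: eval_CompE)
  have "ys = zs"
    using ev_Comp.IH(1) zs(1) by (auto simp: list_all2_conv_all_nth intro: nth_equalityI)
  then show ?case using ev_Comp.IH(2) zs(2) by simp
next
  case (ev_Prim0 f xs y g)
  from ev_Prim0.prems show ?case
    by (rule eval_PrimE) (use ev_Prim0.IH in auto)
next
  case (ev_PrimS f g n xs r y)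
  from ev_PrimS.prems show ?case
    by (rule eval_PrimE) (use ev_PrimS.IH in auto)
next
  case (ev_Mn f n xs)
  from ev_Mn.prems have z: "eval f (z # xs) 0" "\<forall>m<z. \<exists>y>0. eval f (m # xs) y"
    by (rule eval_MnE; simp)+
  show ?case
    using ev_Mn.IH z by (metis nat_neq_iff)
qed

definition total_rec :: "nat \<Rightarrow> (nat list \<Rightarrow> nat) \<Rightarrow> bool" where
  "total_rec n F \<longleftrightarrow> (\<exists>f. \<forall>xs. length xs = n \<longrightarrow> eval f xs (F xs))"

lemma total_rec_cong:
  "total_rec n F \<Longrightarrow> (\<And>xs. length xs = n \<Longrightarrow> F xs = G xs) \<Longrightarrow> total_rec n G"
  unfolding total_rec_def by fastforce

lemma total_rec_nth: "i < n \<Longrightarrow> total_rec n (\<lambda>xs. xs ! i)"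
  unfolding total_rec_def by (rule exI[of _ "Proj i"]) (simp add: eval.ev_Proj)

lemma total_rec_comp:
  assumes F: "total_rec (length Gs) F" and Gs: "\<And>G. G \<in> set Gs \<Longrightarrow> total_rec n G"
  shows "total_rec n (\<lambda>xs. F (map (\<lambda>G. G xs) Gs))"
proof -
  obtain f where f: "\<And>xs. length xs = length Gs \<Longrightarrow> eval f xs (F xs)"
    using F by (auto simp: total_rec_def)
  obtain g where g: "\<And>G xs. G \<in> set Gs \<Longrightarrow> length xs = n \<Longrightarrow> eval (g G) xs (G xs)"
    using Gs unfolding total_rec_def by metis
  show ?thesis
    unfolding total_rec_def
    by (rule exI[of _ "Comp f (map g Gs)"])
      (auto simp: list_all2_conv_all_nth intro!: eval.ev_Comp[where ys = "map (\<lambda>G. G _) Gs"] f g)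
qed

lemma total_rec_1:
  "total_rec 1 (\<lambda>xs. F (xs ! 0)) \<Longrightarrow> total_rec n A \<Longrightarrow> total_rec n (\<lambda>xs. F (A xs))"
  using total_rec_comp[of "[A]" "\<lambda>xs. F (xs ! 0)" n] by simp

lemma total_rec_Suc: "total_rec n A \<Longrightarrow> total_rec n (\<lambda>xs. Suc (A xs))"
  by (rule total_rec_1[of Suc])
    (auto simp: total_rec_def length_Suc_conv intro!: exI[of _ Sc] eval.ev_Sc)

lemma total_rec_const: "total_rec n (\<lambda>xs. c)"
proof (induction c)
  case 0
  show ?case unfolding total_rec_def by (rule exI[of _ Zr]) (simp add: eval.ev_Zr)
qed (rule total_rec_Suc)

lemma total_rec_prim:
  assumes F: "total_rec n F" and G: "total_rec (Suc (Suc n)) G"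
  shows "total_rec (Suc n) (\<lambda>xs. rec_nat (F (tl xs)) (\<lambda>k r. G (r # k # tl xs)) (hd xs))"
proof -
  obtain f where f: "\<And>xs. length xs = n \<Longrightarrow> eval f xs (F xs)"
    using F by (auto simp: total_rec_def)
  obtain g where g: "\<And>xs. length xs = Suc (Suc n) \<Longrightarrow> eval g xs (G xs)"
    using G by (auto simp: total_rec_def)
  have *: "eval (Prim f g) (k # xs) (rec_nat (F xs) (\<lambda>k r. G (r # k # xs)) k)"
    if "length xs = n" for k xs
    by (induction k) (auto intro!: eval.ev_Prim0 eval.ev_PrimS f g simp: that intro: eval.ev_PrimS)
  show ?thesis
    unfolding total_rec_def by (rule exI[of _ "Prim f g"]) (auto simp: length_Suc_conv *)
qed

text \<open>\<open>Prim\<close> counts on its first argument and hands the tail on as parameters.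
  Putting \<open>A xs\<close> in front of a full copy of \<open>xs\<close> allows a computed bound.
  In the step function the accumulator has index 0, the counter index 1, and the parameters start at
  index 2.\<close>

lemma total_rec_prim_at:
  assumes F: "total_rec n F" and G: "total_rec (Suc (Suc n)) G" and A: "total_rec n A"
  shows "total_rec n (\<lambda>xs. rec_nat (F xs) (\<lambda>k r. G (r # k # xs)) (A xs))"
proof -
  let ?H = "\<lambda>xs. rec_nat (F (tl xs)) (\<lambda>k r. G (r # k # tl xs)) (hd xs)"
  let ?Gs = "A # map (\<lambda>i xs. xs ! i) [0..<n]"
  have "total_rec n (\<lambda>xs. ?H (map (\<lambda>G. G xs) ?Gs))"
    by (rule total_rec_comp) (use A total_rec_prim[OF F G] in \<open>auto intro: total_rec_nth\<close>)
  then show ?thesis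
    by (rule total_rec_cong) (auto simp: comp_def map_nth)
qed

section \<open>Decidable predicates and search\<close>

definition decidable :: "nat \<Rightarrow> (nat list \<Rightarrow> bool) \<Rightarrow> bool" where
  "decidable n P \<longleftrightarrow> total_rec n (\<lambda>xs. of_bool (P xs))"

lemma decidable_cong:
  "decidable n P \<Longrightarrow> (\<And>xs. length xs = n \<Longrightarrow> P xs = Q xs) \<Longrightarrow> decidable n Q"
  unfolding decidable_def by (erule total_rec_cong) simp

text \<open>A primitive recursion whose step ignores accumulator and counter returns
  \<open>G xs\<close> after any positive number of rounds.\<close>

lemma total_rec_case_nat:
  assumes "total_rec n F" "total_rec n G" "total_rec n A"
  shows "total_rec n (\<lambda>xs. if A xs = 0 then F xs else G xs)"
proof -
  let ?Gs = "map (\<lambda>i xs. xs ! (i + 2)) [0..<n]"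
  have "total_rec (Suc (Suc n)) (\<lambda>xs. G (map (\<lambda>H. H xs) ?Gs))"
    by (rule total_rec_comp) (use assms(2) in \<open>auto intro: total_rec_nth\<close>)
  from total_rec_prim_at[OF assms(1) this assms(3)] show ?thesis
    by (rule total_rec_cong) (auto simp: comp_def map_nth gr0_conv_Suc)
qed

lemma total_rec_if:
  "decidable n P \<Longrightarrow> total_rec n F \<Longrightarrow> total_rec n G \<Longrightarrow> total_rec n (\<lambda>xs. if P xs then F xs else G xs)"
  unfolding decidable_def
  by (drule total_rec_case_nat[rotated 2, of n _ G F]) (auto elim: total_rec_cong)

lemma decidable_not: "decidable n P \<Longrightarrow> decidable n (\<lambda>xs. \<not> P xs)"
  using total_rec_if[OF _ total_rec_const total_rec_const, of n P 0 1]
  unfolding decidable_def[of _ "\<lambda>xs. \<not> P xs"]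
  by (auto elim!: total_rec_cong)

lemma decidable_conj: "decidable n P \<Longrightarrow> decidable n Q \<Longrightarrow> decidable n (\<lambda>xs. P xs \<and> Q xs)"
  unfolding decidable_def[of _ "\<lambda>xs. P xs \<and> Q xs"] decidable_def[of _ Q]
  by (rule total_rec_cong[OF total_rec_if[OF _ _ total_rec_const, of n P "\<lambda>xs. of_bool (Q xs)" 0]])
    auto

lemma decidable_disj: "decidable n P \<Longrightarrow> decidable n Q \<Longrightarrow> decidable n (\<lambda>xs. P xs \<or> Q xs)"
  using decidable_not[OF decidable_conj[OF decidable_not decidable_not, of n P Q]] by simp

lemma decidable_const: "decidable n (\<lambda>xs. b)"
  unfolding decidable_def by (rule total_rec_const)

lemma decidable_Ball_list: "(\<And>a. a \<in> set as \<Longrightarrow> decidable n (P a)) \<Longrightarrow> decidable n (\<lambda>xs. \<forall>a\<in>set as. P a xs)"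
  by (induction as) (auto intro: decidable_const decidable_conj)

lemma decidable_Bex_finite:
  assumes "finite A" and "\<And>a. a \<in> A \<Longrightarrow> decidable n (P a)"
  shows "decidable n (\<lambda>xs. \<exists>a\<in>A. P a xs)"
  using assms by (induction A) (auto intro: decidable_const decidable_disj)

lemma total_rec_pred: "total_rec n A \<Longrightarrow> total_rec n (\<lambda>xs. A xs - 1)"
proof -
  have *: "rec_nat 0 (\<lambda>k r. k) b = b - 1" for b :: nat
    by (cases b) auto
  assume "total_rec n A"
  then show ?thesis
    by (rule_tac total_rec_cong[OF total_rec_prim_at[of n "\<lambda>_. 0" "\<lambda>xs. xs ! 1" A]])
      (auto intro: total_rec_const total_rec_nth simp: *[simplified])
qed

lemma total_rec_diff:
  assumes "total_rec n A" "total_rec n B"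
  shows "total_rec n (\<lambda>xs. A xs - B xs)"
proof -
  have *: "rec_nat a (\<lambda>k r. r - 1) b = a - b" for a b :: nat
    by (induction b) auto
  show ?thesis
    by (rule total_rec_cong[OF total_rec_prim_at[of n A "\<lambda>xs. xs ! 0 - 1" B]])
      (use assms in \<open>auto intro!: total_rec_pred[simplified] total_rec_nth simp: *[simplified]\<close>)
qed

lemma total_rec_add:
  assumes "total_rec n A" "total_rec n B"
  shows "total_rec n (\<lambda>xs. A xs + B xs)"
proof -
  have *: "rec_nat a (\<lambda>k r. Suc r) b = a + b" for a b :: nat
    by (induction b) auto
  show ?thesis
    by (rule total_rec_cong[OF total_rec_prim_at[of n A "\<lambda>xs. Suc (xs ! 0)" B]])
      (auto intro!: assms total_rec_Suc total_rec_nth simp: *)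
qed

lemma decidable_le: "total_rec n A \<Longrightarrow> total_rec n B \<Longrightarrow> decidable n (\<lambda>xs. A xs \<le> B xs)"
  unfolding decidable_def
  by (rule total_rec_cong[OF total_rec_case_nat[of n "\<lambda>_. 1" "\<lambda>_. 0" "\<lambda>xs. A xs - B xs"]])
    (auto intro: total_rec_const total_rec_diff)

lemma decidable_eq: "total_rec n A \<Longrightarrow> total_rec n B \<Longrightarrow> decidable n (\<lambda>xs. A xs = B xs)"
  by (rule decidable_cong[OF decidable_conj[OF decidable_le[of n A B] decidable_le[of n B A]]]) auto

lemma decidable_less: "total_rec n A \<Longrightarrow> total_rec n B \<Longrightarrow> decidable n (\<lambda>xs. A xs < B xs)"
  by (rule decidable_cong[OF decidable_le[OF total_rec_Suc, of n A B]]) auto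

lemma decidable_ex_less:
  assumes P: "decidable (Suc n) P" and B: "total_rec n B"
  shows "decidable n (\<lambda>xs. \<exists>k<B xs. P (k # xs))"
proof -
  let ?Gs = "map (\<lambda>i xs. xs ! Suc i) [0..<Suc n]"
  have "total_rec (Suc (Suc n)) (\<lambda>xs. of_bool (P (map (\<lambda>H. H xs) ?Gs)))"
    by (rule total_rec_comp[of ?Gs "\<lambda>xs. of_bool (P xs)"])
      (use P in \<open>auto intro: total_rec_nth simp: decidable_def\<close>)
  then have 1: "total_rec (Suc (Suc n)) (\<lambda>xs. of_bool (P (tl xs)))"
  proof (rule total_rec_cong)
    fix xs :: "nat list" assume "length xs = Suc (Suc n)"
    moreover have "map ((!) (y # ys)) [0..<Suc (length ys)] = y # ys" for y :: nat and ys
      using map_nth[of "y # ys"] by simp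
    ultimately show "of_bool (P (map (\<lambda>H. H xs) ?Gs)) = (of_bool (P (tl xs)) :: nat)"
      by (auto simp: comp_def length_Suc_conv simp del: upt_Suc)
  qed
  \<comment> \<open>The accumulator is a flag: 1 means that a witness below the counter has been
    found.\<close>
  have "decidable (Suc (Suc n)) (\<lambda>xs. xs ! 0 = 1 \<or> P (tl xs))"
    by (intro decidable_disj decidable_eq total_rec_nth total_rec_const)
      (use 1 in \<open>auto simp: decidable_def\<close>)
  then have "total_rec (Suc (Suc n)) (\<lambda>xs. of_bool (xs ! 0 = 1 \<or> P (tl xs)))"
    by (simp add: decidable_def)
  from total_rec_prim_at[OF total_rec_const[of n 0] this B]
  have 2: "total_rec n (\<lambda>xs. rec_nat 0 (\<lambda>k r. of_bool (r = 1 \<or> P (k # xs))) (B xs))"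
    by simp
  have 3: "rec_nat 0 (\<lambda>k r. of_bool (r = 1 \<or> P (k # xs))) b = of_bool (\<exists>k<b. P (k # xs))" for xs b
    by (induction b) (auto simp: less_Suc_eq)
  show ?thesis
    using 2 unfolding decidable_def 3 by simp
qed

lemma decidable_all_less:
  assumes "decidable (Suc n) P" "total_rec n B"
  shows "decidable n (\<lambda>xs. \<forall>k<B xs. P (k # xs))"
  using decidable_not[OF decidable_ex_less[OF decidable_not[OF assms(1)] assms(2)]] by simp

text \<open>\<open>Mn\<close> looks for a zero and wants all earlier values defined and positive.
  The characteristic function of the negation of \<open>P\<close> behaves like this, and
  \<open>ex\<close> makes the search terminate.\<close>

lemma total_rec_Least:
  assumes P: "decidable (Suc n) P" and ex: "\<And>xs. length xs = n \<Longrightarrow> \<exists>k. P (k # xs)"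
  shows "total_rec n (\<lambda>xs. LEAST k. P (k # xs))"
proof -
  from decidable_not[OF P] obtain f where
    f: "\<And>xs. length xs = Suc n \<Longrightarrow> eval f xs (of_bool (\<not> P xs))"
    by (auto simp: decidable_def total_rec_def)
  have "eval (Mn f) xs (LEAST k. P (k # xs))" if xs: "length xs = n" for xs
  proof (rule eval.ev_Mn)
    have "P ((LEAST k. P (k # xs)) # xs)" using LeastI_ex[OF ex[OF xs]] .
    with f[of "(LEAST k. P (k # xs)) # xs"] xs show "eval f ((LEAST k. P (k # xs)) # xs) 0"
      by simp
    show "\<forall>m<LEAST k. P (k # xs). \<exists>y>0. eval f (m # xs) y"
    proof (intro allI impI)
      fix m assume "m < (LEAST k. P (k # xs))"
      then have "\<not> P (m # xs)" by (rule not_less_Least)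
      with f[of "m # xs"] xs show "\<exists>y>0. eval f (m # xs) y" by (intro exI[of _ 1]) simp
    qed
  qed
  then show ?thesis by (auto simp: total_rec_def)
qed

text \<open>The search for a witness halts exactly when there is one, so the projection is its
  domain. Enumerability is thereby reduced to exhibiting certificates \<open>k\<close> that can be
  checked.\<close>

lemma RE_nat_ex:
  assumes "decidable 2 P"
  shows "RE_nat {n. \<exists>k. P [k, n]}"
proof -
  from decidable_not[OF assms] obtain f where
    f: "\<And>xs. length xs = 2 \<Longrightarrow> eval f xs (of_bool (\<not> P xs))"
    by (auto simp: decidable_def total_rec_def)
  have "(\<exists>k. P [k, n]) \<longleftrightarrow> (\<exists>y. eval (Mn f) [n] y)" for n
  proof
    assume ex: "\<exists>k. P [k, n]"
    have "eval (Mn f) [n] (LEAST k. P [k, n])"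
    proof (rule eval.ev_Mn)
      show "eval f [LEAST k. P [k, n], n] 0"
        using f[of "[LEAST k. P [k, n], n]"] LeastI_ex[OF ex] by simp
      show "\<forall>m<LEAST k. P [k, n]. \<exists>y>0. eval f [m, n] y"
        using f[of "[_, n]"] by (auto dest!: not_less_Least intro!: exI[of _ 1])
          (metis (full_types) One_nat_def of_bool_eq_1_iff)
    qed
    then show "\<exists>y. eval (Mn f) [n] y" by blast
  next
    assume "\<exists>y. eval (Mn f) [n] y"
    then obtain k where "eval f [k, n] 0" by (auto elim: eval_MnE)
    moreover have "eval f [k, n] (of_bool (\<not> P [k, n]))" using f by simp
    ultimately have "of_bool (\<not> P [k, n]) = (0::nat)" using eval_det by blast
    then show "\<exists>k. P [k, n]" by auto
  qed
  then show ?thesis unfolding RE_nat_def by auto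
qed

section \<open>Pairing and list codes\<close>

lemma total_rec_triangle: "total_rec n A \<Longrightarrow> total_rec n (\<lambda>xs. triangle (A xs))"
proof -
  have *: "rec_nat 0 (\<lambda>k r. r + Suc k) b = triangle b" for b
    by (induction b) auto
  show "total_rec n A \<Longrightarrow> ?thesis"
    by (rule total_rec_cong[OF total_rec_prim_at[of n "\<lambda>_. 0" "\<lambda>xs. xs ! 0 + Suc (xs ! 1)" A]])
      (auto intro!: total_rec_Suc total_rec_add total_rec_nth total_rec_const simp: *[simplified])
qed

lemma total_rec_prod_encode:
  "total_rec n A \<Longrightarrow> total_rec n B \<Longrightarrow> total_rec n (\<lambda>xs. prod_encode (A xs, B xs))"
  unfolding prod_encode_def by (simp add: total_rec_add total_rec_triangle)

text \<open>Decoding is a search: no component exceeds the code of the pair, which bounds the inner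
  quantifier by \<open>Suc n\<close>, and injectivity of \<open>prod_encode\<close> makes the least
  solution the only one.\<close>

lemma total_rec_fst: "total_rec n A \<Longrightarrow> total_rec n (\<lambda>xs. fst (prod_decode (A xs)))"
proof (rule total_rec_1[of "\<lambda>x. fst (prod_decode x)"])
  have "decidable 2 (\<lambda>xs. \<exists>b<Suc (xs ! 1). prod_encode ((b # xs) ! 1, (b # xs) ! 0) = (b # xs) ! 2)"
    by (rule decidable_ex_less[where P = "\<lambda>xs. prod_encode (xs ! 1, xs ! 0) = xs ! 2"])
      (auto intro!: decidable_eq total_rec_prod_encode total_rec_nth total_rec_Suc)
  then have dec: "decidable (Suc 1) (\<lambda>xs. \<exists>b<Suc (xs ! 1). prod_encode (xs ! 0, b) = xs ! 1)"
    by (simp add: numeral_2_eq_2)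
  have ex: "\<exists>b<Suc n. prod_encode (fst (prod_decode n), b) = n" for n
    using le_prod_encode_2[of "snd (prod_decode n)" "fst (prod_decode n)"]
    by (intro exI[of _ "snd (prod_decode n)"]) (auto simp: less_Suc_eq_le)
  have "\<exists>k. \<exists>b<Suc ((k # xs) ! 1). prod_encode ((k # xs) ! 0, b) = (k # xs) ! 1" for xs
    using ex[of "xs ! 0"] by (rule_tac exI[of _ "fst (prod_decode (xs ! 0))"]) simp
  then have "total_rec 1 (\<lambda>xs. LEAST k. (\<exists>b<Suc ((k # xs) ! 1). prod_encode ((k # xs) ! 0, b) = (k # xs) ! 1))"
    by (rule total_rec_Least[OF dec])
  moreover have "(LEAST k. \<exists>b<Suc n. prod_encode (k, b) = n) = fst (prod_decode n)" for n
    by (rule Least_equality) (use ex in auto)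
  ultimately show "total_rec 1 (\<lambda>xs. fst (prod_decode (xs ! 0)))" by simp
qed

lemma total_rec_snd: "total_rec n A \<Longrightarrow> total_rec n (\<lambda>xs. snd (prod_decode (A xs)))"
proof (rule total_rec_1[of "\<lambda>x. snd (prod_decode x)"])
  have "decidable (Suc 1) (\<lambda>xs. prod_encode (fst (prod_decode (xs ! 1)), xs ! 0) = xs ! 1)"
    by (intro decidable_eq total_rec_prod_encode total_rec_nth total_rec_fst) auto
  then have "total_rec 1 (\<lambda>xs. LEAST k. prod_encode (fst (prod_decode ((k # xs) ! 1)), (k # xs) ! 0) = (k # xs) ! 1)"
    by (rule total_rec_Least) (metis nth_Cons_0 One_nat_def nth_Cons_Suc prod.collapse prod_decode_inverse)
  moreover have "(LEAST k. prod_encode (fst (prod_decode n), k) = n) = snd (prod_decode n)" for n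
    by (rule Least_equality) (auto, metis order_refl prod_encode_inverse snd_conv)
  ultimately show "total_rec 1 (\<lambda>xs. snd (prod_decode (xs ! 0)))" by simp
qed

text \<open>\<open>list_encode (x # xs)\<close> is
  \<open>Suc (prod_encode (x, list_encode xs))\<close>, whence the subtractions of 1. Being total,
  the function turns every natural number into an infinite array, so certificates and environments
  have no malformed codes.\<close>

definition code_nth :: "nat \<Rightarrow> nat \<Rightarrow> nat" where
  "code_nth d i = fst (prod_decode (((\<lambda>d. snd (prod_decode (d - 1))) ^^ i) d - 1))"

lemma code_nth_list_encode: "i < length xs \<Longrightarrow> code_nth (list_encode xs) i = xs ! i"
proof (induction xs arbitrary: i)
  case (Cons x xs)
  then show ?case
    by (cases i) (auto simp: code_nth_def funpow_Suc_right simp del: funpow.simps)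
qed simp

lemma total_rec_code_nth:
  assumes "total_rec n A" "total_rec n B"
  shows "total_rec n (\<lambda>xs. code_nth (A xs) (B xs))"
proof -
  have *: "rec_nat d (\<lambda>k r. h r) i = (h ^^ i) d" for d i and h :: "nat \<Rightarrow> nat"
    by (induction i) auto
  have "total_rec n (\<lambda>xs. ((\<lambda>d. snd (prod_decode (d - 1))) ^^ B xs) (A xs))"
    by (rule total_rec_cong[OF total_rec_prim_at[of n A "\<lambda>xs. snd (prod_decode (xs ! 0 - 1))" B]])
      (auto intro!: assms total_rec_snd total_rec_pred[simplified] total_rec_nth simp: *[simplified] *)
  then show ?thesis
    unfolding code_nth_def by (intro total_rec_fst total_rec_pred)
qed

section \<open>Horn programs\<close>

text \<open>\<open>Succ\<close> is present because the code of a nonempty word is the successor of a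
  pair.\<close>

datatype tm = Var nat | Const nat | Succ tm | Pair tm tm

primrec val :: "(nat \<Rightarrow> nat) \<Rightarrow> tm \<Rightarrow> nat" where
  "val \<rho> (Var i) = \<rho> i"
| "val \<rho> (Const c) = c"
| "val \<rho> (Succ t) = Suc (val \<rho> t)"
| "val \<rho> (Pair s t) = prod_encode (val \<rho> s, val \<rho> t)"

inductive_set derives :: "(tm list \<times> tm) set \<Rightarrow> nat set" for Rs where
  rule: "(ps, c) \<in> Rs \<Longrightarrow> (\<And>p. p \<in> set ps \<Longrightarrow> val \<rho> p \<in> derives Rs) \<Longrightarrow> val \<rho> c \<in> derives Rs"

lemma derives_subsetI:
  assumes "\<And>ps c \<rho>. (ps, c) \<in> Rs \<Longrightarrow> (\<And>p. p \<in> set ps \<Longrightarrow> val \<rho> p \<in> M) \<Longrightarrow> val \<rho> c \<in> M"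
  shows "derives Rs \<subseteq> M"
proof
  fix x assume "x \<in> derives Rs"
  then show "x \<in> M" by induction (rule assms)
qed

lemma val_cong_code: "\<exists>K. \<forall>e. (\<forall>i<K. code_nth e i = \<rho> i) \<longrightarrow> val (code_nth e) t = val \<rho> t"
proof (induction t)
  case (Var i)
  show ?case by (rule exI[of _ "Suc i"]) simp
next
  case (Pair s t)
  then obtain K L where "\<forall>e. (\<forall>i<K. code_nth e i = \<rho> i) \<longrightarrow> val (code_nth e) s = val \<rho> s"
    "\<forall>e. (\<forall>i<L. code_nth e i = \<rho> i) \<longrightarrow> val (code_nth e) t = val \<rho> t" by blast
  then show ?case by (intro exI[of _ "max K L"]) auto
qed auto

text \<open>Finitely many terms mention finitely many variables, so a finite list of values can
  replace an arbitrary environment.\<close>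

lemma code_env:
  assumes "finite T"
  shows "\<exists>e. \<forall>t\<in>T. val (code_nth e) t = val \<rho> t"
proof -
  obtain K where K: "\<And>t e. \<forall>i<K t. code_nth e i = \<rho> i \<Longrightarrow> val (code_nth e) t = val \<rho> t"
    using val_cong_code[of \<rho>] by metis
  obtain m where m: "\<And>t. t \<in> T \<Longrightarrow> K t \<le> m"
    using finite_nat_set_iff_bounded_le[of "K ` T"] assms by auto
  have "code_nth (list_encode (map \<rho> [0..<m])) i = \<rho> i" if "i < m" for i
    using that by (subst code_nth_list_encode) auto
  with K m show ?thesis
    by (intro exI[of _ "list_encode (map \<rho> [0..<m])"]) (meson order_less_le_trans)
qed

text \<open>A certificate, with every conclusion to the left of its premises. An entry
  \<open>(x, e)\<close> stores the code \<open>e\<close> of the instantiation next to the fact, so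
  that checking involves no search for a substitution.\<close>

fun derivation :: "(tm list \<times> tm) set \<Rightarrow> (nat \<times> nat) list \<Rightarrow> bool" where
  "derivation Rs [] \<longleftrightarrow> True"
| "derivation Rs (x # l) \<longleftrightarrow> derivation Rs l \<and>
     (\<exists>r\<in>Rs. val (code_nth (snd x)) (snd r) = fst x \<and>
        (\<forall>p\<in>set (fst r). val (code_nth (snd x)) p \<in> fst ` set l))"

lemma derivation_append: "derivation Rs l \<Longrightarrow> derivation Rs l' \<Longrightarrow> derivation Rs (l @ l')"
proof (induction l)
  case (Cons x l)
  then obtain r where "r \<in> Rs" "val (code_nth (snd x)) (snd r) = fst x"
    "\<forall>p\<in>set (fst r). val (code_nth (snd x)) p \<in> fst ` set l" by auto
  moreover have "derivation Rs (l @ l')" using Cons by simp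
  ultimately show ?case by (simp add: image_Un) blast
qed simp

lemma derivation_sound: "derivation Rs l \<Longrightarrow> fst ` set l \<subseteq> derives Rs"
proof (induction l)
  case (Cons x l)
  then obtain ps c where r: "(ps, c) \<in> Rs" "val (code_nth (snd x)) c = fst x"
     "\<forall>p\<in>set ps. val (code_nth (snd x)) p \<in> fst ` set l" by auto
  have "val (code_nth (snd x)) c \<in> derives Rs"
    by (rule derives.rule[OF r(1)]) (use Cons r(3) in auto)
  with r(2) Cons show ?case by auto
qed simp

text \<open>Certificates can be concatenated, so finitely many facts share one.\<close>

lemma derivation_complete:
  assumes "finite X" "\<And>x. x \<in> X \<Longrightarrow> \<exists>l. derivation Rs l \<and> x \<in> fst ` set l"
  shows "\<exists>l. derivation Rs l \<and> X \<subseteq> fst ` set l"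
  using assms
proof (induction X)
  case (insert x X)
  then obtain l l' where "derivation Rs l" "x \<in> fst ` set l" "derivation Rs l'" "X \<subseteq> fst ` set l'"
    by (metis insertCI)
  then show ?case by (intro exI[of _ "l @ l'"]) (auto intro: derivation_append)
qed (auto intro: exI[of _ "[]"])

lemma derives_imp_derivation: "x \<in> derives Rs \<Longrightarrow> \<exists>e l. derivation Rs ((x, e) # l)"
proof (induction rule: derives.induct)
  case (rule ps c \<rho>)
  have "\<exists>l. derivation Rs l \<and> val \<rho> ` set ps \<subseteq> fst ` set l"
  proof (rule derivation_complete)
    fix x assume "x \<in> val \<rho> ` set ps"
    then obtain e l where "derivation Rs ((x, e) # l)" using rule.IH by blast
    then show "\<exists>l. derivation Rs l \<and> x \<in> fst ` set l" by (intro exI[of _ "(x, e) # l"]) auto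
  qed simp
  then obtain l where l: "derivation Rs l" "val \<rho> ` set ps \<subseteq> fst ` set l" by blast
  obtain e where e: "\<forall>t\<in>insert c (set ps). val (code_nth e) t = val \<rho> t"
    using code_env[of "insert c (set ps)"] by auto
  show ?case
    using l e rule.hyps(1) by (intro exI[of _ e] exI[of _ l]) (auto intro!: bexI[of _ "(ps, c)"])
qed

lemma derivation_nth:
  "derivation Rs l \<longleftrightarrow> (\<forall>i<length l. \<exists>r\<in>Rs. val (code_nth (snd (l ! i))) (snd r) = fst (l ! i) \<and>
     (\<forall>p\<in>set (fst r). \<exists>j<length l. i < j \<and> val (code_nth (snd (l ! i))) p = fst (l ! j)))"
proof (induction l)
  case (Cons x l)
  have "a \<in> fst ` set l \<longleftrightarrow> (\<exists>j<Suc (length l). 0 < j \<and> a = fst ((x # l) ! j))" for a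
    unfolding set_conv_nth Ex_less_Suc2 by auto
  moreover have "(\<exists>j<Suc (length l). Suc i < j \<and> a = fst ((x # l) ! j)) \<longleftrightarrow>
      (\<exists>j<length l. i < j \<and> a = fst (l ! j))" for a i
    by (simp add: Ex_less_Suc2)
  ultimately show ?case by (simp only: derivation.simps list.size add_Suc_right add_0_right
      All_less_Suc2 nth_Cons_0 nth_Cons_Suc Cons conj_commute)
qed simp

lemma total_rec_val: "total_rec n E \<Longrightarrow> total_rec n (\<lambda>xs. val (code_nth (E xs)) t)"
  by (induction t)
    (auto intro: total_rec_code_nth total_rec_const total_rec_Suc total_rec_prod_encode)

text \<open>The certificate is a single number: the code of the list of entries paired with its
  length, which \<open>code_nth\<close> cannot recover. Entry 0 has to be the goal
  \<open>g n\<close>.\<close>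

theorem RE_nat_derives:
  assumes fin: "finite Rs" and g: "total_rec 1 (\<lambda>xs. g (xs ! 0))"
  shows "RE_nat {n. g n \<in> derives Rs}"
proof -
  define entry where "entry k i = prod_decode (code_nth (fst (prod_decode k)) i)" for k i
  define ok where "ok k \<longleftrightarrow> (\<forall>i<snd (prod_decode k).
      \<exists>r\<in>Rs. val (code_nth (snd (entry k i))) (snd r) = fst (entry k i) \<and>
       (\<forall>p\<in>set (fst r). \<exists>j<snd (prod_decode k). i < j \<and> val (code_nth (snd (entry k i))) p = fst (entry k j)))"
    for k
  have ok: "ok k \<longleftrightarrow> derivation Rs (map (entry k) [0..<snd (prod_decode k)])" for k
    unfolding derivation_nth ok_def by (simp cong: conj_cong)
  have "(g n \<in> derives Rs) \<longleftrightarrow> (\<exists>k. 0 < snd (prod_decode k) \<and> fst (entry k 0) = g n \<and> ok k)" for n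
  proof
    assume "g n \<in> derives Rs"
    then obtain e l where l: "derivation Rs ((g n, e) # l)" using derives_imp_derivation by blast
    define D where "D = map prod_encode ((g n, e) # l)"
    define k where "k = prod_encode (list_encode D, length D)"
    have "entry k i = ((g n, e) # l) ! i" if "i < length D" for i
      using that unfolding entry_def k_def by (simp add: code_nth_list_encode) (simp add: D_def del: list.map)
    then have "map (entry k) [0..<length D] = (g n, e) # l" "entry k 0 = (g n, e)"
      by (auto intro!: nth_equalityI simp: D_def simp del: upt_Suc)
    with l have "0 < snd (prod_decode k) \<and> fst (entry k 0) = g n \<and> ok k"
      unfolding ok by (simp add: k_def) (simp add: D_def)
    then show "\<exists>k. 0 < snd (prod_decode k) \<and> fst (entry k 0) = g n \<and> ok k" ..
  next
    assume "\<exists>k. 0 < snd (prod_decode k) \<and> fst (entry k 0) = g n \<and> ok k"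
    then obtain k where "0 < snd (prod_decode k)" "fst (entry k 0) = g n" "ok k" by blast
    then show "g n \<in> derives Rs"
      using derivation_sound[of Rs "map (entry k) [0..<snd (prod_decode k)]"]
      by (simp add: ok image_subset_iff) (metis atLeastLessThan_iff le0)
  qed
  moreover have "RE_nat {n. \<exists>k. 0 < snd (prod_decode ([k, n] ! 0)) \<and> fst (entry ([k, n] ! 0) 0) = g ([k, n] ! 1) \<and> ok ([k, n] ! 0)}"
  proof (rule RE_nat_ex[where P = "\<lambda>xs. 0 < snd (prod_decode (xs ! 0)) \<and> fst (entry (xs ! 0) 0) = g (xs ! 1) \<and> ok (xs ! 0)"],
      intro decidable_conj)
    show "decidable 2 (\<lambda>xs. 0 < snd (prod_decode (xs ! 0)))"
      by (intro decidable_less total_rec_const total_rec_snd total_rec_nth) simp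
    show "decidable 2 (\<lambda>xs. fst (entry (xs ! 0) 0) = g (xs ! 1))"
      unfolding entry_def
      by (intro decidable_eq total_rec_1[OF g] total_rec_fst total_rec_code_nth total_rec_const total_rec_nth) auto
    \<comment> \<open>The argument list is \<open>[j, i, k, n]\<close>, since every bounded
      quantifier pushes its variable in front.\<close>
    have 4: "decidable (Suc 3) (\<lambda>xs. xs ! 1 < xs ! 0 \<and>
        val (code_nth (snd (entry (xs ! 2) (xs ! 1)))) p = fst (entry (xs ! 2) (xs ! 0)))" for p
      unfolding entry_def
      by (intro decidable_conj decidable_less decidable_eq total_rec_val total_rec_fst total_rec_snd
          total_rec_code_nth total_rec_nth) auto
    have 3: "decidable 3 (\<lambda>xs. \<exists>j<snd (prod_decode (xs ! 1)). xs ! 0 < j \<and>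
        val (code_nth (snd (entry (xs ! 1) (xs ! 0)))) p = fst (entry (xs ! 1) j))" for p
      using decidable_ex_less[OF 4[of p], of "\<lambda>xs. snd (prod_decode (xs ! 1))"]
      by (simp add: total_rec_snd total_rec_nth)
    have "decidable (Suc 2) (\<lambda>xs.
      \<exists>r\<in>Rs. val (code_nth (snd (entry (xs ! 1) (xs ! 0)))) (snd r) = fst (entry (xs ! 1) (xs ! 0)) \<and>
       (\<forall>p\<in>set (fst r). \<exists>j<snd (prod_decode (xs ! 1)). xs ! 0 < j \<and>
         val (code_nth (snd (entry (xs ! 1) (xs ! 0)))) p = fst (entry (xs ! 1) j)))"
      using 3
      by (intro decidable_Bex_finite fin decidable_conj decidable_Ball_list, unfold entry_def)
        ((intro decidable_eq total_rec_val total_rec_fst total_rec_snd total_rec_code_nth total_rec_nth; simp), simp)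
    from decidable_all_less[OF this, of "\<lambda>xs. snd (prod_decode (xs ! 0))"]
    show "decidable 2 (\<lambda>xs. ok (xs ! 0))"
      unfolding ok_def by (simp add: total_rec_snd total_rec_nth)
  qed
  ultimately show ?thesis by simp
qed

section \<open>Equality in finitely generated rings of real numbers\<close>

definition zero_code :: nat where "zero_code = prod_encode (4, 0)"
definition one_code :: nat where "one_code = prod_encode (5, 0)"
definition gen_code :: "nat \<Rightarrow> nat" where "gen_code i = prod_encode (0, i)"
definition plus_code :: "nat \<Rightarrow> nat \<Rightarrow> nat" where "plus_code a b = prod_encode (1, prod_encode (a, b))"
definition times_code :: "nat \<Rightarrow> nat \<Rightarrow> nat" where "times_code a b = prod_encode (2, prod_encode (a, b))"
definition neg_code :: "nat \<Rightarrow> nat" where "neg_code a = prod_encode (3, a)"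

text \<open>Termination of \<open>tval\<close>: it recurses only under the tags 1, 2 and 3, and a
  positive tag makes the payload smaller than the code.\<close>

lemma snd_prod_decode_less: "0 < fst (prod_decode n) \<Longrightarrow> snd (prod_decode n) < n"
proof -
  assume "0 < fst (prod_decode n)"
  then have "snd (prod_decode n) < prod_encode (prod_decode n)"
    by (cases "prod_decode n") (auto simp: prod_encode_def gr0_conv_Suc intro: le_imp_less_Suc)
  then show ?thesis by simp
qed

lemma fst_prod_decode_le: "fst (prod_decode n) \<le> n"
  using le_prod_encode_1[of "fst (prod_decode n)" "snd (prod_decode n)"] by simp

lemma snd_prod_decode_le: "snd (prod_decode n) \<le> n"
  using le_prod_encode_2[of "snd (prod_decode n)" "fst (prod_decode n)"] by simp

text \<open>Every natural number denotes some element, so that soundness of the rules does not need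
  a well-formedness condition on the instances of rule variables.\<close>

function tval :: "(nat \<Rightarrow> real) \<Rightarrow> nat \<Rightarrow> real" where
  "tval x n = (let m = snd (prod_decode n) in
     if fst (prod_decode n) = 0 then x m
     else if fst (prod_decode n) = 1 then tval x (fst (prod_decode m)) + tval x (snd (prod_decode m))
     else if fst (prod_decode n) = 2 then tval x (fst (prod_decode m)) * tval x (snd (prod_decode m))
     else if fst (prod_decode n) = 3 then - tval x m
     else if fst (prod_decode n) = 4 then 0 else 1)"
  by auto
termination
  by (relation "Wellfounded.measure snd")
    (auto intro: snd_prod_decode_less intro!: le_less_trans[OF fst_prod_decode_le snd_prod_decode_less]
      le_less_trans[OF snd_prod_decode_le snd_prod_decode_less])

declare tval.simps [simp del]

lemma tval_simps [simp]:
  "tval x zero_code = 0" "tval x one_code = 1" "tval x (gen_code i) = x i"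
  "tval x (plus_code a b) = tval x a + tval x b" "tval x (times_code a b) = tval x a * tval x b"
  "tval x (neg_code a) = - tval x a"
  unfolding zero_code_def one_code_def gen_code_def plus_code_def times_code_def neg_code_def
  by (subst tval.simps; simp add: Let_def)+

definition "Plus s t = Pair (Const 1) (Pair s t)"
definition "Times s t = Pair (Const 2) (Pair s t)"
definition "Neg s = Pair (Const 3) s"

lemma val_ring [simp]:
  "val \<rho> (Plus s t) = plus_code (val \<rho> s) (val \<rho> t)"
  "val \<rho> (Times s t) = times_code (val \<rho> s) (val \<rho> t)"
  "val \<rho> (Neg s) = neg_code (val \<rho> s)"
  by (simp_all add: Plus_def Times_def Neg_def plus_code_def times_code_def neg_code_def)

definition "Eq s t = Pair (Const 0) (Pair s t)"

definition eq_fact :: "nat \<Rightarrow> nat \<Rightarrow> nat" where "eq_fact a b = prod_encode (0, prod_encode (a, b))"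

lemma val_Eq [simp]: "val \<rho> (Eq s t) = eq_fact (val \<rho> s) (val \<rho> t)"
  by (simp add: Eq_def eq_fact_def)

text \<open>Tailored identities rather than a basis of ring axioms: simplification with zero and
  one, cancellation of leading terms in pseudo-division, arithmetic of Horner forms in the variable
  \<open>x\<close>, and arithmetic of numerals and their differences.\<close>

definition identities :: "(tm \<times> tm) list" where
  "identities =
    (let a = Var 0; b = Var 1; c = Var 2; d = Var 3; x = Var 4; z = Const zero_code; u = Const one_code in
    [(Plus z a, a), (Plus a z, a), (Times a z, z), (Times z a, z), (Neg z, z), (Times a u, a),
     (Plus a (Neg a), z), (Plus (Times a c) (Times (Neg c) a), z),
     (Plus a (Times x z), a),
     (Plus (Plus c (Times x a)) (Plus d (Times x b)), Plus (Plus c d) (Times x (Plus a b))),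
     (Neg (Plus c (Times x a)), Plus (Neg c) (Times x (Neg a))),
     (Times (Plus c (Times x a)) b, Plus (Times c b) (Times x (Times a b))),
     (Times c (Plus d (Times x b)), Plus (Times c d) (Times x (Times c b))),
     (Plus (Plus a b) c, Plus a (Plus b c)),
     (Times (Plus a b) c, Plus (Times a c) (Times b c)),
     (Plus (Plus a (Neg b)) (Plus c (Neg d)), Plus (Plus a c) (Neg (Plus b d))),
     (Neg (Plus a (Neg b)), Plus b (Neg a)),
     (Times (Plus a (Neg b)) (Plus c (Neg d)),
       Plus (Plus (Times a c) (Times b d)) (Neg (Plus (Times a d) (Times b c))))])"

definition equality_rules :: "(tm list \<times> tm) set" where
  "equality_rules =
    (let a = Var 0; b = Var 1; c = Var 2; d = Var 3 in
    {([], Eq a a), ([Eq a b], Eq b a), ([Eq a b, Eq b c], Eq a c), ([Eq a b], Eq (Neg a) (Neg b)),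
     ([Eq a b, Eq c d], Eq (Plus a c) (Plus b d)), ([Eq a b, Eq c d], Eq (Times a c) (Times b d))}
    \<union> (\<lambda>(s, t). ([], Eq s t)) ` set identities)"

lemma finite_equality_rules: "finite equality_rules"
  by (simp add: equality_rules_def Let_def)

inductive_set terms :: "nat \<Rightarrow> nat set" for k where
  "zero_code \<in> terms k"
| "one_code \<in> terms k"
| "i < k \<Longrightarrow> gen_code i \<in> terms k"
| "a \<in> terms k \<Longrightarrow> b \<in> terms k \<Longrightarrow> plus_code a b \<in> terms k"
| "a \<in> terms k \<Longrightarrow> b \<in> terms k \<Longrightarrow> times_code a b \<in> terms k"
| "a \<in> terms k \<Longrightarrow> neg_code a \<in> terms k"

fun horner :: "nat \<Rightarrow> nat list \<Rightarrow> nat" where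
  "horner g [] = zero_code"
| "horner g (c # p) = plus_code c (times_code g (horner g p))"

text \<open>A polynomial relation for the \<open>k\<close>-th generator over the ring of the earlier
  ones, lowest coefficient first. Coefficients are codes, and a code other than
  \<open>zero_code\<close> may still denote 0; the last conjunct ensures a true leading coefficient
  and, together with the root condition, excludes constants.\<close>

definition annihilator :: "(nat \<Rightarrow> real) \<Rightarrow> nat \<Rightarrow> nat list \<Rightarrow> bool" where
  "annihilator x k m \<longleftrightarrow> m \<noteq> [] \<and> set m \<subseteq> terms k \<and> tval x (horner (gen_code k) m) = 0 \<and> tval x (last m) \<noteq> 0"

definition min_annihilator :: "(nat \<Rightarrow> real) \<Rightarrow> nat \<Rightarrow> nat list" where
  "min_annihilator x k = arg_min length (annihilator x k)"

text \<open>The relations of the extension of the ring by its \<open>k\<close>-th generator: a minimal polynomial over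
  the previous ring, and cancellation of its leading coefficient.\<close>

definition extension_rules :: "(nat \<Rightarrow> real) \<Rightarrow> nat \<Rightarrow> (tm list \<times> tm) set" where
  "extension_rules x k = (if \<exists>m. annihilator x k m then
     {([], Eq (Const (horner (gen_code k) (min_annihilator x k))) (Const zero_code)),
      ([Eq (Times (Const (last (min_annihilator x k))) (Var 0)) (Const zero_code)], Eq (Var 0) (Const zero_code))}
     else {})"

lemma annihilator_min:
  assumes "annihilator x k m"
  shows "annihilator x k (min_annihilator x k)" "length (min_annihilator x k) \<le> length m"
  unfolding min_annihilator_def
  by (rule arg_min_natI[of "annihilator x k", OF assms], rule arg_min_nat_le[of "annihilator x k", OF assms])

definition sound_rule :: "nat set \<Rightarrow> tm list \<times> tm \<Rightarrow> bool" where
  "sound_rule M r \<longleftrightarrow> (\<forall>\<rho>. (\<forall>p\<in>set (fst r). val \<rho> p \<in> M) \<longrightarrow> val \<rho> (snd r) \<in> M)"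

lemma sound_equality_rules:
  assumes "\<And>a b. eq_fact a b \<in> M \<longleftrightarrow> tval x a = tval x b" and "r \<in> equality_rules"
  shows "sound_rule M r"
proof -
  have "tval x (val \<rho> s) = tval x (val \<rho> t)" if "(s, t) \<in> set identities" for s t \<rho>
    using that unfolding identities_def Let_def
    by (simp, elim disjE conjE) (simp_all add: algebra_simps)
  then show ?thesis
    using assms(2) unfolding equality_rules_def sound_rule_def Let_def
    by (auto simp: assms(1))
qed

text \<open>Cancellation is sound because the leading coefficient denotes a nonzero real and the
  reals have no zero divisors.\<close>

lemma sound_extension_rules:
  assumes "\<And>a b. eq_fact a b \<in> M \<longleftrightarrow> tval x a = tval x b" and "r \<in> extension_rules x k"
  shows "sound_rule M r"
  using assms(2) annihilator_min(1)[of x k] unfolding extension_rules_def sound_rule_def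
  by (auto simp: assms(1) annihilator_def split: if_splits)

text \<open>Soundness is an assumption here because \<open>Rs\<close> may contain further rules,
  later those of the automaton, whose facts the ring part does not interpret.\<close>

locale ring_rules =
  fixes x :: "nat \<Rightarrow> real" and Rs :: "(tm list \<times> tm) set" and K :: nat
  assumes equality: "equality_rules \<subseteq> Rs"
    and extension: "\<And>k. k < K \<Longrightarrow> extension_rules x k \<subseteq> Rs"
    and sound: "\<And>a b. eq_fact a b \<in> derives Rs \<Longrightarrow> tval x a = tval x b"
begin

definition eqv :: "nat \<Rightarrow> nat \<Rightarrow> bool" (infix "\<doteq>" 50) where
  "a \<doteq> b \<longleftrightarrow> eq_fact a b \<in> derives Rs"

lemma apply_rule:
  "(ps, Eq s t) \<in> Rs \<Longrightarrow> \<forall>p\<in>set ps. val \<rho> p \<in> derives Rs \<Longrightarrow> val \<rho> s \<doteq> val \<rho> t"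
  using derives.rule[of ps "Eq s t" Rs \<rho>] by (simp add: eqv_def)

lemma refl [simp]: "a \<doteq> a"
  using apply_rule[of "[]" "Var 0" "Var 0" "nth [a]"] equality
  by (auto simp: equality_rules_def Let_def)

lemma sym [sym]: "a \<doteq> b \<Longrightarrow> b \<doteq> a"
  using apply_rule[of "[Eq (Var 0) (Var 1)]" "Var 1" "Var 0" "nth [a, b]"] equality
  by (auto simp: equality_rules_def Let_def eqv_def)

lemma trans [trans]: "a \<doteq> b \<Longrightarrow> b \<doteq> c \<Longrightarrow> a \<doteq> c"
  using apply_rule[of "[Eq (Var 0) (Var 1), Eq (Var 1) (Var 2)]" "Var 0" "Var 2" "nth [a, b, c]"] equality
  by (auto simp: equality_rules_def Let_def eqv_def)

lemma cong_neg: "a \<doteq> b \<Longrightarrow> neg_code a \<doteq> neg_code b"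
  using apply_rule[of "[Eq (Var 0) (Var 1)]" "Neg (Var 0)" "Neg (Var 1)" "nth [a, b]"] equality
  by (auto simp: equality_rules_def Let_def eqv_def)

lemma cong_plus: "a \<doteq> b \<Longrightarrow> c \<doteq> d \<Longrightarrow> plus_code a c \<doteq> plus_code b d"
  using apply_rule[of "[Eq (Var 0) (Var 1), Eq (Var 2) (Var 3)]" "Plus (Var 0) (Var 2)"
      "Plus (Var 1) (Var 3)" "nth [a, b, c, d]"] equality
  by (auto simp: equality_rules_def Let_def eqv_def)

lemma cong_times: "a \<doteq> b \<Longrightarrow> c \<doteq> d \<Longrightarrow> times_code a c \<doteq> times_code b d"
  using apply_rule[of "[Eq (Var 0) (Var 1), Eq (Var 2) (Var 3)]" "Times (Var 0) (Var 2)"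
      "Times (Var 1) (Var 3)" "nth [a, b, c, d]"] equality
  by (auto simp: equality_rules_def Let_def eqv_def)

lemma identity: "(s, t) \<in> set identities \<Longrightarrow> val \<rho> s \<doteq> val \<rho> t"
  using equality by (intro apply_rule[of "[]"]) (auto simp: equality_rules_def Let_def)

lemma ring_identities:
  "plus_code zero_code a \<doteq> a" "plus_code a zero_code \<doteq> a" "times_code a zero_code \<doteq> zero_code" "times_code zero_code a \<doteq> zero_code" "neg_code zero_code \<doteq> zero_code"
  "times_code a one_code \<doteq> a" "plus_code a (neg_code a) \<doteq> zero_code" "plus_code (times_code a c) (times_code (neg_code c) a) \<doteq> zero_code"
  "plus_code a (times_code y zero_code) \<doteq> a"
  "plus_code (plus_code c (times_code y a)) (plus_code d (times_code y b)) \<doteq> plus_code (plus_code c d) (times_code y (plus_code a b))"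
  "neg_code (plus_code c (times_code y a)) \<doteq> plus_code (neg_code c) (times_code y (neg_code a))"
  "times_code (plus_code c (times_code y a)) b \<doteq> plus_code (times_code c b) (times_code y (times_code a b))"
  "times_code c (plus_code d (times_code y b)) \<doteq> plus_code (times_code c d) (times_code y (times_code c b))"
  "plus_code (plus_code a b) c \<doteq> plus_code a (plus_code b c)"
  "times_code (plus_code a b) c \<doteq> plus_code (times_code a c) (times_code b c)"
  "plus_code (plus_code a (neg_code b)) (plus_code c (neg_code d)) \<doteq> plus_code (plus_code a c) (neg_code (plus_code b d))"
  "neg_code (plus_code a (neg_code b)) \<doteq> plus_code b (neg_code a)"
  "times_code (plus_code a (neg_code b)) (plus_code c (neg_code d)) \<doteq>
     plus_code (plus_code (times_code a c) (times_code b d)) (neg_code (plus_code (times_code a d) (times_code b c)))"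
proof -
  have "\<forall>(s, t) \<in> set identities. val (nth [a, b, c, d, y]) s \<doteq> val (nth [a, b, c, d, y]) t"
    using identity by blast
  note all = this[unfolded identities_def Let_def, simplified]
  show "plus_code zero_code a \<doteq> a" "plus_code a zero_code \<doteq> a" "times_code a zero_code \<doteq> zero_code" "times_code zero_code a \<doteq> zero_code" "neg_code zero_code \<doteq> zero_code"
  "times_code a one_code \<doteq> a" "plus_code a (neg_code a) \<doteq> zero_code" "plus_code (times_code a c) (times_code (neg_code c) a) \<doteq> zero_code"
  "plus_code a (times_code y zero_code) \<doteq> a"
  "plus_code (plus_code c (times_code y a)) (plus_code d (times_code y b)) \<doteq> plus_code (plus_code c d) (times_code y (plus_code a b))"
  "neg_code (plus_code c (times_code y a)) \<doteq> plus_code (neg_code c) (times_code y (neg_code a))"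
  "times_code (plus_code c (times_code y a)) b \<doteq> plus_code (times_code c b) (times_code y (times_code a b))"
  "times_code c (plus_code d (times_code y b)) \<doteq> plus_code (times_code c d) (times_code y (times_code c b))"
  "plus_code (plus_code a b) c \<doteq> plus_code a (plus_code b c)"
  "times_code (plus_code a b) c \<doteq> plus_code (times_code a c) (times_code b c)"
  "plus_code (plus_code a (neg_code b)) (plus_code c (neg_code d)) \<doteq> plus_code (plus_code a c) (neg_code (plus_code b d))"
  "neg_code (plus_code a (neg_code b)) \<doteq> plus_code b (neg_code a)"
  "times_code (plus_code a (neg_code b)) (plus_code c (neg_code d)) \<doteq>
     plus_code (plus_code (times_code a c) (times_code b d)) (neg_code (plus_code (times_code a d) (times_code b c)))"
    using all by blast+
qed

section \<open>Numerals and integers\<close>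

primrec num :: "nat \<Rightarrow> nat" where
  "num 0 = zero_code"
| "num (Suc n) = plus_code one_code (num n)"

lemma tval_num [simp]: "tval x (num n) = real n"
  by (induction n) auto

lemma num_plus: "plus_code (num m) (num n) \<doteq> num (m + n)"
proof (induction m)
  case (Suc m)
  show ?case using trans[OF ring_identities(14) cong_plus[OF refl Suc]] by simp
qed (simp add: ring_identities)

lemma num_times: "times_code (num m) (num n) \<doteq> num (m * n)"
proof (induction m)
  case (Suc m)
  have "times_code one_code (num n) \<doteq> num n" for n
  proof (induction n)
    case (Suc n)
    have "times_code one_code (plus_code one_code (times_code one_code (num n))) \<doteq> plus_code one_code (times_code one_code (num n))"
      using trans[OF ring_identities(13) cong_plus[OF ring_identities(6) cong_times[OF refl Suc]]] .
    moreover have "plus_code one_code (times_code one_code (num n)) \<doteq> num (Suc n)"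
      using cong_plus[OF refl Suc, of one_code] by simp
    ultimately show ?case by (meson cong_times refl sym trans)
  qed (simp add: ring_identities)
  then have "times_code (num (Suc m)) (num n) \<doteq> plus_code (num n) (num (m * n))"
    using trans[OF ring_identities(15) cong_plus[OF _ Suc]] by simp
  then show ?case using trans[OF _ num_plus] by simp
qed (simp add: ring_identities)

text \<open>The bottom of the tower of rings. Differences of two numerals are closed under the ring
  operations without any distinction of signs, and a difference of value 0 has the same numeral
  twice.\<close>

lemma integer_form: "t \<in> terms 0 \<Longrightarrow> \<exists>m n. t \<doteq> plus_code (num m) (neg_code (num n))"
proof (induction rule: terms.induct)
  case 1
  show ?case using ring_identities(7)[THEN sym] by blast
next
  case 2
  have "one_code \<doteq> plus_code (plus_code one_code zero_code) (neg_code zero_code)"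
    by (meson cong_plus refl ring_identities(2,5) sym trans)
  then show ?case by (metis num.simps)
next
  case (4 a b)
  then obtain m n m' n' where "a \<doteq> plus_code (num m) (neg_code (num n))" "b \<doteq> plus_code (num m') (neg_code (num n'))"
    by blast
  from trans[OF cong_plus[OF this] ring_identities(16)]
  show ?case by (meson cong_plus cong_neg num_plus trans)
next
  case (5 a b)
  then obtain m n m' n' where "a \<doteq> plus_code (num m) (neg_code (num n))" "b \<doteq> plus_code (num m') (neg_code (num n'))"
    by blast
  from trans[OF cong_times[OF this] ring_identities(18)]
  show ?case by (meson cong_plus cong_neg num_plus num_times trans)
next
  case (6 a)
  then show ?case by (meson cong_neg ring_identities(17) trans)
qed simp

section \<open>Polynomials in Horner form\<close>

definition padd :: "nat list \<Rightarrow> nat list \<Rightarrow> nat list" where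
  "padd p q = map (\<lambda>(a, b). plus_code a b) (zip p q)"

lemma set_padd: "set p \<subseteq> terms k \<Longrightarrow> set q \<subseteq> terms k \<Longrightarrow> set (padd p q) \<subseteq> terms k"
  by (auto simp: padd_def intro!: terms.intros dest: set_zip_leftD set_zip_rightD)

lemma horner_padd: "length p = length q \<Longrightarrow> plus_code (horner g p) (horner g q) \<doteq> horner g (padd p q)"
proof (induction p q rule: list_induct2)
  case (Cons a p b q)
  then show ?case
    using trans[OF ring_identities(10) cong_plus[OF refl cong_times[OF refl Cons.IH]]] by (simp add: padd_def)
qed (simp add: padd_def ring_identities)

lemma horner_scale: "times_code c (horner g p) \<doteq> horner g (map (times_code c) p)"
proof (induction p)
  case (Cons a p)
  then show ?case
    using trans[OF ring_identities(13) cong_plus[OF refl cong_times[OF refl Cons.IH]]] by simp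
qed (simp add: ring_identities)

lemma horner_neg: "neg_code (horner g p) \<doteq> horner g (map neg_code p)"
proof (induction p)
  case (Cons a p)
  then show ?case
    using trans[OF ring_identities(11) cong_plus[OF refl cong_times[OF refl Cons.IH]]] by simp
qed (simp add: ring_identities)

lemma horner_shift: "times_code g (horner g p) \<doteq> horner g (zero_code # p)"
  using ring_identities(1) by (simp add: sym)

lemma horner_append_zero: "z \<doteq> zero_code \<Longrightarrow> horner g (p @ [z]) \<doteq> horner g p"
proof (induction p)
  case Nil
  then show ?case by (simp) (meson ring_identities(9) trans)
qed (simp add: cong_plus cong_times)

lemma horner_append_zeros: "horner g (p @ replicate n zero_code) \<doteq> horner g p"
proof (induction n)
  case (Suc n)
  have "horner g ((p @ replicate n zero_code) @ [zero_code]) \<doteq> horner g (p @ replicate n zero_code)"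
    by (rule horner_append_zero) simp
  from trans[OF this Suc] show ?case by (simp add: replicate_append_same)
qed simp

lemma horner_zeros_append: "horner g m \<doteq> zero_code \<Longrightarrow> horner g (replicate n zero_code @ m) \<doteq> zero_code"
proof (induction n)
  case (Suc n)
  then have "plus_code zero_code (times_code g (horner g (replicate n zero_code @ m))) \<doteq> plus_code zero_code (times_code g zero_code)"
    by (intro cong_plus cong_times) auto
  then show ?case by simp (meson ring_identities(9) trans)
qed simp

definition poly_form :: "nat \<Rightarrow> nat \<Rightarrow> bool" where
  "poly_form k t \<longleftrightarrow> (\<exists>p. set p \<subseteq> terms k \<and> t \<doteq> horner (gen_code k) p)"

lemma poly_form_cong: "poly_form k t \<Longrightarrow> s \<doteq> t \<Longrightarrow> poly_form k s"
  unfolding poly_form_def by (meson trans)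

lemma poly_form_const: "c \<in> terms k \<Longrightarrow> poly_form k c"
  unfolding poly_form_def by (rule exI[of _ "[c]"]) (simp add: ring_identities(9) sym)

lemma poly_form_plus:
  assumes "poly_form k a" "poly_form k b"
  shows "poly_form k (plus_code a b)"
proof -
  obtain p q where p: "set p \<subseteq> terms k" "a \<doteq> horner (gen_code k) p"
    and q: "set q \<subseteq> terms k" "b \<doteq> horner (gen_code k) q"
    using assms by (auto simp: poly_form_def)
  \<comment> \<open>\<open>padd\<close> zips and would truncate the longer list, so both are first
    filled up with zeros to the same length.\<close>
  define p' where "p' = p @ replicate (length q - length p) zero_code"
  define q' where "q' = q @ replicate (length p - length q) zero_code"
  have len: "length p' = length q'" by (simp add: p'_def q'_def)
  have "a \<doteq> horner (gen_code k) p'" "b \<doteq> horner (gen_code k) q'"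
    unfolding p'_def q'_def by (meson p(2) q(2) horner_append_zeros sym trans)+
  then have "plus_code a b \<doteq> horner (gen_code k) (padd p' q')"
    using trans[OF cong_plus horner_padd[OF len]] by blast
  moreover have "set (padd p' q') \<subseteq> terms k"
    using p(1) q(1) unfolding p'_def q'_def by (intro set_padd) (auto intro: terms.intros)
  ultimately show ?thesis unfolding poly_form_def by blast
qed

lemma poly_form_scale:
  assumes "c \<in> terms k" "poly_form k a"
  shows "poly_form k (times_code c a)"
proof -
  obtain p where "set p \<subseteq> terms k" "a \<doteq> horner (gen_code k) p"
    using assms by (auto simp: poly_form_def)
  then show ?thesis
    unfolding poly_form_def using assms(1)
    by (intro exI[of _ "map (times_code c) p"])
      (auto intro: terms.intros trans[OF cong_times[OF refl] horner_scale])
qed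

lemma poly_form_shift:
  assumes "poly_form k a"
  shows "poly_form k (times_code (gen_code k) a)"
proof -
  obtain p where "set p \<subseteq> terms k" "a \<doteq> horner (gen_code k) p"
    using assms by (auto simp: poly_form_def)
  then show ?thesis
    unfolding poly_form_def
    by (intro exI[of _ "zero_code # p"])
      (auto intro: terms.intros trans[OF cong_times[OF refl] horner_shift] simp del: horner.simps)
qed

text \<open>Recursion along the Horner form of the first factor: (c + y p) b = c b + y (p b) reduces
  a product to scaling, shifting and addition.\<close>

lemma poly_form_times:
  assumes "poly_form k a" "poly_form k b"
  shows "poly_form k (times_code a b)"
proof -
  obtain p where p: "set p \<subseteq> terms k" "a \<doteq> horner (gen_code k) p"
    using assms by (auto simp: poly_form_def)
  have "poly_form k (times_code (horner (gen_code k) p) b)"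
    using p(1)
  proof (induction p)
    case Nil
    show ?case using poly_form_const[of zero_code] by (auto intro: poly_form_cong ring_identities terms.intros)
  next
    case (Cons c p)
    have "poly_form k (plus_code (times_code c b) (times_code (gen_code k) (times_code (horner (gen_code k) p) b)))"
      using Cons by (intro poly_form_plus poly_form_scale[of c] poly_form_shift assms(2)) auto
    then show ?case using ring_identities(12) by (auto intro: poly_form_cong)
  qed
  then show ?thesis by (rule poly_form_cong) (intro cong_times p(2) refl)
qed

lemma poly_form_terms: "t \<in> terms (Suc k) \<Longrightarrow> poly_form k t"
proof (induction rule: terms.induct)
  case (3 i)
  show ?case
  proof (cases "i = k")
    case True
    have "poly_form k (times_code (gen_code k) one_code)"
      by (intro poly_form_shift poly_form_const terms.intros)
    then show ?thesis using ring_identities(6)[THEN sym] True by (auto intro: poly_form_cong)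
  qed (use 3 in \<open>simp add: less_Suc_eq poly_form_const terms.intros\<close>)
next
  case (6 a)
  then obtain p where "set p \<subseteq> terms k" "a \<doteq> horner (gen_code k) p" by (auto simp: poly_form_def)
  then show ?case
    unfolding poly_form_def
    by (intro exI[of _ "map neg_code p"]) (auto intro: terms.intros trans[OF cong_neg horner_neg])
qed (auto intro: poly_form_const poly_form_plus poly_form_times terms.intros)

lemma cancel:
  assumes "k < K" "annihilator x k m" "times_code (last (min_annihilator x k)) t \<doteq> zero_code"
  shows "t \<doteq> zero_code"
  using apply_rule[of "[Eq (Times (Const (last (min_annihilator x k))) (Var 0)) (Const zero_code)]"
      "Var 0" "Const zero_code" "nth [t]"] assms extension[OF assms(1)]
  by (auto simp: extension_rules_def eqv_def split: if_splits)

lemma min_annihilator_zero: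
  assumes "k < K" "annihilator x k m"
  shows "horner (gen_code k) (min_annihilator x k) \<doteq> zero_code"
  using apply_rule[of "[]" "Const (horner (gen_code k) (min_annihilator x k))" "Const zero_code"] assms extension[OF assms(1)]
  by (auto simp: extension_rules_def eqv_def split: if_splits)

text \<open>One elimination step. Let a and c be the leading coefficients of \<open>m\<close> and
  \<open>p\<close>, and d the difference of their lengths. The top terms of a p - c y^d m cancel,
  and since \<open>m\<close> provably vanishes at y this shorter polynomial is provably equal to a
  p.\<close>

lemma pseudo_division:
  assumes p: "p \<noteq> []" "set p \<subseteq> terms k" and m: "m \<noteq> []" "set m \<subseteq> terms k" "horner (gen_code k) m \<doteq> zero_code"
    and len: "length m \<le> length p"
  obtains r where "length r < length p" "set r \<subseteq> terms k"
    "times_code (last m) (horner (gen_code k) p) \<doteq> horner (gen_code k) r"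
proof -
  define a c where "a = last m" and "c = last p"
  define q where "q = replicate (length p - length m) zero_code @ butlast m"
  define r where "r = padd (map (times_code a) (butlast p)) (map (times_code (neg_code c)) q)"
  have ac: "a \<in> terms k" "c \<in> terms k" using p m by (auto simp: a_def c_def)
  have lq: "length q = length p - 1"
  proof -
    have "length q = (length p - length m) + (length m - 1)" unfolding q_def by simp
    moreover have "0 < length m" using m(1) by simp
    ultimately show ?thesis using len by linarith
  qed
  \<comment> \<open>This is \<open>m\<close> shifted up to the length of \<open>p\<close>;
    \<open>q\<close> is the shift without its leading coefficient.\<close>
  have qa: "q @ [a] = replicate (length p - length m) zero_code @ m"
    using m(1) by (simp add: q_def a_def)
  have "horner (gen_code k) (q @ [a]) \<doteq> zero_code"
    unfolding qa by (rule horner_zeros_append[OF m(3)])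
  then have 1: "horner (gen_code k) (map (times_code (neg_code c)) (q @ [a])) \<doteq> zero_code"
    by (meson cong_times horner_scale refl ring_identities(3) sym trans)
  have "times_code a (horner (gen_code k) p) \<doteq> horner (gen_code k) (map (times_code a) p)" by (rule horner_scale)
  also have "horner (gen_code k) (map (times_code a) p) \<doteq> plus_code (horner (gen_code k) (map (times_code a) p)) zero_code"
    by (rule ring_identities(2)[THEN sym])
  also have "\<dots> \<doteq> plus_code (horner (gen_code k) (map (times_code a) p)) (horner (gen_code k) (map (times_code (neg_code c)) (q @ [a])))"
    by (intro cong_plus refl 1[THEN sym])
  also have "\<dots> \<doteq> horner (gen_code k) (padd (map (times_code a) p) (map (times_code (neg_code c)) (q @ [a])))"
    by (rule horner_padd) (use lq p(1) in simp)
  also have "map (times_code a) p = map (times_code a) (butlast p) @ [times_code a c]"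
    using p(1) unfolding c_def by (metis append_butlast_last_id list.simps(8,9) map_append)
  also have "padd (map (times_code a) (butlast p) @ [times_code a c]) (map (times_code (neg_code c)) (q @ [a])) =
      r @ [plus_code (times_code a c) (times_code (neg_code c) a)]"
    using lq by (simp add: padd_def r_def)
  also have "horner (gen_code k) (r @ [plus_code (times_code a c) (times_code (neg_code c) a)]) \<doteq> horner (gen_code k) r"
    by (rule horner_append_zero) (rule ring_identities)
  finally have "times_code a (horner (gen_code k) p) \<doteq> horner (gen_code k) r" .
  moreover have "length r < length p" using lq p(1) by (simp add: r_def padd_def)
  moreover have "set r \<subseteq> terms k"
    using p(2) m(2) ac unfolding r_def q_def
    by (intro set_padd) (auto dest!: in_set_butlastD intro!: terms.intros)
  ultimately show ?thesis using that unfolding a_def by blast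
qed

text \<open>Induction on the tower, with an inner induction on the length of a polynomial of value
  0. If its last coefficient denotes 0, the previous stage proves that and the polynomial gets
  shorter. Otherwise it is itself an annihilator, so the minimal one is no longer than it, and
  elimination followed by cancellation reduces to a shorter polynomial; soundness shows that this
  one still has value 0. For a transcendental generator the second case cannot occur.\<close>

theorem zero_complete: "k \<le> K \<Longrightarrow> t \<in> terms k \<Longrightarrow> tval x t = 0 \<Longrightarrow> t \<doteq> zero_code"
proof (induction k arbitrary: t)
  case 0
  then obtain m n where t: "t \<doteq> plus_code (num m) (neg_code (num n))" using integer_form by blast
  then have "m = n" using sound[of t "plus_code (num m) (neg_code (num n))"] 0(3) by (simp add: eqv_def)
  with t show ?case using trans ring_identities(7) by blast
next
  case (Suc k)
  have horner_zero: "horner (gen_code k) p \<doteq> zero_code" if "set p \<subseteq> terms k" "tval x (horner (gen_code k) p) = 0" for p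
    using that
  proof (induction "length p" arbitrary: p rule: less_induct)
    case less
    show ?case
    proof (cases p rule: rev_cases)
      case (snoc q c)
      show ?thesis
      proof (cases "tval x c = 0")
        case True
        then have "c \<doteq> zero_code" using Suc.IH Suc.prems(1) less.prems snoc by auto
        then have eq: "horner (gen_code k) p \<doteq> horner (gen_code k) q" unfolding snoc by (rule horner_append_zero)
        then have "tval x (horner (gen_code k) q) = 0" using sound less.prems by (fastforce simp: eqv_def)
        then have "horner (gen_code k) q \<doteq> zero_code" using less snoc by auto
        with eq show ?thesis using trans by blast
      next
        case False
        then have ann: "annihilator x k p" using less.prems snoc by (simp add: annihilator_def)
        note m = annihilator_min[OF ann]
        have "k < K" using Suc.prems by simp
        note m0 = min_annihilator_zero[OF this ann]
        obtain r where r: "length r < length p" "set r \<subseteq> terms k"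
          "times_code (last (min_annihilator x k)) (horner (gen_code k) p) \<doteq> horner (gen_code k) r"
          by (rule pseudo_division[OF _ less.prems(1) _ _ m0 m(2)])
            (use m(1) snoc in \<open>auto simp: annihilator_def\<close>)
        have "tval x (horner (gen_code k) r) = 0"
          using sound r(3) less.prems by (fastforce simp: eqv_def)
        then have "horner (gen_code k) r \<doteq> zero_code" using less.hyps r by blast
        then show ?thesis using cancel[OF \<open>k < K\<close> ann] r(3) trans by blast
      qed
    qed simp
  qed
  obtain p where p: "set p \<subseteq> terms k" "t \<doteq> horner (gen_code k) p"
    using poly_form_terms[OF Suc.prems(2)] by (auto simp: poly_form_def)
  then have "tval x (horner (gen_code k) p) = 0" using sound Suc.prems by (fastforce simp: eqv_def)
  then show ?case using horner_zero p trans by blast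
qed

end

section \<open>Languages of real matrix automata\<close>

text \<open>A fact about the rest of a computation: from state \<open>q\<close> with the register
  denoted by \<open>t\<close>, the word \<open>w\<close> can still be accepted. Derivations thus
  start at final configurations and go backwards. The tag 1 keeps these facts apart from
  equations.\<close>

definition Acc :: "nat \<Rightarrow> tm \<Rightarrow> tm \<Rightarrow> tm" where
  "Acc q w t = Pair (Const 1) (Pair (Const q) (Pair w t))"

definition acc_fact :: "nat \<Rightarrow> nat \<Rightarrow> nat \<Rightarrow> nat" where
  "acc_fact q w t = prod_encode (1, prod_encode (q, prod_encode (w, t)))"

lemma val_Acc [simp]: "val \<rho> (Acc q w t) = acc_fact q (val \<rho> w) (val \<rho> t)"
  by (simp add: Acc_def acc_fact_def)

lemma fact_simps [simp]:
  "acc_fact q w t = acc_fact q' w' t' \<longleftrightarrow> q = q' \<and> w = w' \<and> t = t'"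
  "eq_fact a b = eq_fact a' b' \<longleftrightarrow> a = a' \<and> b = b'"
  "acc_fact q w t \<noteq> eq_fact a b" "eq_fact a b \<noteq> acc_fact q w t"
  by (auto simp: acc_fact_def eq_fact_def)

definition tuple :: "'p list \<Rightarrow> ('p \<Rightarrow> tm) \<Rightarrow> tm" where
  "tuple ps f = foldr (\<lambda>p t. Pair (f p) t) ps (Const 0)"

definition tuple_code :: "'p list \<Rightarrow> ('p \<Rightarrow> nat) \<Rightarrow> nat" where
  "tuple_code ps g = foldr (\<lambda>p n. prod_encode (g p, n)) ps 0"

lemma val_tuple [simp]: "val \<rho> (tuple ps f) = tuple_code ps (\<lambda>p. val \<rho> (f p))"
  by (induction ps) (auto simp: tuple_def tuple_code_def)

lemma tuple_code_inject:
  assumes "set ps = UNIV"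
  shows "tuple_code ps g = tuple_code ps h \<longleftrightarrow> g = h"
proof -
  have "tuple_code qs g = tuple_code qs h \<longleftrightarrow> (\<forall>p\<in>set qs. g p = h p)" for qs
    by (induction qs) (auto simp: tuple_code_def)
  then show ?thesis using assms by auto
qed

text \<open>\<open>x\<close> lists the matrix entries in use and \<open>ix\<close> finds the index
  of an entry in it; \<open>e\<close> numbers the letters, and \<open>v\<close> numbers the matrix
  positions as rule variables. \<open>ps\<close> runs through all positions and \<open>ls\<close>
  through all indices, distinctly, so that a sum over \<open>ls\<close> is a sum over the index
  type.\<close>

locale real_matrix_automaton =
  fixes S :: "(real ^'n ^'n) set" and Q q0 Qa
    and delta :: "nat \<Rightarrow> 'a::finite option \<Rightarrow> (nat \<times> (real ^'n ^'n)) set"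
    and x :: "nat \<Rightarrow> real" and K :: nat and ix :: "real \<Rightarrow> nat"
    and e :: "'a \<Rightarrow> nat" and v :: "'n \<times> 'n \<Rightarrow> nat" and ps :: "('n \<times> 'n) list" and ls :: "'n list"
  assumes aut: "G_automaton (matrix_group S) Q delta q0 Qa"
    and ix: "\<And>q s q' m i j. q \<in> Q \<Longrightarrow> (q', m) \<in> delta q s \<Longrightarrow> ix (m $ i $ j) < K \<and> x (ix (m $ i $ j)) = m $ i $ j"
    and v: "inj v" and ps: "set ps = UNIV" and ls: "set ls = UNIV" "distinct ls"
begin

text \<open>\<open>Var 0\<close> is reserved for the unread word, hence the
  \<open>Suc\<close>.\<close>

definition entry :: "'n \<times> 'n \<Rightarrow> tm" where "entry p = Var (Suc (v p))"

definition next_entry :: "real ^'n ^'n \<Rightarrow> 'n \<times> 'n \<Rightarrow> tm" where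
  "next_entry m p = foldr (\<lambda>l. Plus (Times (entry (fst p, l)) (Const (gen_code (ix (m $ l $ snd p)))))) ls (Const zero_code)"

definition unit_entry :: "'n \<times> 'n \<Rightarrow> nat" where
  "unit_entry p = (if fst p = snd p then one_code else zero_code)"

definition read_tm :: "'a option \<Rightarrow> tm" where
  "read_tm s = (case s of None \<Rightarrow> Var 0 | Some a \<Rightarrow> Succ (Pair (Const (e a)) (Var 0)))"

definition step_rules :: "(tm list \<times> tm) set" where
  "step_rules = (\<Union>q\<in>Q. \<Union>s. \<Union>(q', m)\<in>delta q s.
     {([Acc q' (Var 0) (tuple ps (next_entry m))], Acc q (read_tm s) (tuple ps entry))})"

text \<open>The register is compared with the identity through differences of entries, because
  \<open>zero_complete\<close> yields equations with right-hand side zero.\<close>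

definition final_rules :: "(tm list \<times> tm) set" where
  "final_rules = (\<lambda>q. (map (\<lambda>p. Eq (Plus (entry p) (Neg (Const (unit_entry p)))) (Const zero_code)) ps,
     Acc q (Const 0) (tuple ps entry))) ` Qa"

definition rules :: "(tm list \<times> tm) set" where
  "rules = equality_rules \<union> (\<Union>k<K. extension_rules x k) \<union> step_rules \<union> final_rules"

lemma finite_rules: "finite rules"
proof -
  have "finite Q" "Qa \<subseteq> Q" "\<And>q s. q \<in> Q \<Longrightarrow> finite (delta q s)"
    using aut by (auto simp: G_automaton_def)
  then show ?thesis
    unfolding rules_def step_rules_def final_rules_def
    by (auto simp: finite_equality_rules extension_rules_def finite_subset)
qed

section \<open>Soundness and completeness of the automaton rules\<close>

definition denote :: "('n \<times> 'n \<Rightarrow> nat) \<Rightarrow> real ^'n ^'n" where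
  "denote g = (\<chi> i j. tval x (g (i, j)))"

definition accepts :: "nat \<Rightarrow> nat \<Rightarrow> ('n \<times> 'n \<Rightarrow> nat) \<Rightarrow> bool" where
  "accepts q w g \<longleftrightarrow> (\<exists>u. w = list_encode (map e u) \<and>
     (\<exists>qf\<in>Qa. steps (matrix_group S) delta q (denote g) u qf (mat 1)))"

text \<open>The intended model. Its closure under every rule yields soundness of acceptance and also
  the soundness of equations that \<open>ring_rules\<close> assumes.\<close>

definition true_facts :: "nat set" where
  "true_facts = {eq_fact a b |a b. tval x a = tval x b} \<union> {acc_fact q w (tuple_code ps g) |q w g. accepts q w g}"

lemma true_facts_simps [simp]:
  "eq_fact a b \<in> true_facts \<longleftrightarrow> tval x a = tval x b"
  "acc_fact q w (tuple_code ps g) \<in> true_facts \<longleftrightarrow> accepts q w g"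
  by (auto simp: true_facts_def tuple_code_inject[OF ps])

lemma denote_next:
  assumes "q \<in> Q" "(q', m) \<in> delta q s"
  shows "denote (\<lambda>p. val \<rho> (next_entry m p)) = denote (\<lambda>p. val \<rho> (entry p)) ** m"
proof -
  have "tval x (foldr plus_code (map (\<lambda>l. times_code (f l) (gen_code (ix (m $ l $ j)))) qs) zero_code) =
      (\<Sum>l\<leftarrow>qs. tval x (f l) * m $ l $ j)" for f j qs
    using ix[OF assms] by (induction qs) auto
  moreover have "val \<rho> (foldr (\<lambda>l. Plus (F l)) qs (Const zero_code)) = foldr plus_code (map (\<lambda>l. val \<rho> (F l)) qs) zero_code"
    for F :: "'n \<Rightarrow> tm" and qs
    by (induction qs) auto
  ultimately show ?thesis
    by (simp add: denote_def next_entry_def matrix_matrix_mult_def vec_eq_iff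
        sum_list_distinct_conv_sum_set[OF ls(2)] ls(1))
qed

lemma denote_unit [simp]: "denote unit_entry = mat 1"
  by (simp add: denote_def unit_entry_def mat_def vec_eq_iff)

lemma derives_true: "derives rules \<subseteq> true_facts"
proof (rule derives_subsetI)
  fix r c \<rho> assume rc: "(r, c) \<in> rules" and prems: "\<And>p. p \<in> set r \<Longrightarrow> val \<rho> p \<in> true_facts"
  have sr: "sound_rule true_facts (r, c) \<Longrightarrow> val \<rho> c \<in> true_facts"
    using prems by (auto simp: sound_rule_def)
  from rc consider "(r, c) \<in> equality_rules" | k where "(r, c) \<in> extension_rules x k"
    | "(r, c) \<in> step_rules" | "(r, c) \<in> final_rules"
    by (auto simp: rules_def)
  then show "val \<rho> c \<in> true_facts"
  proof cases
    case 1
    then show ?thesis using sound_equality_rules[of true_facts x] sr by simp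
  next
    case 2
    then show ?thesis using sound_extension_rules[of true_facts x] sr by simp
  next
    case 3
    then obtain q s q' m where q: "q \<in> Q" "(q', m) \<in> delta q s"
      and r: "r = [Acc q' (Var 0) (tuple ps (next_entry m))]" and c: "c = Acc q (read_tm s) (tuple ps entry)"
      by (auto simp: step_rules_def)
    from prems[of "hd r"] obtain u qf where u: "\<rho> 0 = list_encode (map e u)" and qf: "qf \<in> Qa"
      and st: "steps (matrix_group S) delta q' (denote (\<lambda>p. val \<rho> (entry p)) \<otimes>\<^bsub>matrix_group S\<^esub> m) u qf (mat 1)"
      unfolding r by (auto simp: accepts_def denote_next[OF q] matrix_group_def)
    show ?thesis
    proof (cases s)
      case None
      then show ?thesis using u qf steps.st_eps[OF _ st] q
        by (auto simp: c read_tm_def accepts_def)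
    next
      case (Some a)
      then have "steps (matrix_group S) delta q (denote (\<lambda>p. val \<rho> (entry p))) (a # u) qf (mat 1)"
        using steps.st_read[OF _ st] q by simp
      then show ?thesis using u qf Some
        by (auto simp: c read_tm_def accepts_def intro!: exI[of _ "a # u"])
    qed
  next
    case 4
    then obtain q where q: "q \<in> Qa" and c: "c = Acc q (Const 0) (tuple ps entry)"
      and r: "r = map (\<lambda>p. Eq (Plus (entry p) (Neg (Const (unit_entry p)))) (Const zero_code)) ps"
      by (auto simp: final_rules_def)
    have "tval x (val \<rho> (entry p)) = tval x (unit_entry p)" for p
      using prems[of "Eq (Plus (entry p) (Neg (Const (unit_entry p)))) (Const zero_code)"] ps by (simp add: r)
    then have "denote (\<lambda>p. val \<rho> (entry p)) = mat 1"
      by (simp add: denote_def flip: denote_unit)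
    then show ?thesis using q
      by (auto simp: c accepts_def intro!: exI[of _ "[]"] bexI[of _ q] steps.st_refl)
  qed
qed

sublocale ring_rules x rules K
proof
  show "equality_rules \<subseteq> rules" "\<And>k. k < K \<Longrightarrow> extension_rules x k \<subseteq> rules"
    by (auto simp: rules_def)
  show "tval x a = tval x b" if "eq_fact a b \<in> derives rules" for a b
    using derives_true that by auto
qed

definition env :: "nat \<Rightarrow> ('n \<times> 'n \<Rightarrow> nat) \<Rightarrow> nat \<Rightarrow> nat" where
  "env w g i = (case i of 0 \<Rightarrow> w | Suc k \<Rightarrow> g (inv_into UNIV v k))"

lemma val_entry [simp]: "val (env w g) (entry p) = g p"
  by (simp add: entry_def env_def v)

lemma env_0 [simp]: "env w g 0 = w"
  by (simp add: env_def)

lemma step_complete: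
  assumes "q \<in> Q" "(q', m) \<in> delta q s" "\<And>p. g p \<in> terms K"
    and IH: "\<And>h. (\<And>p. h p \<in> terms K) \<Longrightarrow> denote h = denote g ** m \<Longrightarrow>
      acc_fact q' w (tuple_code ps h) \<in> derives rules"
  shows "acc_fact q (val (env w g) (read_tm s)) (tuple_code ps g) \<in> derives rules"
proof -
  let ?h = "\<lambda>p. val (env w g) (next_entry m p)"
  have "foldr (\<lambda>l. plus_code (times_code (f l) (gen_code (ix (m $ l $ j))))) qs zero_code \<in> terms K"
    if "\<And>l. f l \<in> terms K" for f j qs
    using ix[OF assms(1,2)] that by (induction qs) (auto intro!: terms.intros)
  moreover have "val (env w g) (foldr (\<lambda>l. Plus (F l)) qs (Const zero_code)) = foldr (\<lambda>l. plus_code (val (env w g) (F l))) qs zero_code"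
    for F :: "'n \<Rightarrow> tm" and qs
    by (induction qs) auto
  ultimately have "?h p \<in> terms K" for p
    using assms(3) by (simp add: next_entry_def)
  then have "acc_fact q' w (tuple_code ps ?h) \<in> derives rules"
    by (rule IH) (simp add: denote_next[OF assms(1,2)])
  moreover have "([Acc q' (Var 0) (tuple ps (next_entry m))], Acc q (read_tm s) (tuple ps entry)) \<in> rules"
    using assms(1,2) by (force simp: rules_def step_rules_def)
  ultimately show ?thesis
    using derives.rule[of _ "Acc q (read_tm s) (tuple ps entry)" rules "env w g"] by fastforce
qed

text \<open>Many tuples of codes denote the same matrix, and a derivation concerns the particular
  tuple built up by the preceding steps; hence the generalisation over \<open>g\<close>. Membership
  in \<open>terms K\<close> is what lets \<open>zero_complete\<close> verify the last
  register.\<close>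

lemma steps_complete:
  assumes "steps (matrix_group S) delta q X w qf Y" "Y = mat 1" "qf \<in> Qa" "q \<in> Q"
    "\<And>p. g p \<in> terms K" "denote g = X"
  shows "acc_fact q (list_encode (map e w)) (tuple_code ps g) \<in> derives rules"
  using assms
proof (induction arbitrary: g rule: steps.induct)
  case (st_refl q X)
  have "val (env 0 g) (Acc q (Const 0) (tuple ps entry)) \<in> derives rules"
  proof (rule derives.rule)
    show "(map (\<lambda>p. Eq (Plus (entry p) (Neg (Const (unit_entry p)))) (Const zero_code)) ps,
     Acc q (Const 0) (tuple ps entry)) \<in> rules"
      using st_refl by (auto simp: rules_def final_rules_def)
    fix t assume "t \<in> set (map (\<lambda>p. Eq (Plus (entry p) (Neg (Const (unit_entry p)))) (Const zero_code)) ps)"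
    then obtain p where t: "t = Eq (Plus (entry p) (Neg (Const (unit_entry p)))) (Const zero_code)" by auto
    have "denote g $ fst p $ snd p = denote unit_entry $ fst p $ snd p"
      using st_refl by simp
    then have "tval x (g p) = tval x (unit_entry p)" by (simp add: denote_def)
    then have "eqv (plus_code (g p) (neg_code (unit_entry p))) zero_code"
      by (intro zero_complete[OF order_refl] terms.intros st_refl) (auto simp: unit_entry_def intro: terms.intros)
    then show "val (env 0 g) t \<in> derives rules" by (simp add: t eqv_def)
  qed
  then show ?case by simp
next
  case (st_eps q1 m q X w q2 y)
  have "q1 \<in> Q" using st_eps.hyps(1) st_eps.prems(3) aut unfolding G_automaton_def by blast
  with st_eps step_complete[of q q1 m None g "list_encode (map e w)"]
  show ?case by (simp add: read_tm_def matrix_group_def)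
next
  case (st_read q1 m q a X w q2 y)
  have "q1 \<in> Q" using st_read.hyps(1) st_read.prems(3) aut unfolding G_automaton_def by blast
  with st_read step_complete[of q q1 m "Some a" g "list_encode (map e w)"]
  show ?case by (simp add: read_tm_def matrix_group_def)
qed

lemma aut_lang_codes:
  assumes "inj e"
  shows "list_encode ` map e ` aut_lang (matrix_group S) delta q0 Qa =
    {n. acc_fact q0 n (tuple_code ps unit_entry) \<in> derives rules}"
proof (intro Set.set_eqI iffI)
  fix n assume "n \<in> list_encode ` map e ` aut_lang (matrix_group S) delta q0 Qa"
  then obtain w qf where n: "n = list_encode (map e w)" and "qf \<in> Qa"
    "steps (matrix_group S) delta q0 (mat 1) w qf (mat 1)"
    by (auto simp: aut_lang_def matrix_group_def)
  moreover have "unit_entry p \<in> terms K" for p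
    by (simp add: unit_entry_def terms.intros)
  ultimately show "n \<in> {n. acc_fact q0 n (tuple_code ps unit_entry) \<in> derives rules}"
    using steps_complete[of q0 "mat 1" w qf "mat 1" unit_entry] aut
    by (simp add: G_automaton_def)
next
  fix n assume "n \<in> {n. acc_fact q0 n (tuple_code ps unit_entry) \<in> derives rules}"
  then have "accepts q0 n unit_entry" using derives_true by auto
  then show "n \<in> list_encode ` map e ` aut_lang (matrix_group S) delta q0 Qa"
    by (auto simp: accepts_def aut_lang_def matrix_group_def)
qed

end

theorem automaton_RE:
  fixes S :: "(real ^'n ^'n) set" and delta :: "nat \<Rightarrow> 'a::finite option \<Rightarrow> (nat \<times> (real ^'n ^'n)) set"
  assumes aut: "G_automaton (matrix_group S) Q delta q0 Qa"
  shows "RE_lang (aut_lang (matrix_group S) delta q0 Qa)"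
proof -
  obtain e :: "'a \<Rightarrow> nat" where e: "bij_betw e UNIV {..<CARD('a)}"
    using ex_bij_betw_finite_nat[of "UNIV :: 'a set"] by (auto simp: atLeast0LessThan)
  obtain v :: "'n \<times> 'n \<Rightarrow> nat" where v: "inj v"
    using ex_bij_betw_finite_nat[of "UNIV :: ('n \<times> 'n) set"] by (auto simp: bij_betw_def)
  obtain ps :: "('n \<times> 'n) list" where ps: "set ps = UNIV"
    using finite_list[of "UNIV :: ('n \<times> 'n) set"] by auto
  obtain ls :: "'n list" where ls: "set ls = UNIV" "distinct ls"
    using finite_distinct_list[of "UNIV :: 'n set"] by auto
  \<comment> \<open>Finitely many transitions and matrix positions leave finitely many reals; these
    become the generators.\<close>
  define E where "E = (\<Union>q\<in>Q. \<Union>s. \<Union>(q', m)\<in>delta q s. \<Union>i. \<Union>j. {m $ i $ j})"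
  have "finite E" using aut unfolding E_def G_automaton_def by auto
  then obtain rs where rs: "set rs = E" using finite_list by blast
  have "\<exists>k<length rs. rs ! k = r" if "r \<in> E" for r
    using that rs by (auto simp: in_set_conv_nth)
  then obtain ix where ix: "\<And>r. r \<in> E \<Longrightarrow> ix r < length rs \<and> rs ! ix r = r" by metis
  interpret real_matrix_automaton S Q q0 Qa delta "nth rs" "length rs" ix e v ps ls
  proof
    show "ix (m $ i $ j) < length rs \<and> rs ! ix (m $ i $ j) = m $ i $ j"
      if "q \<in> Q" "(q', m) \<in> delta q s" for q s q' m i j
      by (rule ix) (use that in \<open>force simp: E_def\<close>)
  qed (use aut v ps ls in auto)
  have "RE_nat {n. acc_fact q0 n (tuple_code ps unit_entry) \<in> derives rules}"
    unfolding acc_fact_def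
    by (intro RE_nat_derives finite_rules total_rec_prod_encode total_rec_const total_rec_nth) simp
  moreover have "inj e" using e by (auto simp: bij_betw_def)
  ultimately show ?thesis
    unfolding RE_lang_def using e aut_lang_codes by auto
qed

section \<open>Automata of regular expressions\<close>

datatype 'x rexp = Empty | Eps | Atom 'x | Alt "'x rexp" "'x rexp" | Cat "'x rexp" "'x rexp" | Star "'x rexp"

inductive matches :: "'x rexp \<Rightarrow> 'x list \<Rightarrow> bool" where
  Eps: "matches Eps []"
| Atom: "matches (Atom x) [x]"
| Alt1: "matches a u \<Longrightarrow> matches (Alt a b) u"
| Alt2: "matches b u \<Longrightarrow> matches (Alt a b) u"
| Cat: "matches a u \<Longrightarrow> matches b v \<Longrightarrow> matches (Cat a b) (u @ v)"
| Star_Nil: "matches (Star a) []"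
| Star_step: "matches a u \<Longrightarrow> matches (Star a) v \<Longrightarrow> matches (Star a) (u @ v)"

inductive_cases matches_EmptyE: "matches Empty u"
inductive_cases matches_EpsE: "matches Eps u"
inductive_cases matches_AtomE: "matches (Atom x) u"
inductive_cases matches_AltE: "matches (Alt a b) u"
inductive_cases matches_CatE: "matches (Cat a b) u"

lemma matches_simps [simp]:
  "\<not> matches Empty u" "matches Eps u \<longleftrightarrow> u = []" "matches (Atom x) u \<longleftrightarrow> u = [x]"
  "matches (Alt a b) u \<longleftrightarrow> matches a u \<or> matches b u"
  "matches (Cat a b) u \<longleftrightarrow> (\<exists>v w. u = v @ w \<and> matches a v \<and> matches b w)"
  by (auto elim: matches_EmptyE matches_EpsE matches_AtomE matches_AltE intro: matches.intros)
    (blast elim: matches_CatE)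

lemma matches_Star: "matches (Star a) u \<longleftrightarrow> (\<exists>us. (\<forall>v\<in>set us. matches a v) \<and> u = concat us)"
proof
  show "matches (Star a) u \<Longrightarrow> \<exists>us. (\<forall>v\<in>set us. matches a v) \<and> u = concat us"
  proof (induction "Star a" u rule: matches.induct)
    case Star_Nil
    show ?case by (rule exI[of _ "[]"]) simp
  next
    case (Star_step u v)
    then obtain us where "\<forall>v\<in>set us. matches a v" "v = concat us" by blast
    with Star_step show ?case by (intro exI[of _ "u # us"]) auto
  qed
  have "\<forall>v\<in>set us. matches a v \<Longrightarrow> matches (Star a) (concat us)" for us
    by (induction us) (auto intro: matches.intros)
  then show "\<exists>us. (\<forall>v\<in>set us. matches a v) \<and> u = concat us \<Longrightarrow> matches (Star a) u" by blast
qed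

lemma matches_atoms: "matches a u \<Longrightarrow> set u \<subseteq> set_rexp a"
  by (induction rule: matches.induct) auto

text \<open>The states of the automaton of a regular expression are stacks of expressions that remain to
  be matched; \<open>stacks e K\<close> lists those that occur while \<open>e\<close> is processed on top of \<open>K\<close>.\<close>

inductive stack_step :: "'x rexp list \<Rightarrow> 'x option \<Rightarrow> 'x rexp list \<Rightarrow> bool" where
  "stack_step (Eps # K) None K"
| "stack_step (Atom x # K) (Some x) K"
| "stack_step (Alt a b # K) None (a # K)"
| "stack_step (Alt a b # K) None (b # K)"
| "stack_step (Cat a b # K) None (a # b # K)"
| "stack_step (Star a # K) None K"
| "stack_step (Star a # K) None (a # Star a # K)"

primrec stacks :: "'x rexp \<Rightarrow> 'x rexp list \<Rightarrow> 'x rexp list set" where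
  "stacks Empty K = {Empty # K}"
| "stacks Eps K = {Eps # K}"
| "stacks (Atom x) K = {Atom x # K}"
| "stacks (Alt a b) K = {Alt a b # K} \<union> stacks a K \<union> stacks b K"
| "stacks (Cat a b) K = {Cat a b # K} \<union> stacks a (b # K) \<union> stacks b K"
| "stacks (Star a) K = {Star a # K} \<union> stacks a (Star a # K)"

lemma finite_stacks: "finite (stacks e K)"
  by (induction e arbitrary: K) auto

lemma Cons_in_stacks [simp]: "e # K \<in> stacks e K"
  by (cases e) auto

text \<open>With \<open>finite_stacks\<close> this yields a finite state set: a step stays among the
  listed stacks or completes \<open>e\<close> and uncovers \<open>K\<close>.\<close>

lemma stacks_closed: "L \<in> stacks e K \<Longrightarrow> stack_step L l L' \<Longrightarrow> L' \<in> insert K (stacks e K)"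
proof (induction e arbitrary: K)
  case (Alt a b)
  then consider "L = Alt a b # K" | "L \<in> stacks a K" | "L \<in> stacks b K" by auto
  then show ?case
    by cases (use Alt.IH[of K] Alt.prems(2) in \<open>auto elim: stack_step.cases\<close>)
next
  case (Cat a b)
  then consider "L = Cat a b # K" | "L \<in> stacks a (b # K)" | "L \<in> stacks b K" by auto
  then show ?case
    by cases (use Cat.IH(1)[of "b # K"] Cat.IH(2)[of K] Cat.prems(2) in \<open>auto elim: stack_step.cases\<close>)
next
  case (Star a)
  then consider "L = Star a # K" | "L \<in> stacks a (Star a # K)" by auto
  then show ?case
    by cases (use Star.IH[of "Star a # K"] Star.prems(2) in \<open>auto elim: stack_step.cases\<close>)
qed (auto elim: stack_step.cases)

text \<open>For \<open>Cat a b\<close> the automaton enters \<open>a # b # K\<close>; the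
  completeness proof also has to know that \<open>b # K\<close>, reached once \<open>a\<close> is
  done, is a state.\<close>

lemma stacks_tl: "L \<in> stacks e K \<Longrightarrow> tl L \<in> insert K (stacks e K)"
  by (induction e arbitrary: K) fastforce+

lemma stacks_atoms:
  "L \<in> stacks e K \<Longrightarrow> \<Union> (set_rexp ` set L) \<subseteq> set_rexp e \<union> \<Union> (set_rexp ` set K)"
  by (induction e arbitrary: K) (auto; fastforce)+

lemma finite_stack_step: "finite {(l, L'). stack_step L l L'}"
proof -
  have "{(l, L'). stack_step L l L'} \<subseteq> (case L of [] \<Rightarrow> {} | e # K \<Rightarrow> (case e of Empty \<Rightarrow> {} | Eps \<Rightarrow> {(None, K)}
    | Atom x \<Rightarrow> {(Some x, K)} | Alt a b \<Rightarrow> {(None, a # K), (None, b # K)} | Cat a b \<Rightarrow> {(None, a # b # K)}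
    | Star a \<Rightarrow> {(None, K), (None, a # Star a # K)}))"
    by (auto elim!: stack_step.cases)
  then show ?thesis
    by (rule finite_subset) (auto split: list.split rexp.split)
qed

fun matches_stack :: "'x rexp list \<Rightarrow> 'x list \<Rightarrow> bool" where
  "matches_stack [] xs \<longleftrightarrow> xs = []"
| "matches_stack (e # K) xs \<longleftrightarrow> (\<exists>u v. xs = u @ v \<and> matches e u \<and> matches_stack K v)"

lemma matches_stack_step:
  "stack_step K l K' \<Longrightarrow> matches_stack K' xs \<Longrightarrow>
    matches_stack K ((case l of None \<Rightarrow> [] | Some x \<Rightarrow> [x]) @ xs)"
proof (induction rule: stack_step.induct)
  case (5 a b K)
  then show ?case by simp (metis append.assoc)
next
  case (6 a K)
  then show ?case by simp (metis append_Nil matches.Star_Nil)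
next
  case (7 a K)
  then show ?case by simp (metis append.assoc matches.Star_step)
qed force+

section \<open>Words and products of label sequences\<close>

definition label_word :: "('a option \<times> 'g) list \<Rightarrow> 'a list" where
  "label_word xs = List.map_filter fst xs"

lemma label_word_simps [simp]:
  "label_word [] = []" "label_word ((None, m) # xs) = label_word xs"
  "label_word ((Some a, m) # xs) = a # label_word xs"
  "label_word (xs @ ys) = label_word xs @ label_word ys"
  by (auto simp: label_word_def map_filter_def)

definition label_prod :: "('g, 'b) monoid_scheme \<Rightarrow> 'g \<Rightarrow> ('a option \<times> 'g) list \<Rightarrow> 'g" where
  "label_prod G = foldl (\<lambda>y (_, m). y \<otimes>\<^bsub>G\<^esub> m)"

lemma label_prod_simps [simp]:
  "label_prod G y [] = y" "label_prod G y ((s, m) # xs) = label_prod G (y \<otimes>\<^bsub>G\<^esub> m) xs"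
  "label_prod G y (xs @ ys) = label_prod G (label_prod G y xs) ys"
  by (auto simp: label_prod_def)

lemma label_prod_closed:
  assumes "group G" "y \<in> carrier G" "\<forall>(s, m)\<in>set xs. m \<in> carrier G"
  shows "label_prod G y xs \<in> carrier G"
proof -
  interpret group G by fact
  show ?thesis using assms(2,3) by (induction xs arbitrary: y) auto
qed

theorem rexp_automaton:
  fixes G :: "('g, 'b) monoid_scheme" and E :: "('a option \<times> 'g) rexp"
  assumes G: "group G" and E: "\<forall>(s, m)\<in>set_rexp E. m \<in> carrier G"
  shows "{w. \<exists>xs. matches E xs \<and> label_word xs = w \<and> label_prod G \<one>\<^bsub>G\<^esub> xs = \<one>\<^bsub>G\<^esub>} \<in> G_languages G"
proof -
  interpret group G by fact
  define R where "R = insert [] (stacks E [])"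
  have fin: "finite R" by (simp add: R_def finite_stacks)
  then obtain f :: "('a option \<times> 'g) rexp list \<Rightarrow> nat" where f: "inj_on f R"
    using finite_imp_inj_to_nat_seg by blast
  have closed: "K' \<in> R" if "K \<in> R" "stack_step K l K'" for K l K'
    using that stacks_closed[of K E "[]"] by (auto simp: R_def elim: stack_step.cases)
  have atoms: "m \<in> carrier G" if "K \<in> R" "stack_step K (Some (s, m)) K'" for K s m K'
    using that E stacks_atoms[of K E "[]"] by (fastforce simp: R_def elim: stack_step.cases)
  \<comment> \<open>Epsilon transitions have two sources: silent stack steps, which carry the
    identity, and atoms \<open>(None, m)\<close>, which carry \<open>m\<close>.\<close>
  define arc where "arc l s m \<longleftrightarrow> (case l of None \<Rightarrow> s = None \<and> m = \<one>\<^bsub>G\<^esub> | Some y \<Rightarrow> y = (s, m))"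
    for l :: "('a option \<times> 'g) option" and s m
  define delta where "delta q s = {(f K', m) |K K' l m. K \<in> R \<and> f K = q \<and> stack_step K l K' \<and> arc l s m}" for q s
  have aut: "G_automaton G (f ` R) delta (f [E]) {f []}"
    unfolding G_automaton_def
  proof (intro conjI ballI allI)
    fix q s assume "q \<in> f ` R"
    have "delta q s \<subseteq> (\<Union>K\<in>R. (\<lambda>(l, K'). (f K', case l of None \<Rightarrow> \<one>\<^bsub>G\<^esub> | Some y \<Rightarrow> snd y)) ` {(l, K'). stack_step K l K'})"
    proof
      fix z assume "z \<in> delta q s"
      then obtain K K' l m where z: "z = (f K', m)" "K \<in> R" "stack_step K l K'" "arc l s m"
        by (auto simp: delta_def)
      then show "z \<in> (\<Union>K\<in>R. (\<lambda>(l, K'). (f K', case l of None \<Rightarrow> \<one>\<^bsub>G\<^esub> | Some y \<Rightarrow> snd y)) ` {(l, K'). stack_step K l K'})"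
        by (intro UN_I[of K] image_eqI[of _ _ "(l, K')"]) (auto simp: arc_def split: option.splits)
    qed
    then show "finite (delta q s)"
      by (rule finite_subset) (intro finite_UN_I fin finite_imageI finite_stack_step)
    show "delta q s \<subseteq> f ` R \<times> carrier G"
    proof
      fix z assume "z \<in> delta q s"
      then obtain K K' l m where z: "z = (f K', m)" "K \<in> R" "stack_step K l K'" "arc l s m"
        by (auto simp: delta_def)
      then show "z \<in> f ` R \<times> carrier G"
        using closed[OF z(2,3)] atoms[OF z(2), of s m] by (auto simp: arc_def split: option.splits)
    qed
  qed (use fin in \<open>auto simp: R_def\<close>)
  have deltaI: "(f K', m) \<in> delta (f K) s" if "K \<in> R" "stack_step K l K'" "arc l s m" for K l K' s m
    unfolding delta_def using that by blast
  have silent: "steps G delta (f K) y w q z"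
    if "K \<in> R" "stack_step K None K'" "y \<in> carrier G" "steps G delta (f K') y w q z" for K K' y w q z
    by (rule steps.st_eps[of "f K'" "\<one>\<^bsub>G\<^esub>"])
      (use that deltaI[of K None K' None "\<one>\<^bsub>G\<^esub>"] in \<open>auto simp: arc_def\<close>)
  \<comment> \<open>The computation that continues from the lower stack \<open>K\<close> on the
    input \<open>w\<close> is a parameter, so that the induction can chain the parts of
    \<open>Cat\<close> and \<open>Star\<close>.\<close>
  have complete: "steps G delta (f (e # K)) y (label_word xs @ w) q z"
    if "matches e xs" "e # K \<in> R" "y \<in> carrier G" "\<forall>(s, m)\<in>set xs. m \<in> carrier G"
      "steps G delta (f K) (label_prod G y xs) w q z" for e K y xs w q z
    using that
  proof (induction arbitrary: K y w q z rule: matches.induct)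
    case Eps
    then show ?case using silent[OF _ stack_step.intros(1)] by simp
  next
    case (Atom x)
    obtain s m where x: "x = (s, m)" by fastforce
    have "(f K, m) \<in> delta (f (Atom x # K)) s"
      using deltaI[OF Atom(1) stack_step.intros(2)] by (simp add: arc_def x)
    then show ?case
      using Atom(4) steps.st_eps[of "f K" m delta _ G y w q z] steps.st_read[of "f K" m delta _ _ G y w q z]
      by (cases s) (auto simp: x)
  next
    case (Alt1 a u b)
    then show ?case using silent[OF _ stack_step.intros(3)] closed[OF _ stack_step.intros(3)] by blast
  next
    case (Alt2 b u a)
    then show ?case using silent[OF _ stack_step.intros(4)] closed[OF _ stack_step.intros(4)] by blast
  next
    case (Cat a u b v)
    have R: "a # b # K \<in> R" "b # K \<in> R"
      using closed[OF Cat.prems(1) stack_step.intros(5)] stacks_tl[of "a # b # K" E "[]"]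
      by (auto simp: R_def)
    have u: "label_prod G y u \<in> carrier G" using Cat.prems by (intro label_prod_closed G) auto
    have "steps G delta (f (b # K)) (label_prod G y u) (label_word v @ w) q z"
      using Cat.prems u R by (intro Cat.IH(2)) auto
    then have "steps G delta (f (a # b # K)) y (label_word u @ label_word v @ w) q z"
      using Cat.prems R by (intro Cat.IH(1)) auto
    then show ?case
      using silent[OF Cat.prems(1) stack_step.intros(5) Cat.prems(2)] by simp
  next
    case (Star_Nil a)
    then show ?case using silent[OF _ stack_step.intros(6)] by simp
  next
    case (Star_step a u v)
    have u: "label_prod G y u \<in> carrier G" using Star_step.prems by (intro label_prod_closed G) auto
    have "steps G delta (f (Star a # K)) (label_prod G y u) (label_word v @ w) q z"
      using Star_step.prems u by (intro Star_step.IH(2)) auto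
    then have "steps G delta (f (a # Star a # K)) y (label_word u @ label_word v @ w) q z"
      using Star_step.prems closed[OF _ stack_step.intros(7)] by (intro Star_step.IH(1)) auto
    then show ?case
      using silent[OF Star_step.prems(1) stack_step.intros(7) Star_step.prems(2)] by simp
  qed
  have sound: "\<exists>xs. matches_stack K xs \<and> w = label_word xs \<and> z = label_prod G y xs"
    if "steps G delta p y w q z" "p = f K" "K \<in> R" "q = f []" "y \<in> carrier G" for p y w q z K
    using that
  proof (induction arbitrary: K rule: steps.induct)
    case (st_refl q y)
    then have "K = []" using f by (auto simp: R_def inj_on_def)
    then show ?case by simp
  next
    case (st_eps q1 m q y w q2 z)
    then obtain K1 K' l where "K1 \<in> R" "f K1 = f K" "q1 = f K'" "stack_step K1 l K'" and arc: "arc l None m"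
      by (auto simp: delta_def)
    with f \<open>K \<in> R\<close> have K': "stack_step K l K'" "q1 = f K'" "K' \<in> R"
      using closed by (auto simp: inj_on_def)
    have m: "m \<in> carrier G" using arc atoms[OF \<open>K \<in> R\<close>] K'(1) by (auto simp: arc_def split: option.splits)
    then obtain xs where "matches_stack K' xs" "w = label_word xs" "z = label_prod G (y \<otimes>\<^bsub>G\<^esub> m) xs"
      using st_eps.IH[OF K'(2,3) st_eps.prems(3)] st_eps.prems(4) by auto
    then show ?case
      using matches_stack_step[OF K'(1), of xs] arc st_eps.prems(4)
      by (auto simp: arc_def split: option.splits intro: exI[of _ xs] exI[of _ "(None, m) # xs"])
  next
    case (st_read q1 m q a y w q2 z)
    then obtain K1 K' l where "K1 \<in> R" "f K1 = f K" "q1 = f K'" "stack_step K1 l K'" and arc: "arc l (Some a) m"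
      by (auto simp: delta_def)
    with f \<open>K \<in> R\<close> have K': "stack_step K l K'" "q1 = f K'" "K' \<in> R"
      using closed by (auto simp: inj_on_def)
    have m: "m \<in> carrier G" using arc atoms[OF \<open>K \<in> R\<close>] K'(1) by (auto simp: arc_def split: option.splits)
    then obtain xs where "matches_stack K' xs" "w = label_word xs" "z = label_prod G (y \<otimes>\<^bsub>G\<^esub> m) xs"
      using st_read.IH[OF K'(2,3) st_read.prems(3)] st_read.prems(4) by auto
    then show ?case
      using matches_stack_step[OF K'(1), of xs] arc
      by (auto simp: arc_def split: option.splits intro: exI[of _ "(Some a, m) # xs"])
  qed
  have "aut_lang G delta (f [E]) {f []} =
    {w. \<exists>xs. matches E xs \<and> label_word xs = w \<and> label_prod G \<one>\<^bsub>G\<^esub> xs = \<one>\<^bsub>G\<^esub>}"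
  proof (intro Set.set_eqI iffI)
    fix w assume "w \<in> aut_lang G delta (f [E]) {f []}"
    then show "w \<in> {w. \<exists>xs. matches E xs \<and> label_word xs = w \<and> label_prod G \<one>\<^bsub>G\<^esub> xs = \<one>\<^bsub>G\<^esub>}"
      using sound[of "f [E]" "\<one>\<^bsub>G\<^esub>" w "f []" "\<one>\<^bsub>G\<^esub>" "[E]"] by (auto simp: aut_lang_def R_def)
  next
    fix w assume "w \<in> {w. \<exists>xs. matches E xs \<and> label_word xs = w \<and> label_prod G \<one>\<^bsub>G\<^esub> xs = \<one>\<^bsub>G\<^esub>}"
    then obtain xs where xs: "matches E xs" "label_word xs = w" "label_prod G \<one>\<^bsub>G\<^esub> xs = \<one>\<^bsub>G\<^esub>" by blast
    moreover have "\<forall>(s, m)\<in>set xs. m \<in> carrier G" using E matches_atoms[OF xs(1)] by auto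
    ultimately show "w \<in> aut_lang G delta (f [E]) {f []}"
      using complete[of E xs "[]" "\<one>\<^bsub>G\<^esub>" "[]" "f []" "\<one>\<^bsub>G\<^esub>"]
      by (auto simp: aut_lang_def R_def intro: steps.st_refl)
  qed
  with aut show ?thesis unfolding G_languages_def by blast
qed

section \<open>Counter programs\<close>

datatype 'a action = Read 'a | Inc nat | Dec nat | Test nat

primrec act :: "'a action \<Rightarrow> (nat \<Rightarrow> nat) \<Rightarrow> (nat \<Rightarrow> nat) \<Rightarrow> bool" where
  "act (Read a) s s' \<longleftrightarrow> s' = s"
| "act (Inc r) s s' \<longleftrightarrow> s' = s(r := Suc (s r))"
| "act (Dec r) s s' \<longleftrightarrow> 0 < s r \<and> s' = s(r := s r - 1)"
| "act (Test r) s s' \<longleftrightarrow> s r = 0 \<and> s' = s"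

fun run :: "'a action list \<Rightarrow> (nat \<Rightarrow> nat) \<Rightarrow> (nat \<Rightarrow> nat) \<Rightarrow> bool" where
  "run [] s s' \<longleftrightarrow> s' = s"
| "run (a # as) s s' \<longleftrightarrow> (\<exists>t. act a s t \<and> run as t s')"

lemma run_append: "run (as @ bs) s s' \<longleftrightarrow> (\<exists>t. run as s t \<and> run bs t s')"
  by (induction as arbitrary: s) auto

fun reads :: "'a action list \<Rightarrow> 'a list" where
  "reads [] = []"
| "reads (Read a # as) = a # reads as"
| "reads (_ # as) = reads as"

lemma reads_append [simp]: "reads (as @ bs) = reads as @ reads bs"
  by (induction as rule: reads.induct) auto

definition sem :: "'a action rexp \<Rightarrow> (nat \<Rightarrow> nat) \<Rightarrow> 'a list \<Rightarrow> (nat \<Rightarrow> nat) \<Rightarrow> bool" where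
  "sem e s w s' \<longleftrightarrow> (\<exists>as. matches e as \<and> reads as = w \<and> run as s s')"

lemma sem_Cat: "sem (Cat a b) s w s' \<longleftrightarrow> (\<exists>u v t. w = u @ v \<and> sem a s u t \<and> sem b t v s')"
proof
  assume "sem (Cat a b) s w s'"
  then obtain as bs where "matches a as" "matches b bs" "reads (as @ bs) = w" "run (as @ bs) s s'"
    by (auto simp: sem_def)
  then show "\<exists>u v t. w = u @ v \<and> sem a s u t \<and> sem b t v s'"
    unfolding sem_def run_append by (metis reads_append)
next
  assume "\<exists>u v t. w = u @ v \<and> sem a s u t \<and> sem b t v s'"
  then obtain as bs t where "matches a as" "matches b bs" "w = reads as @ reads bs" "run as s t" "run bs t s'"
    unfolding sem_def by blast
  then show "sem (Cat a b) s w s'"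
    unfolding sem_def by (intro exI[of _ "as @ bs"]) (auto simp: run_append)
qed

lemma sem_Alt: "sem (Alt a b) s w s' \<longleftrightarrow> sem a s w s' \<or> sem b s w s'"
  by (auto simp: sem_def)

lemma sem_Empty: "\<not> sem Empty s w s'"
  by (simp add: sem_def)

lemma sem_Read: "sem (Atom (Read a)) s w s' \<longleftrightarrow> w = [a] \<and> s' = s"
  by (auto simp: sem_def)

lemma sem_Star_unfold:
  "sem (Star a) s w s' \<longleftrightarrow> w = [] \<and> s' = s \<or> (\<exists>u v t. w = u @ v \<and> sem a s u t \<and> sem (Star a) t v s')"
proof -
  have "matches (Star a) as \<longleftrightarrow> as = [] \<or> matches (Cat a (Star a)) as" for as
    by (auto elim: matches.cases[of "Star a" as] intro: matches.intros)
  then have "sem (Star a) s w s' \<longleftrightarrow> w = [] \<and> s' = s \<or> sem (Cat a (Star a)) s w s'"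
    unfolding sem_def by (metis reads.simps(1) run.simps(1))
  then show ?thesis by (simp add: sem_Cat)
qed

definition rel :: "'a action rexp \<Rightarrow> (nat \<Rightarrow> nat) \<Rightarrow> (nat \<Rightarrow> nat) \<Rightarrow> bool" where
  "rel e s s' \<longleftrightarrow> sem e s [] s'"

lemma rel_simps [simp]:
  "rel Empty s s' \<longleftrightarrow> False" "rel Eps s s' \<longleftrightarrow> s' = s"
  "rel (Cat a b) s s' \<longleftrightarrow> (\<exists>t. rel a s t \<and> rel b t s')"
  "rel (Alt a b) s s' \<longleftrightarrow> rel a s s' \<or> rel b s s'"
  "rel (Atom (Inc r)) s s' \<longleftrightarrow> s' = s(r := Suc (s r))"
  "rel (Atom (Dec r)) s s' \<longleftrightarrow> 0 < s r \<and> s' = s(r := s r - 1)"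
  "rel (Atom (Test r)) s s' \<longleftrightarrow> s r = 0 \<and> s' = s"
  unfolding rel_def sem_Cat sem_Alt by (auto simp: sem_def)

lemma rel_Star: "rel (Star a) = (rel a)\<^sup>*\<^sup>*"
proof (intro ext iffI)
  fix s s' assume "rel (Star a) s s'"
  then obtain us where "\<forall>as\<in>set us. matches a as" "reads (concat us) = []" "run (concat us) s s'"
    by (auto simp: rel_def sem_def matches_Star)
  then show "(rel a)\<^sup>*\<^sup>* s s'"
  proof (induction us arbitrary: s)
    case (Cons as us)
    then obtain t where "run as s t" "run (concat us) t s'" by (auto simp: run_append)
    with Cons show ?case
      by (intro converse_rtranclp_into_rtranclp[of _ s t]) (auto simp: rel_def sem_def)
  qed simp
next
  fix s s' assume "(rel a)\<^sup>*\<^sup>* s s'"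
  then show "rel (Star a) s s'"
  proof (induction rule: converse_rtranclp_induct)
    case base
    show ?case unfolding rel_def by (subst sem_Star_unfold) simp
  next
    case (step s t)
    then show ?case unfolding rel_def by (subst sem_Star_unfold) blast
  qed
qed

definition pure :: "'a action rexp \<Rightarrow> bool" where
  "pure e \<longleftrightarrow> (\<forall>a. Read a \<notin> set_rexp e)"

lemma pure_simps [simp]:
  "pure Empty" "pure Eps" "pure (Cat a b) \<longleftrightarrow> pure a \<and> pure b" "pure (Alt a b) \<longleftrightarrow> pure a \<and> pure b"
  "pure (Star a) \<longleftrightarrow> pure a" "pure (Atom (Inc r))" "pure (Atom (Dec r))" "pure (Atom (Test r))"
  by (auto simp: pure_def)

lemma sem_pure: "pure e \<Longrightarrow> sem e s w s' \<longleftrightarrow> w = [] \<and> rel e s s'"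
proof -
  have "\<forall>a. Read a \<notin> set as \<Longrightarrow> reads as = []" for as :: "'a action list"
    by (induction as rule: reads.induct) auto
  then show "pure e \<Longrightarrow> ?thesis"
    unfolding rel_def sem_def pure_def by (metis matches_atoms subsetD)
qed

lemma rel_Star_function:
  assumes "\<And>s s'. rel b s s' \<longleftrightarrow> P s \<and> s' = f s"
  shows "rel (Star b) s s' \<longleftrightarrow> (\<exists>n. (\<forall>i<n. P ((f ^^ i) s)) \<and> s' = (f ^^ n) s)"
  unfolding rel_Star
proof
  assume "(rel b)\<^sup>*\<^sup>* s s'"
  then show "\<exists>n. (\<forall>i<n. P ((f ^^ i) s)) \<and> s' = (f ^^ n) s"
  proof induction
    case base
    show ?case by (rule exI[of _ 0]) simp
  next
    case (step t u)
    then obtain n where "\<forall>i<n. P ((f ^^ i) s)" "t = (f ^^ n) s" by blast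
    with step(2) show ?case
      by (intro exI[of _ "Suc n"]) (auto simp: assms less_Suc_eq)
  qed
next
  have "(\<forall>i<n. P ((f ^^ i) s)) \<Longrightarrow> (rel b)\<^sup>*\<^sup>* s ((f ^^ n) s)" for n
    by (induction n) (auto simp: assms intro: rtranclp.rtrancl_into_rtrancl)
  then show "\<exists>n. (\<forall>i<n. P ((f ^^ i) s)) \<and> s' = (f ^^ n) s \<Longrightarrow> (rel b)\<^sup>*\<^sup>* s s'" by blast
qed

text \<open>\<open>Star\<close> guesses a number n of rounds. The guard of \<open>b\<close> blocks
  at 0, so n is at most \<open>s r\<close>, and the closing \<open>Test\<close> blocks unless
  \<open>r\<close> is exhausted. Only n = \<open>s r\<close> survives, and the guess behaves like a
  deterministic loop.\<close>

lemma rel_countdown: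
  assumes b: "\<And>s s'. rel b s s' \<longleftrightarrow> 0 < s r \<and> s' = f s" and f: "\<And>s. f s r = s r - 1"
  shows "rel (Cat (Star b) (Atom (Test r))) s s' \<longleftrightarrow> s' = (f ^^ s r) s"
proof -
  have *: "((f ^^ i) s) r = s r - i" for i
    by (induction i) (auto simp: f)
  have "(\<forall>i<n. i < s r) \<longleftrightarrow> n \<le> s r" for n
    by (metis leI less_irrefl order_less_le_trans)
  then have "rel (Cat (Star b) (Atom (Test r))) s s' \<longleftrightarrow> (\<exists>n\<le>s r. s' = (f ^^ n) s \<and> s r \<le> n)"
    by (auto simp: rel_Star_function[of b "\<lambda>s. 0 < s r" f, OF b] *)
  then show ?thesis by (metis order_antisym order_refl)
qed

section \<open>Basic counter programs\<close>

definition "clear r = Cat (Star (Atom (Dec r))) (Atom (Test r))"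

lemma rel_clear [simp]: "rel (clear r) s s' \<longleftrightarrow> s' = s(r := 0)"
proof -
  have "((\<lambda>s. s(r := s r - 1)) ^^ n) s = s(r := s r - n)" for n :: nat
    by (induction n) auto
  then show ?thesis
    unfolding clear_def by (subst rel_countdown[of _ r "\<lambda>s. s(r := s r - 1)"]) auto
qed

definition "move r d = Cat (Star (Cat (Atom (Dec r)) (Atom (Inc d)))) (Atom (Test r))"

lemma rel_move [simp]:
  assumes "r \<noteq> d"
  shows "rel (move r d) s s' \<longleftrightarrow> s' = s(r := 0, d := s d + s r)"
proof -
  have "((\<lambda>s. s(r := s r - 1, d := Suc (s d))) ^^ n) s = s(r := s r - n, d := s d + n)" for n :: nat
    using assms by (induction n) (auto simp: fun_eq_iff)
  then show ?thesis
    using assms unfolding move_def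
    by (subst rel_countdown[of _ r "\<lambda>s. s(r := s r - 1, d := Suc (s d))"]) auto
qed

text \<open>Counting a register down destroys it, so \<open>d\<close> and \<open>t\<close> are
  filled together and \<open>r\<close> is restored from \<open>t\<close>.\<close>

definition "copy r d t =
  Cat (Cat (Star (Cat (Atom (Dec r)) (Cat (Atom (Inc d)) (Atom (Inc t))))) (Atom (Test r))) (move t r)"

lemma rel_copy [simp]:
  assumes "r \<noteq> d" "r \<noteq> t" "d \<noteq> t" "s t = 0"
  shows "rel (copy r d t :: 'a action rexp) s s' \<longleftrightarrow> s' = s(d := s d + s r)"
proof -
  have 1: "((\<lambda>s. s(r := s r - 1, d := Suc (s d), t := Suc (s t))) ^^ n) s =
      s(r := s r - n, d := s d + n, t := s t + n)" for n and s :: "nat \<Rightarrow> nat"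
    using assms(1-3) by (induction n) (auto simp: fun_eq_iff)
  define loop :: "'a action rexp" where
    "loop = Cat (Star (Cat (Atom (Dec r)) (Cat (Atom (Inc d)) (Atom (Inc t))))) (Atom (Test r))"
  have "rel loop s s' \<longleftrightarrow> s' = s(r := 0, d := s d + s r, t := s t + s r)" for s s'
    using assms(1-3) unfolding loop_def
    by (subst rel_countdown[of _ r "\<lambda>s. s(r := s r - 1, d := Suc (s d), t := Suc (s t))"]) (auto simp: 1[simplified])
  then have "rel (copy r d t :: 'a action rexp) s s' \<longleftrightarrow>
      s' = s(r := 0, d := s d + s r, t := 0, r := s r)"
    using assms unfolding copy_def loop_def[symmetric] by simp
  also have "s(r := 0, d := s d + s r, t := 0, r := s r) = s(d := s d + s r)"
    using assms by (auto simp: fun_eq_iff)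
  finally show ?thesis .
qed

lemma pure_basic [simp]: "pure (clear r)" "pure (move r d)" "pure (copy r d t)"
  by (simp_all add: clear_def move_def copy_def)

primrec clear_range :: "nat \<Rightarrow> nat \<Rightarrow> 'a action rexp" where
  "clear_range b 0 = Eps"
| "clear_range b (Suc n) = Cat (clear b) (clear_range (Suc b) n)"

lemma pure_clear_range [simp]: "pure (clear_range b n)"
  by (induction n arbitrary: b) auto

lemma rel_clear_range [simp]:
  "rel (clear_range b n) s s' \<longleftrightarrow> s' = (\<lambda>r. if b \<le> r \<and> r < b + n then 0 else s r)"
proof (induction n arbitrary: b s)
  case (Suc n)
  have "(\<lambda>r. if Suc b \<le> r \<and> r < Suc b + n then 0 else (s(b := 0)) r) =
      (\<lambda>r. if b \<le> r \<and> r < b + Suc n then 0 else s r)"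
    by (auto simp: fun_eq_iff)
  with Suc show ?case by simp
qed (auto simp: fun_eq_iff)

text \<open>Registers from \<open>b\<close> on are scratch space: they are zero before and after the run.\<close>

definition computes :: "'a action rexp \<Rightarrow> recf \<Rightarrow> nat list \<Rightarrow> nat \<Rightarrow> nat \<Rightarrow> bool" where
  "computes e f ins out b \<longleftrightarrow> pure e \<and> (\<forall>s s'. s out = 0 \<longrightarrow> (\<forall>r\<ge>b. s r = 0) \<longrightarrow>
     (rel e s s' \<longleftrightarrow> (\<exists>y. eval f (map s ins) y \<and> s' = s(out := y))))"

section \<open>Compilation of partial recursive functions\<close>

definition load :: "(nat \<Rightarrow> nat) \<Rightarrow> nat \<Rightarrow> nat list \<Rightarrow> nat \<Rightarrow> nat" where
  "load s d ys r = (if d \<le> r \<and> r < d + length ys then ys ! (r - d) else s r)"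

lemma load_Nil [simp]: "load s d [] = s"
  by (simp add: load_def fun_eq_iff)

lemma load_Cons: "load s d (y # ys) = load (s(d := y)) (Suc d) ys"
  by (auto simp: load_def fun_eq_iff nth_Cons' Suc_diff_Suc)

text \<open>Values are stored in consecutive registers from \<open>d\<close> on. All inputs lie
  below \<open>d\<close>, so a stored value does not disturb the evaluations that follow.\<close>

lemma compile_list:
  assumes "\<And>g out b. g \<in> set gs \<Longrightarrow> out \<notin> set ins \<Longrightarrow> out < b \<Longrightarrow> \<forall>i\<in>set ins. i < b \<Longrightarrow> \<exists>e :: 'a action rexp. computes e g ins out b"
    and "\<forall>i\<in>set ins. i < d"
  shows "\<exists>e :: 'a action rexp. pure e \<and> (\<forall>s s'. (\<forall>r\<ge>d. s r = 0) \<longrightarrow>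
     (rel e s s' \<longleftrightarrow> (\<exists>ys. list_all2 (\<lambda>g y. eval g (map s ins) y) gs ys \<and> s' = load s d ys)))"
  using assms
proof (induction gs arbitrary: d)
  case Nil
  show ?case by (rule exI[of _ Eps]) simp
next
  case (Cons g gs)
  obtain e1 :: "'a action rexp" where e1: "computes e1 g ins d (Suc d)"
    using Cons.prems(1)[of g d "Suc d"] Cons.prems(2) by (auto simp: less_Suc_eq)
  have "\<exists>e :: 'a action rexp. pure e \<and> (\<forall>s s'. (\<forall>r\<ge>Suc d. s r = 0) \<longrightarrow>
     (rel e s s' \<longleftrightarrow> (\<exists>ys. list_all2 (\<lambda>g y. eval g (map s ins) y) gs ys \<and> s' = load s (Suc d) ys)))"
  proof (rule Cons.IH)
    show "\<exists>e :: 'a action rexp. computes e g' ins out b"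
      if "g' \<in> set gs" "out \<notin> set ins" "out < b" "\<forall>i\<in>set ins. i < b" for g' out b
      using Cons.prems(1) that by simp
    show "\<forall>i\<in>set ins. i < Suc d" using Cons.prems(2) by auto
  qed
  then obtain e2 :: "'a action rexp" where e2: "pure e2" "\<And>s s'. \<forall>r\<ge>Suc d. s r = 0 \<Longrightarrow>
     rel e2 s s' \<longleftrightarrow> (\<exists>ys. list_all2 (\<lambda>g y. eval g (map s ins) y) gs ys \<and> s' = load s (Suc d) ys)"
    by blast
  have "rel (Cat e1 e2) s s' \<longleftrightarrow> (\<exists>ys. list_all2 (\<lambda>g y. eval g (map s ins) y) (g # gs) ys \<and> s' = load s d ys)"
    if s: "\<forall>r\<ge>d. s r = 0" for s s'
  proof -
    have m: "map (s(d := y)) ins = map s ins" for y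
      using Cons.prems(2) by auto
    have "rel (Cat e1 e2) s s' \<longleftrightarrow> (\<exists>y. eval g (map s ins) y \<and> rel e2 (s(d := y)) s')"
      using e1 s by (auto simp: computes_def)
    also have "\<dots> \<longleftrightarrow> (\<exists>y ys. eval g (map s ins) y \<and> list_all2 (\<lambda>g y. eval g (map s ins) y) gs ys \<and>
        s' = load s d (y # ys))"
      using s by (auto simp: e2(2) m load_Cons)
    also have "\<dots> \<longleftrightarrow> (\<exists>ys. list_all2 (\<lambda>g y. eval g (map s ins) y) (g # gs) ys \<and> s' = load s d ys)"
      by (auto simp: list_all2_Cons1)
    finally show ?thesis .
  qed
  then show ?case using e1 e2(1) by (intro exI[of _ "Cat e1 e2"]) (auto simp: computes_def)
qed

lemma eval_Comp_iff: "eval (Comp f gs) xs y \<longleftrightarrow> (\<exists>ys. list_all2 (\<lambda>g y. eval g xs y) gs ys \<and> eval f ys y)"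
  by (auto elim: eval_CompE intro: eval.ev_Comp)

text \<open>The values of \<open>gs\<close> occupy the first scratch registers, serve as the inputs
  of \<open>f\<close>, and are cleared at the end to restore the scratch convention.\<close>

lemma compile_Comp:
  assumes f: "\<And>ins out b. out \<notin> set ins \<Longrightarrow> out < b \<Longrightarrow> \<forall>i\<in>set ins. i < b \<Longrightarrow> \<exists>e :: 'a action rexp. computes e f ins out b"
    and gs: "\<And>g out b. g \<in> set gs \<Longrightarrow> out \<notin> set ins \<Longrightarrow> out < b \<Longrightarrow> \<forall>i\<in>set ins. i < b \<Longrightarrow> \<exists>e :: 'a action rexp. computes e g ins out b"
    and out: "out < b" and ins: "\<forall>i\<in>set ins. i < b"
  shows "\<exists>e :: 'a action rexp. computes e (Comp f gs) ins out b"
proof -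
  obtain e1 :: "'a action rexp" where e1: "pure e1" "\<And>s s'. (\<forall>r\<ge>b. s r = 0) \<Longrightarrow>
     rel e1 s s' \<longleftrightarrow> (\<exists>ys. list_all2 (\<lambda>g y. eval g (map s ins) y) gs ys \<and> s' = load s b ys)"
    using compile_list[OF gs ins] by blast
  obtain e2 :: "'a action rexp" where e2: "computes e2 f [b..<b + length gs] out (b + length gs)"
    using f[of out "[b..<b + length gs]" "b + length gs"] out by auto
  define e where "e = Cat e1 (Cat e2 (clear_range b (length gs)))"
  have "rel e s s' \<longleftrightarrow> (\<exists>y. eval (Comp f gs) (map s ins) y \<and> s' = s(out := y))"
    if s: "s out = 0" "\<forall>r\<ge>b. s r = 0" for s s'
  proof -
    have "rel e s s' \<longleftrightarrow> (\<exists>ys. list_all2 (\<lambda>g y. eval g (map s ins) y) gs ys \<and>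
        rel (Cat e2 (clear_range b (length gs))) (load s b ys) s')"
      using s unfolding e_def by (auto simp: e1(2))
    moreover have "rel (Cat e2 (clear_range b (length gs))) (load s b ys) s' \<longleftrightarrow> (\<exists>y. eval f ys y \<and> s' = s(out := y))"
      if "length ys = length gs" for ys
    proof -
      have "map (load s b ys) [b..<b + length gs] = ys"
        using that by (auto simp: load_def intro: nth_equalityI)
      moreover have "(\<lambda>r. if b \<le> r \<and> r < b + length gs then 0 else ((load s b ys)(out := y)) r) = s(out := y)" for y
        using out s(2) that by (auto simp: load_def fun_eq_iff)
      moreover have "load s b ys out = 0" "\<forall>r\<ge>b + length gs. load s b ys r = 0"
        using out s that by (auto simp: load_def)
      ultimately show ?thesis using e2 by (auto simp: computes_def)
    qed
    ultimately show ?thesis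
      unfolding eval_Comp_iff by (metis list_all2_lengthD)
  qed
  then show ?thesis
    using e1(1) e2 by (intro exI[of _ e]) (auto simp: computes_def e_def)
qed

lemma eval_Prim_iff:
  "eval (Prim f g) (0 # xs) y \<longleftrightarrow> eval f xs y"
  "eval (Prim f g) (Suc n # xs) y \<longleftrightarrow> (\<exists>r. eval (Prim f g) (n # xs) r \<and> eval g (r # n # xs) y)"
  "\<not> eval (Prim f g) [] y"
  by (auto elim: eval_PrimE intro: eval.ev_Prim0 eval.ev_PrimS)

text \<open>Register \<open>b\<close> holds the round k, \<open>b + 1\<close> the current value,
  \<open>b + 2\<close> the number of rounds still to go, and \<open>b + 3\<close> the next
  value.\<close>

lemma compile_Prim:
  assumes f: "\<And>ins out b. out \<notin> set ins \<Longrightarrow> out < b \<Longrightarrow> \<forall>i\<in>set ins. i < b \<Longrightarrow> \<exists>e :: 'a action rexp. computes e f ins out b"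
    and g: "\<And>ins out b. out \<notin> set ins \<Longrightarrow> out < b \<Longrightarrow> \<forall>i\<in>set ins. i < b \<Longrightarrow> \<exists>e :: 'a action rexp. computes e g ins out b"
    and out: "out < b" "out \<notin> set ins" and ins: "\<forall>i\<in>set ins. i < b"
  shows "\<exists>e :: 'a action rexp. computes e (Prim f g) ins out b"
proof (cases ins)
  case Nil
  \<comment> \<open>Primitive recursion is undefined on the empty argument list, and
    \<open>Empty\<close> has no run.\<close>
  then show ?thesis by (intro exI[of _ Empty]) (simp add: computes_def eval_Prim_iff)
next
  case (Cons i js)
  have js: "\<forall>j\<in>set js. j < b" "i < b" "b \<noteq> out" "i \<noteq> out" using ins out Cons by auto
  obtain ef :: "'a action rexp" where ef: "computes ef f js (b + 1) (b + 3)"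
    using f[of "b + 1" js "b + 3"] js by fastforce
  obtain eg :: "'a action rexp" where eg: "computes eg g ((b + 1) # b # js) (b + 3) (b + 4)"
    using g[of "b + 3" "(b + 1) # b # js" "b + 4"] js by fastforce
  \<comment> \<open>Here \<open>b + 3\<close> is only the temporary of \<open>copy\<close>; it is
    zero again when \<open>eg\<close> stores into it.\<close>
  define pre where "pre = Cat (copy i (b + 2) (b + 3)) ef"
  define rest :: "'a action rexp" where
    "rest = Cat (clear (b + 1)) (Cat (move (b + 3) (b + 1)) (Atom (Inc b)))"
  define body where "body = Cat (Atom (Dec (b + 2))) (Cat eg rest)"
  define post :: "'a action rexp" where "post = Cat (Atom (Test (b + 2))) (Cat (clear b) (move (b + 1) out))"
  define e where "e = Cat pre (Cat (Star body) post)"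
  have "rel e s s' \<longleftrightarrow> (\<exists>y. eval (Prim f g) (map s ins) y \<and> s' = s(out := y))"
    if s: "s out = 0" "\<forall>r\<ge>b. s r = 0" for s s'
  proof -
    define xs where "xs = map s js"
    define St where "St k r m = s(b := k, b + 1 := r, b + 2 := m)" for k r m
    have map_js: "map (St k r m) js = xs" for k r m
      using js by (auto simp: St_def xs_def)
    have pre: "rel pre s t \<longleftrightarrow> (\<exists>r. eval f xs r \<and> t = St 0 r (s i))" for t
    proof -
      have 1: "rel (copy i (b + 2) (b + 3)) s t \<longleftrightarrow> t = St 0 0 (s i)" for t
        using js s by (subst rel_copy) (auto simp: St_def fun_eq_iff)
      have 2: "rel ef (St 0 0 (s i)) t \<longleftrightarrow> (\<exists>r. eval f xs r \<and> t = (St 0 0 (s i))(b + 1 := r))" for t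
        using ef s unfolding computes_def by (subst map_js[symmetric]) (auto simp: St_def)
      have 3: "(St 0 0 (s i))(b + 1 := r) = St 0 r (s i)" for r
        by (auto simp: St_def fun_eq_iff)
      have "rel pre s t \<longleftrightarrow> rel ef (St 0 0 (s i)) t"
        unfolding pre_def rel_simps(3) 1 by blast
      then show ?thesis unfolding 2 3 .
    qed
    have body: "rel body (St k r m) t \<longleftrightarrow> 0 < m \<and> (\<exists>y. eval g (r # k # xs) y \<and> t = St (Suc k) y (m - 1))" for k r m t
    proof -
      have 1: "rel (Atom (Dec (b + 2))) (St k r m) t \<longleftrightarrow> 0 < m \<and> t = St k r (m - 1)" for t
        by (auto simp: St_def fun_eq_iff)
      have 2: "rel eg (St k r (m - 1)) t \<longleftrightarrow> (\<exists>y. eval g (r # k # xs) y \<and> t = (St k r (m - 1))(b + 3 := y))" for t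
      proof -
        have "map (St k r (m - 1)) ((b + 1) # b # js) = r # k # xs"
          using map_js by (simp add: St_def)
        then show ?thesis using eg s unfolding computes_def by (auto simp: St_def)
      qed
      have 3: "rel rest ((St k r (m - 1))(b + 3 := y)) t \<longleftrightarrow> t = St (Suc k) y (m - 1)" for y t
        using s unfolding rest_def by (simp add: St_def) (auto simp: fun_eq_iff)
      have "rel body (St k r m) t \<longleftrightarrow> 0 < m \<and> rel (Cat eg rest) (St k r (m - 1)) t"
        unfolding body_def rel_simps(3)[of "Atom (Dec (b + 2))"] 1 by blast
      moreover have "rel (Cat eg rest) (St k r (m - 1)) t \<longleftrightarrow>
          (\<exists>y. eval g (r # k # xs) y \<and> rel rest ((St k r (m - 1))(b + 3 := y)) t)"
        unfolding rel_simps(3)[of eg] 2 by blast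
      ultimately show ?thesis unfolding 3 by simp
    qed
    \<comment> \<open>The loop may stop after any k rounds; the \<open>Test\<close> in
      \<open>post\<close> then selects k = n.\<close>
    have loop: "(\<exists>r0. eval f xs r0 \<and> (rel body)\<^sup>*\<^sup>* (St 0 r0 n) t) \<longleftrightarrow>
        (\<exists>k\<le>n. \<exists>r. eval (Prim f g) (k # xs) r \<and> t = St k r (n - k))" for t n
    proof
      assume "\<exists>r0. eval f xs r0 \<and> (rel body)\<^sup>*\<^sup>* (St 0 r0 n) t"
      then obtain r0 where r0: "eval f xs r0" and st: "(rel body)\<^sup>*\<^sup>* (St 0 r0 n) t" by blast
      from st show "\<exists>k\<le>n. \<exists>r. eval (Prim f g) (k # xs) r \<and> t = St k r (n - k)"
      proof induction
        case base
        show ?case using r0 by (intro exI[of _ 0]) (auto simp: eval_Prim_iff)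
      next
        case (step t u)
        then obtain k r where "k \<le> n" "eval (Prim f g) (k # xs) r" "t = St k r (n - k)" by blast
        with step(2) show ?case by (intro exI[of _ "Suc k"]) (auto simp: body eval_Prim_iff)
      qed
    next
      have "k \<le> n \<Longrightarrow> eval (Prim f g) (k # xs) r \<Longrightarrow> \<exists>r0. eval f xs r0 \<and> (rel body)\<^sup>*\<^sup>* (St 0 r0 n) (St k r (n - k))" for k r
      proof (induction k arbitrary: r)
        case (Suc k)
        then obtain r' where r': "eval (Prim f g) (k # xs) r'" "eval g (r' # k # xs) r"
          by (auto simp: eval_Prim_iff)
        with Suc obtain r0 where r0: "eval f xs r0" "(rel body)\<^sup>*\<^sup>* (St 0 r0 n) (St k r' (n - k))" by auto
        have "rel body (St k r' (n - k)) (St (Suc k) r (n - Suc k))"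
          using Suc.prems r' by (auto simp: body)
        with r0 show ?case by (meson rtranclp.rtrancl_into_rtrancl)
      qed (auto simp: eval_Prim_iff)
      then show "\<exists>k\<le>n. \<exists>r. eval (Prim f g) (k # xs) r \<and> t = St k r (n - k) \<Longrightarrow>
        \<exists>r0. eval f xs r0 \<and> (rel body)\<^sup>*\<^sup>* (St 0 r0 n) t" by blast
    qed
    have post: "rel post (St k r m) t \<longleftrightarrow> m = 0 \<and> t = s(out := r)" for k r m t
      using s out js unfolding post_def by (simp add: St_def) (auto simp: fun_eq_iff)
    have "rel e s s' \<longleftrightarrow> (\<exists>t. (\<exists>r0. eval f xs r0 \<and> (rel body)\<^sup>*\<^sup>* (St 0 r0 (s i)) t) \<and> rel post t s')"
      unfolding e_def rel_simps pre rel_Star by blast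
    also have "\<dots> \<longleftrightarrow> (\<exists>k\<le>s i. \<exists>r. eval (Prim f g) (k # xs) r \<and> rel post (St k r (s i - k)) s')"
      unfolding loop by blast
    also have "\<dots> \<longleftrightarrow> (\<exists>r. eval (Prim f g) (s i # xs) r \<and> s' = s(out := r))"
      unfolding post by (metis diff_is_0_eq' diff_self_eq_0 order_antisym order_refl diff_is_0_eq)
    finally show ?thesis by (simp add: Cons xs_def)
  qed
  moreover have "pure e" using ef eg by (simp add: e_def pre_def body_def rest_def post_def computes_def)
  ultimately show ?thesis unfolding computes_def by blast
qed

lemma eval_Mn_iff: "eval (Mn f) xs n \<longleftrightarrow> eval f (n # xs) 0 \<and> (\<forall>m<n. \<exists>y>0. eval f (m # xs) y)"
  by (auto elim: eval_MnE intro: eval.ev_Mn)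

text \<open>Register \<open>b\<close> holds the candidate and \<open>b + 1\<close> the value of
  \<open>f\<close> at it. \<open>Dec\<close> lets a round pass only for a positive value, and the
  \<open>Test\<close> after the loop allows stopping only at value 0. An undefined value leaves no
  run, in agreement with the premises of \<open>ev_Mn\<close>.\<close>

lemma compile_Mn:
  assumes f: "\<And>ins out b. out \<notin> set ins \<Longrightarrow> out < b \<Longrightarrow> \<forall>i\<in>set ins. i < b \<Longrightarrow> \<exists>e :: 'a action rexp. computes e f ins out b"
    and out: "out < b" "out \<notin> set ins" and ins: "\<forall>i\<in>set ins. i < b"
  shows "\<exists>e :: 'a action rexp. computes e (Mn f) ins out b"
proof -
  obtain ef :: "'a action rexp" where ef: "computes ef f (b # ins) (b + 1) (b + 2)"
    using f[of "b + 1" "b # ins" "b + 2"] ins by fastforce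
  define body where "body = Cat ef (Cat (Atom (Dec (b + 1))) (Cat (clear (b + 1)) (Atom (Inc b))))"
  define fin :: "'a action rexp" where "fin = Cat (Atom (Test (b + 1))) (move b out)"
  define post where "post = Cat ef fin"
  define e where "e = Cat (Star body) post"
  have "rel e s s' \<longleftrightarrow> (\<exists>y. eval (Mn f) (map s ins) y \<and> s' = s(out := y))"
    if s: "s out = 0" "\<forall>r\<ge>b. s r = 0" for s s'
  proof -
    define xs where "xs = map s ins"
    define St where "St k = s(b := k)" for k
    have ef': "rel ef (St k) t \<longleftrightarrow> (\<exists>y. eval f (k # xs) y \<and> t = (St k)(b + 1 := y))" for k t
    proof -
      have "map (St k) (b # ins) = k # xs" using ins by (auto simp: St_def xs_def)
      then show ?thesis using ef s unfolding computes_def by (auto simp: St_def)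
    qed
    have body: "rel body (St k) t \<longleftrightarrow> (\<exists>y>0. eval f (k # xs) y) \<and> t = St (Suc k)" for k t
    proof -
      have "rel (Cat (Atom (Dec (b + 1))) (Cat (clear (b + 1)) (Atom (Inc b)))) ((St k)(b + 1 := y)) t \<longleftrightarrow>
          0 < y \<and> t = St (Suc k)" for y
        using s by (simp add: St_def) (auto simp: fun_eq_iff)
      then show ?thesis
        by (simp only: body_def rel_simps(3)[of ef] ef') blast
    qed
    have loop: "(rel body)\<^sup>*\<^sup>* (St 0) t \<longleftrightarrow> (\<exists>k. (\<forall>m<k. \<exists>y>0. eval f (m # xs) y) \<and> t = St k)" for t
    proof
      assume "(rel body)\<^sup>*\<^sup>* (St 0) t"
      then show "\<exists>k. (\<forall>m<k. \<exists>y>0. eval f (m # xs) y) \<and> t = St k"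
      proof induction
        case base
        show ?case by (rule exI[of _ 0]) simp
      next
        case (step t u)
        then obtain k where "\<forall>m<k. \<exists>y>0. eval f (m # xs) y" "t = St k" by blast
        with step(2) show ?case by (intro exI[of _ "Suc k"]) (auto simp: body less_Suc_eq)
      qed
    next
      have "(\<forall>m<k. \<exists>y>0. eval f (m # xs) y) \<Longrightarrow> (rel body)\<^sup>*\<^sup>* (St 0) (St k)" for k
        by (induction k) (auto intro: rtranclp.rtrancl_into_rtrancl simp: body)
      then show "\<exists>k. (\<forall>m<k. \<exists>y>0. eval f (m # xs) y) \<and> t = St k \<Longrightarrow> (rel body)\<^sup>*\<^sup>* (St 0) t" by blast
    qed
    have post: "rel post (St k) t \<longleftrightarrow> eval f (k # xs) 0 \<and> t = s(out := k)" for k t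
    proof -
      have "rel fin ((St k)(b + 1 := y)) t \<longleftrightarrow> y = 0 \<and> t = s(out := k)" for y
        using s out unfolding fin_def by (simp add: St_def) (auto simp: fun_eq_iff)
      moreover have "rel post (St k) t \<longleftrightarrow> (\<exists>y. eval f (k # xs) y \<and>
          rel fin ((St k)(b + 1 := y)) t)"
        unfolding post_def rel_simps(3)[of ef] ef' by blast
      ultimately show ?thesis by simp
    qed
    have "St 0 = s" using s by (auto simp: St_def)
    then have "rel e s s' \<longleftrightarrow> (\<exists>t. (rel body)\<^sup>*\<^sup>* (St 0) t \<and> rel post t s')"
      by (simp add: e_def rel_Star)
    also have "\<dots> \<longleftrightarrow> (\<exists>k. (\<forall>m<k. \<exists>y>0. eval f (m # xs) y) \<and> eval f (k # xs) 0 \<and> s' = s(out := k))"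
      unfolding loop using post by blast
    finally show ?thesis unfolding eval_Mn_iff xs_def by blast
  qed
  moreover have "pure e" using ef by (simp add: e_def body_def post_def fin_def computes_def)
  ultimately show ?thesis unfolding computes_def by blast
qed

theorem compile:
  "out \<notin> set ins \<Longrightarrow> out < b \<Longrightarrow> \<forall>i\<in>set ins. i < b \<Longrightarrow> \<exists>e :: 'a action rexp. computes e f ins out b"
proof (induction f arbitrary: ins out b)
  case Zr
  have "eval Zr xs y \<longleftrightarrow> y = 0" for xs y by (auto elim: eval_ZrE intro: eval.ev_Zr)
  then show ?case by (intro exI[of _ Eps]) (auto simp: computes_def)
next
  case Sc
  have ev: "eval Sc xs y \<longleftrightarrow> (\<exists>x xs'. xs = x # xs' \<and> y = Suc x)" for xs y
    by (auto elim: eval_ScE intro: eval.ev_Sc)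
  show ?case
  proof (cases ins)
    case Nil
    then show ?thesis by (intro exI[of _ Empty]) (auto simp: computes_def ev)
  next
    case (Cons i js)
    then show ?thesis
      using Sc by (intro exI[of _ "Cat (copy i out b) (Atom (Inc out))"]) (auto simp: computes_def ev)
  qed
next
  case (Proj j)
  have ev: "eval (Proj j) xs y \<longleftrightarrow> j < length xs \<and> y = xs ! j" for xs y
    by (auto elim: eval_ProjE intro: eval.ev_Proj)
  show ?case
  proof (cases "j < length ins")
    case True
    then have "ins ! j \<noteq> out" "ins ! j \<noteq> b" "out \<noteq> b" using Proj by auto
    then show ?thesis
      using Proj True by (intro exI[of _ "copy (ins ! j) out b"]) (auto simp: computes_def ev)
  next
    case False
    then show ?thesis by (intro exI[of _ Empty]) (auto simp: computes_def ev)
  qed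
next
  case (Comp f gs)
  then show ?case by (intro compile_Comp) auto
next
  case (Prim f g)
  then show ?case by (intro compile_Prim) auto
next
  case (Mn f)
  then show ?case by (intro compile_Mn) auto
qed


text \<open>The register content before \<open>w\<close> is read, when \<open>m\<close> is to be
  left over afterwards.\<close>

primrec push :: "('a \<Rightarrow> nat) \<Rightarrow> 'a list \<Rightarrow> nat \<Rightarrow> nat" where
  "push e [] m = m"
| "push e (a # w) m = Suc (prod_encode (e a, push e w m))"

lemma push_0: "push e w 0 = list_encode (map e w)"
  by (induction w) auto

text \<open>The first letter arrives first, but \<open>list_encode\<close> builds the code from the
  last letter on. The program therefore guesses the code in advance, keeps it in register 0 and
  peels a copy in register 1 letter by letter while reading; afterwards it runs \<open>f\<close> on
  register 0. Wrong guesses block.\<close>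

theorem RE_lang_program:
  fixes L :: "('a::finite) list set"
  assumes "RE_lang L"
  shows "\<exists>E :: 'a action rexp. \<forall>w. w \<in> L \<longleftrightarrow> sem E (\<lambda>_. 0) w (\<lambda>_. 0)"
proof -
  obtain e :: "'a \<Rightarrow> nat" and A where e: "inj e" and A: "RE_nat A" "A = list_encode ` map e ` L"
    using assms by (auto simp: RE_lang_def bij_betw_def)
  obtain f where f: "A = {n. \<exists>y. eval f [n] y}" using A(1) by (auto simp: RE_nat_def)
  have L: "w \<in> L \<longleftrightarrow> (\<exists>y. eval f [list_encode (map e w)] y)" for w
  proof -
    have "w \<in> L \<longleftrightarrow> list_encode (map e w) \<in> A"
      unfolding A(2) using e by (auto simp: list_encode_eq inj_map_eq_map)
    then show ?thesis by (simp add: f)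
  qed
  define St :: "nat \<Rightarrow> nat \<Rightarrow> nat \<Rightarrow> nat" where "St N n = (\<lambda>_. 0)(0 := N, 1 := n)" for N n
  \<comment> \<open>Peeling off a letter avoids decoding: guess the remaining code m, recompute the
    code with \<open>a\<close> in front of it, and compare that with register 1.\<close>
  have "\<exists>D :: 'a action rexp. pure D \<and> (\<forall>N n t. rel D (St N n) t \<longleftrightarrow> (\<exists>m. n = Suc (prod_encode (e a, m)) \<and> t = St N m))" for a
  proof -
    have "total_rec 1 (\<lambda>xs. Suc (prod_encode (e a, xs ! 0)))"
      by (intro total_rec_Suc total_rec_prod_encode total_rec_const total_rec_nth) simp
    then obtain g where g0: "\<And>xs. length xs = 1 \<Longrightarrow> eval g xs (Suc (prod_encode (e a, xs ! 0)))"
      by (auto simp: total_rec_def)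
    have g: "eval g [m] y \<longleftrightarrow> y = Suc (prod_encode (e a, m))" for m y
      using g0[of "[m]"] eval_det[of g "[m]"] by auto
    obtain eg :: "'a action rexp" where eg: "computes eg g [2] 3 4"
      using compile[of 3 "[2]" 4 g] by auto
    define guess :: "'a action rexp" where "guess = Star (Atom (Inc 2))"
    \<comment> \<open>Both registers decrease together, so the two zero tests in \<open>fin\<close>
      succeed exactly for equal contents.\<close>
    define compare :: "'a action rexp" where "compare = Star (Cat (Atom (Dec 1)) (Atom (Dec 3)))"
    define fin :: "'a action rexp" where "fin = Cat (Atom (Test 1)) (Cat (Atom (Test 3)) (move 2 1))"
    define D where "D = Cat guess (Cat eg (Cat compare fin))"
    have "rel D (St N n) t \<longleftrightarrow> (\<exists>m. n = Suc (prod_encode (e a, m)) \<and> t = St N m)" for N n t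
    proof -
      have "((\<lambda>s. s(2 := Suc (s 2))) ^^ m) s = s(2 := s 2 + m)" for m and s :: "nat \<Rightarrow> nat"
        by (induction m) auto
      then have guess: "rel guess (St N n) t \<longleftrightarrow> (\<exists>m. t = (St N n)(2 := m))" for t
        unfolding guess_def
        by (subst rel_Star_function[of _ "\<lambda>_. True" "\<lambda>s. s(2 := Suc (s 2))"]) (auto simp: St_def)
      have eg': "rel eg ((St N n)(2 := m)) t \<longleftrightarrow> t = (St N n)(2 := m, 3 := Suc (prod_encode (e a, m)))" for m t
        using eg unfolding computes_def by (auto simp: St_def g)
      have iter: "((\<lambda>s. s(1 := s 1 - 1, 3 := s 3 - 1)) ^^ i) s = s(1 := s 1 - i, 3 := s 3 - i)"
        for i and s :: "nat \<Rightarrow> nat"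
        by (induction i) (auto simp: fun_eq_iff)
      have comp: "rel (Cat compare fin) ((St N n)(2 := m, 3 := k)) t \<longleftrightarrow> n = k \<and> t = St N m" for m k t
      proof -
        have "rel compare s u \<longleftrightarrow> (\<exists>i. (\<forall>j<i. j < s 1 \<and> j < s 3) \<and> u = s(1 := s 1 - i, 3 := s 3 - i))" for s u
          unfolding compare_def
          by (subst rel_Star_function[of _ "\<lambda>s. 0 < s 1 \<and> 0 < s 3" "\<lambda>s. s(1 := s 1 - 1, 3 := s 3 - 1)"])
            (auto simp: iter[simplified])
        moreover have "(\<forall>j<i. j < a \<and> j < b) \<longleftrightarrow> i \<le> a \<and> i \<le> b" for i a b :: nat
          by (metis leI less_irrefl order_less_le_trans)
        ultimately have c: "rel compare s u \<longleftrightarrow> (\<exists>i\<le>s 1. i \<le> s 3 \<and> u = s(1 := s 1 - i, 3 := s 3 - i))" for s u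
          by simp
        have "rel (Cat compare fin) s t \<longleftrightarrow>
            (\<exists>i\<le>s 1. i \<le> s 3 \<and> rel fin (s(1 := s 1 - i, 3 := s 3 - i)) t)" for s
          unfolding rel_simps(3) c by blast
        also have "(\<exists>i\<le>s 1. i \<le> s 3 \<and> rel fin (s(1 := s 1 - i, 3 := s 3 - i)) t) \<longleftrightarrow>
            s 1 = s 3 \<and> t = s(1 := s 2, 2 := 0, 3 := 0)" for s
        proof -
          have "rel fin (s(1 := s 1 - i, 3 := s 3 - i)) t \<longleftrightarrow> s 1 \<le> i \<and> s 3 \<le> i \<and> t = s(1 := s 2, 2 := 0, 3 := 0)" for i
            unfolding fin_def by (auto simp: fun_upd_twist)
          then show ?thesis by (metis order_antisym order_refl)
        qed
        finally have "rel (Cat compare fin) s t \<longleftrightarrow> s 1 = s 3 \<and> t = s(1 := s 2, 2 := 0, 3 := 0)" for s .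
        moreover have "(St N n)(2 := m, 3 := k, 1 := m, 2 := 0, 3 := 0) = St N m"
          by (auto simp: St_def fun_eq_iff)
        ultimately show ?thesis by (simp add: St_def)
      qed
      have "rel D (St N n) t \<longleftrightarrow> (\<exists>m. rel (Cat eg (Cat compare fin)) ((St N n)(2 := m)) t)"
        unfolding D_def rel_simps(3)[of guess] guess by blast
      also have "\<dots> \<longleftrightarrow> (\<exists>m. rel (Cat compare fin) ((St N n)(2 := m, 3 := Suc (prod_encode (e a, m)))) t)"
        unfolding rel_simps(3)[of eg] eg' by blast
      finally show ?thesis unfolding comp .
    qed
    moreover have "pure D" using eg by (simp add: D_def guess_def compare_def fin_def computes_def)
    ultimately show ?thesis by blast
  qed
  then obtain D :: "'a \<Rightarrow> 'a action rexp" where D: "\<And>a. pure (D a)"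
    "\<And>a N n t. rel (D a) (St N n) t \<longleftrightarrow> (\<exists>m. n = Suc (prod_encode (e a, m)) \<and> t = St N m)"
    by metis
  obtain as :: "'a list" where as: "set as = UNIV" using finite_list[of "UNIV :: 'a set"] by auto
  define X where "X = foldr Alt (map (\<lambda>a. Cat (Atom (Read a)) (D a)) as) Empty"
  have X: "sem X s u t \<longleftrightarrow> (\<exists>a. u = [a] \<and> rel (D a) s t)" for s u t
  proof -
    have "sem (foldr Alt es Empty) s u t \<longleftrightarrow> (\<exists>e\<in>set es. sem e s u t)" for es :: "'a action rexp list"
      by (induction es) (auto simp: sem_Empty sem_Alt)
    then show ?thesis by (simp add: X_def as sem_Cat sem_Read sem_pure D(1))
  qed
  have loop: "sem (Star X) (St N n) w t \<longleftrightarrow> (\<exists>m. n = push e w m \<and> t = St N m)" for N n w t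
  proof (induction w arbitrary: n)
    case Nil
    show ?case by (subst sem_Star_unfold) (auto simp: X)
  next
    case (Cons a w)
    have "sem (Star X) (St N n) (a # w) t \<longleftrightarrow> (\<exists>u. rel (D a) (St N n) u \<and> sem (Star X) u w t)"
    proof
      assume "sem (Star X) (St N n) (a # w) t"
      then show "\<exists>u. rel (D a) (St N n) u \<and> sem (Star X) u w t"
        by (subst (asm) sem_Star_unfold) (auto simp: X)
    next
      assume "\<exists>u. rel (D a) (St N n) u \<and> sem (Star X) u w t"
      then obtain u where "sem X (St N n) [a] u" "sem (Star X) u w t" by (auto simp: X)
      then show "sem (Star X) (St N n) (a # w) t"
        by (subst sem_Star_unfold) (metis append_Cons append_Nil)
    qed
    also have "\<dots> \<longleftrightarrow> (\<exists>m. n = Suc (prod_encode (e a, m)) \<and> sem (Star X) (St N m) w t)"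
      unfolding D(2) by blast
    finally show ?case unfolding Cons by auto
  qed
  obtain ef :: "'a action rexp" where ef: "computes ef f [0] 2 3"
    using compile[of 2 "[0]" 3 f] by auto
  define pre :: "'a action rexp" where "pre = Cat (Star (Atom (Inc 0))) (copy 0 1 2)"
  \<comment> \<open>The final state has to be zero everywhere, but the guessed code in register 0
    and the value of \<open>f\<close> in register 2 are still there.\<close>
  define clean :: "'a action rexp" where "clean = Cat (clear 0) (clear 2)"
  define post where "post = Cat (Atom (Test 1)) (Cat ef clean)"
  have "((\<lambda>s. s(0 := Suc (s 0))) ^^ m) s = s(0 := s 0 + m)" for m and s :: "nat \<Rightarrow> nat"
    by (induction m) auto
  then have guess: "rel (Star (Atom (Inc 0)) :: 'a action rexp) (\<lambda>_. 0) t \<longleftrightarrow> (\<exists>m. t = (\<lambda>_. 0)(0 := m))" for t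
    by (subst rel_Star_function[of _ "\<lambda>_. True" "\<lambda>s. s(0 := Suc (s 0))"]) auto
  have pre: "rel pre (\<lambda>_. 0) t \<longleftrightarrow> (\<exists>n. t = St n n)" for t
  proof -
    have "rel (copy 0 1 2 :: 'a action rexp) ((\<lambda>_. 0)(0 := m)) t \<longleftrightarrow> t = St m m" for m
      by (subst rel_copy) (auto simp: St_def)
    then show ?thesis unfolding pre_def rel_simps(3) guess by blast
  qed
  have post: "rel post (St n m) (\<lambda>_. 0) \<longleftrightarrow> m = 0 \<and> (\<exists>y. eval f [n] y)" for n m
  proof -
    have "rel ef (St n 0) t \<longleftrightarrow> (\<exists>y. eval f [n] y \<and> t = (St n 0)(2 := y))" for t
      using ef unfolding computes_def by (simp add: St_def)
    moreover have "rel clean ((St n 0)(2 := y)) (\<lambda>_. 0)" for y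
      unfolding clean_def by (simp add: St_def) (auto simp: fun_eq_iff)
    ultimately have "rel (Cat ef clean) (St n 0) (\<lambda>_. 0) \<longleftrightarrow> (\<exists>y. eval f [n] y)"
      unfolding rel_simps(3) by blast
    moreover have "rel post (St n m) (\<lambda>_. 0) \<longleftrightarrow> m = 0 \<and> rel (Cat ef clean) (St n m) (\<lambda>_. 0)"
      unfolding post_def rel_simps(3)[of "Atom (Test 1)"] by (auto simp: St_def)
    ultimately show ?thesis by auto
  qed
  have "pure pre" "pure post" using ef by (simp_all add: pre_def post_def clean_def computes_def)
  then have "sem (Cat pre (Cat (Star X) post)) (\<lambda>_. 0) w (\<lambda>_. 0) \<longleftrightarrow>
      (\<exists>t u. rel pre (\<lambda>_. 0) t \<and> sem (Star X) t w u \<and> rel post u (\<lambda>_. 0))" for w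
    unfolding sem_Cat by (simp add: sem_pure) (metis append_Nil2)
  then have "sem (Cat pre (Cat (Star X) post)) (\<lambda>_. 0) w (\<lambda>_. 0) \<longleftrightarrow> w \<in> L" for w
    unfolding pre L push_0[symmetric] using loop post by (metis (no_types, lifting))
  then show ?thesis by blast
qed

section \<open>Equations between computation histories\<close>

definition left_word :: "('a option \<times> nat list \<times> nat list) list \<Rightarrow> nat list" where
  "left_word xs = concat (map (fst \<circ> snd) xs)"

definition right_word :: "('a option \<times> nat list \<times> nat list) list \<Rightarrow> nat list" where
  "right_word xs = concat (map (snd \<circ> snd) xs)"

lemma pair_words_simps [simp]:
  "left_word [] = []" "left_word ((s, u, v) # xs) = u @ left_word xs" "left_word (xs @ ys) = left_word xs @ left_word ys"
  "right_word [] = []" "right_word ((s, u, v) # xs) = v @ right_word xs" "right_word (xs @ ys) = right_word xs @ right_word ys"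
  by (auto simp: left_word_def right_word_def)

definition emits :: "('a option \<times> nat list \<times> nat list) rexp \<Rightarrow> 'a list \<Rightarrow> nat list \<Rightarrow> nat list \<Rightarrow> bool" where
  "emits e w u v \<longleftrightarrow> (\<exists>xs. matches e xs \<and> label_word xs = w \<and> left_word xs = u \<and> right_word xs = v)"

lemma emits_Cat: "emits (Cat a b) w u v \<longleftrightarrow>
  (\<exists>w1 w2 u1 u2 v1 v2. w = w1 @ w2 \<and> u = u1 @ u2 \<and> v = v1 @ v2 \<and> emits a w1 u1 v1 \<and> emits b w2 u2 v2)"
proof
  assume "emits (Cat a b) w u v"
  then obtain xs ys where "matches a xs" "matches b ys" "w = label_word xs @ label_word ys"
    "u = left_word xs @ left_word ys" "v = right_word xs @ right_word ys"
    by (auto simp: emits_def)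
  then show "\<exists>w1 w2 u1 u2 v1 v2. w = w1 @ w2 \<and> u = u1 @ u2 \<and> v = v1 @ v2 \<and> emits a w1 u1 v1 \<and> emits b w2 u2 v2"
    unfolding emits_def by blast
next
  assume "\<exists>w1 w2 u1 u2 v1 v2. w = w1 @ w2 \<and> u = u1 @ u2 \<and> v = v1 @ v2 \<and> emits a w1 u1 v1 \<and> emits b w2 u2 v2"
  then obtain xs ys where "matches a xs" "matches b ys" "w = label_word xs @ label_word ys"
    "u = left_word xs @ left_word ys" "v = right_word xs @ right_word ys"
    unfolding emits_def by blast
  then show "emits (Cat a b) w u v"
    unfolding emits_def by (intro exI[of _ "xs @ ys"]) auto
qed

lemma emits_Atom: "emits (Atom (s, u', v')) w u v \<longleftrightarrow> w = (case s of None \<Rightarrow> [] | Some a \<Rightarrow> [a]) \<and> u = u' \<and> v = v'"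
  by (cases s) (auto simp: emits_def)

lemma emits_Eps: "emits Eps w u v \<longleftrightarrow> w = [] \<and> u = [] \<and> v = []"
  by (auto simp: emits_def)

text \<open>An unchanged counter with a guessed content: both words grow by equally many
  letters.\<close>

definition repeat :: "nat \<Rightarrow> ('a option \<times> nat list \<times> nat list) rexp" where
  "repeat i = Star (Atom (None, [i], [i]))"

lemma emits_repeat: "emits (repeat i) w u v \<longleftrightarrow> w = [] \<and> (\<exists>n. u = replicate n i \<and> v = replicate n i)"
proof -
  have 1: "\<exists>n. xs = replicate n (None, [i], [i])" if "matches (repeat i) xs" for xs :: "('a option \<times> nat list \<times> nat list) list"
  proof -
    from that obtain us where "\<forall>u\<in>set us. u = [(None, [i], [i])]" "xs = concat us"
      by (auto simp: repeat_def matches_Star)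
    moreover have "\<forall>u\<in>set us. u = [(None, [i], [i])] \<Longrightarrow> concat us = replicate (length us) (None :: 'a option, [i], [i])" for us
      by (induction us) auto
    ultimately show ?thesis by blast
  qed
  have 2: "matches (repeat i) (replicate n (None :: 'a option, [i], [i]))" for n
    unfolding repeat_def matches_Star
    by (rule exI[of _ "replicate n [(None, [i], [i])]"]) (induction n, auto)
  have "label_word (replicate n (None :: 'a option, [i], [i])) = []" "left_word (replicate n (None :: 'a option, [i], [i])) = replicate n i"
     "right_word (replicate n (None :: 'a option, [i], [i])) = replicate n i" for n
    by (induction n) auto
  with 1 2 show ?thesis unfolding emits_def by metis
qed

text \<open>The effect of an action on a single counter. Treated one counter at a time, the contents
  before and after can be emitted in parallel by a regular expression, with no number to be
  remembered. In the \<open>Dec\<close> clause, \<open>n = Suc n'\<close> includes the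
  guard.\<close>

primrec update :: "'a action \<Rightarrow> nat \<Rightarrow> nat \<Rightarrow> nat \<Rightarrow> bool" where
  "update (Read a) i n n' \<longleftrightarrow> n' = n"
| "update (Inc r) i n n' \<longleftrightarrow> n' = (if i = r then Suc n else n)"
| "update (Dec r) i n n' \<longleftrightarrow> n = (if i = r then Suc n' else n')"
| "update (Test r) i n n' \<longleftrightarrow> n' = n \<and> (i = r \<longrightarrow> n = 0)"

lemma act_update: "act \<alpha> s s' \<longleftrightarrow> (\<forall>i. update \<alpha> i (s i) (s' i))"
proof (cases \<alpha>)
  case (Dec r)
  show ?thesis
  proof
    assume u: "\<forall>i. update \<alpha> i (s i) (s' i)"
    have "s r = Suc (s' r)" "\<And>i. i \<noteq> r \<Longrightarrow> s' i = s i"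
      using u[rule_format] Dec by (metis update.simps(3))+
    then show "act \<alpha> s s'" using Dec by (auto simp: fun_eq_iff)
  qed (auto simp: Dec)
qed (auto simp: fun_eq_iff)

text \<open>The left word receives the counter after the action and the right word the counter
  before it; so the additional letter of \<open>Inc\<close> goes left and that of \<open>Dec\<close>
  goes right.\<close>

primrec block :: "'a action \<Rightarrow> nat \<Rightarrow> ('a option \<times> nat list \<times> nat list) rexp" where
  "block (Read a) i = repeat i"
| "block (Inc r) i = (if i = r then Cat (Atom (None, [r], [])) (repeat r) else repeat i)"
| "block (Dec r) i = (if i = r then Cat (Atom (None, [], [r])) (repeat r) else repeat i)"
| "block (Test r) i = (if i = r then Eps else repeat i)"

lemma emits_block:
  "emits (block \<alpha> i) w u v \<longleftrightarrow> w = [] \<and> (\<exists>n n'. v = replicate n i \<and> u = replicate n' i \<and> update \<alpha> i n n')"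
proof (cases \<alpha>)
  case (Read a)
  then show ?thesis by (auto simp: emits_repeat)
next
  case (Inc r)
  then show ?thesis by (cases "i = r") (auto simp: emits_repeat emits_Cat emits_Atom)
next
  case (Dec r)
  then show ?thesis by (cases "i = r") (auto simp: emits_repeat emits_Cat emits_Atom)
next
  case (Test r)
  then show ?thesis by (cases "i = r") (auto simp: emits_repeat emits_Eps)
qed

definition config :: "nat \<Rightarrow> (nat \<Rightarrow> nat) \<Rightarrow> nat list" where
  "config k s = concat (map (\<lambda>i. replicate (s i) i) [0..<k]) @ [k]"

definition supported :: "nat \<Rightarrow> (nat \<Rightarrow> nat) \<Rightarrow> bool" where
  "supported k s \<longleftrightarrow> (\<forall>i\<ge>k. s i = 0)"

lemma count_config:
  "count_list (concat (map (\<lambda>i. replicate (s i) i) [0..<k])) j = (if j < k then s j else 0)"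
proof (induction k)
  case (Suc k)
  have "count_list (replicate n i) j = (if i = j then n else 0)" for n i :: nat
    by (induction n) auto
  with Suc show ?case by (auto simp: less_Suc_eq)
qed simp

text \<open>The letter \<open>k\<close> occurs only as the end marker, which makes configurations a
  prefix code; counting letters recovers the counters below \<open>k\<close>, and
  \<open>supported\<close> fixes the others.\<close>

lemma config_inject:
  assumes "supported k s" "supported k t" "config k s @ u = config k t @ v"
  shows "s = t \<and> u = v"
proof -
  define X where "X s = concat (map (\<lambda>i. replicate (s i) i) [0..<k])" for s :: "nat \<Rightarrow> nat"
  have "k \<notin> set (X s)" for s by (auto simp: X_def)
  then have "takeWhile (\<lambda>x. x \<noteq> k) (X s @ k # u) = X s" for s u
    by (subst takeWhile_append2) auto
  moreover have *: "X s @ k # u = X t @ k # v" using assms(3) by (simp add: X_def config_def)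
  ultimately have "X s = X t" by metis
  with * have eq: "X s = X t" "u = v" by auto
  then have "s j = t j" for j
    using count_config[of s k j] count_config[of t k j] assms(1,2)
    by (cases "j < k") (auto simp: X_def supported_def)
  with eq show ?thesis by auto
qed

primrec sweep :: "nat \<Rightarrow> 'a action \<Rightarrow> nat list \<Rightarrow> ('a option \<times> nat list \<times> nat list) rexp" where
  "sweep k \<alpha> [] = Atom (None, [k], [k])"
| "sweep k \<alpha> (i # js) = Cat (block \<alpha> i) (sweep k \<alpha> js)"

lemma emits_sweep:
  assumes "distinct js"
  shows "emits (sweep k \<alpha> js) w u v \<longleftrightarrow> w = [] \<and> (\<exists>s s'. (\<forall>i\<in>set js. update \<alpha> i (s i) (s' i)) \<and>
    u = concat (map (\<lambda>i. replicate (s' i) i) js) @ [k] \<and> v = concat (map (\<lambda>i. replicate (s i) i) js) @ [k])"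
  using assms
proof (induction js arbitrary: w u v)
  case (Cons j js)
  show ?case
  proof
    assume "emits (sweep k \<alpha> (j # js)) w u v"
    then obtain n n' s s' where *: "w = []" "update \<alpha> j n n'" "\<forall>i\<in>set js. update \<alpha> i (s i) (s' i)"
      "u = replicate n' j @ concat (map (\<lambda>i. replicate (s' i) i) js) @ [k]"
      "v = replicate n j @ concat (map (\<lambda>i. replicate (s i) i) js) @ [k]"
      using Cons by (auto simp: emits_Cat emits_block)
    \<comment> \<open>By distinctness \<open>j\<close> is not in \<open>js\<close>, so the values at
      \<open>j\<close> can be patched in without touching the rest.\<close>
    have **: "map (\<lambda>i. replicate ((s(j := n)) i) i) js = map (\<lambda>i. replicate (s i) i) js" for n s
      using Cons.prems by auto
    have "\<forall>i\<in>set (j # js). update \<alpha> i ((s(j := n)) i) ((s'(j := n')) i)" using Cons.prems * by auto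
    moreover have "u = concat (map (\<lambda>i. replicate ((s'(j := n')) i) i) (j # js)) @ [k]"
      "v = concat (map (\<lambda>i. replicate ((s(j := n)) i) i) (j # js)) @ [k]"
      unfolding list.map concat.simps ** using * by simp_all
    ultimately show "w = [] \<and> (\<exists>s s'. (\<forall>i\<in>set (j # js). update \<alpha> i (s i) (s' i)) \<and>
      u = concat (map (\<lambda>i. replicate (s' i) i) (j # js)) @ [k] \<and> v = concat (map (\<lambda>i. replicate (s i) i) (j # js)) @ [k])"
      using *(1) by blast
  next
    assume "w = [] \<and> (\<exists>s s'. (\<forall>i\<in>set (j # js). update \<alpha> i (s i) (s' i)) \<and>
      u = concat (map (\<lambda>i. replicate (s' i) i) (j # js)) @ [k] \<and> v = concat (map (\<lambda>i. replicate (s i) i) (j # js)) @ [k])"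
    then obtain s s' where *: "w = []" "\<forall>i\<in>set (j # js). update \<alpha> i (s i) (s' i)"
      "u = replicate (s' j) j @ concat (map (\<lambda>i. replicate (s' i) i) js) @ [k]"
      "v = replicate (s j) j @ concat (map (\<lambda>i. replicate (s i) i) js) @ [k]" by auto
    then have "emits (block \<alpha> j) [] (replicate (s' j) j) (replicate (s j) j)"
      by (auto simp: emits_block)
    moreover have "emits (sweep k \<alpha> js) [] (concat (map (\<lambda>i. replicate (s' i) i) js) @ [k])
        (concat (map (\<lambda>i. replicate (s i) i) js) @ [k])"
      using Cons * by auto
    ultimately show "emits (sweep k \<alpha> (j # js)) w u v"
      unfolding sweep.simps emits_Cat * by blast
  qed
qed (auto simp: emits_Atom)

primrec register_bound :: "nat \<Rightarrow> 'a action \<Rightarrow> bool" where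
  "register_bound k (Read a) \<longleftrightarrow> True"
| "register_bound k (Inc r) \<longleftrightarrow> r < k"
| "register_bound k (Dec r) \<longleftrightarrow> r < k"
| "register_bound k (Test r) \<longleftrightarrow> r < k"

definition action_rexp :: "nat \<Rightarrow> 'a action \<Rightarrow> ('a option \<times> nat list \<times> nat list) rexp" where
  "action_rexp k \<alpha> = Cat (case \<alpha> of Read a \<Rightarrow> Atom (Some a, [], []) | _ \<Rightarrow> Eps) (sweep k \<alpha> [0..<k])"

lemma emits_action:
  assumes "register_bound k \<alpha>"
  shows "emits (action_rexp k \<alpha>) w u v \<longleftrightarrow> w = reads [\<alpha>] \<and>
    (\<exists>s s'. supported k s \<and> supported k s' \<and> act \<alpha> s s' \<and> u = config k s' \<and> v = config k s)"
proof -
  have "emits (case \<alpha> of Read a \<Rightarrow> Atom (Some a, [], []) | _ \<Rightarrow> Eps) w u v \<longleftrightarrow> w = reads [\<alpha>] \<and> u = [] \<and> v = []"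
    for w u v
    by (cases \<alpha>) (auto simp: emits_Atom emits_Eps)
  then have 1: "emits (action_rexp k \<alpha>) w u v \<longleftrightarrow> w = reads [\<alpha>] \<and> emits (sweep k \<alpha> [0..<k]) [] u v"
    unfolding action_rexp_def emits_Cat by (auto simp: emits_sweep)
  have "emits (sweep k \<alpha> [0..<k]) [] u v \<longleftrightarrow>
    (\<exists>s s'. supported k s \<and> supported k s' \<and> act \<alpha> s s' \<and> u = config k s' \<and> v = config k s)"
  proof
    assume "emits (sweep k \<alpha> [0..<k]) [] u v"
    then obtain s s' where ss: "\<forall>i<k. update \<alpha> i (s i) (s' i)" "u = config k s'" "v = config k s"
      unfolding emits_sweep[OF distinct_upt] config_def by fastforce
    \<comment> \<open>The expression says nothing about counters from \<open>k\<close> on. Setting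
      them to 0 makes the states supported, and the register bound keeps the action valid.\<close>
    define cut where "cut s i = (if i < k then s i else 0)" for s :: "nat \<Rightarrow> nat" and i
    have "map (\<lambda>i. replicate (cut s i) i) [0..<k] = map (\<lambda>i. replicate (s i) i) [0..<k]" for s
      by (auto simp: cut_def)
    then have "config k (cut s) = config k s" for s unfolding config_def by metis
    moreover have "act \<alpha> (cut s) (cut s')"
      using ss(1) assms unfolding act_update by (cases \<alpha>) (auto simp: cut_def)
    moreover have "supported k (cut s)" for s by (simp add: supported_def cut_def)
    ultimately show "\<exists>s s'. supported k s \<and> supported k s' \<and> act \<alpha> s s' \<and> u = config k s' \<and> v = config k s"
      using ss by metis
  next
    assume "\<exists>s s'. supported k s \<and> supported k s' \<and> act \<alpha> s s' \<and> u = config k s' \<and> v = config k s"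
    then show "emits (sweep k \<alpha> [0..<k]) [] u v"
      by (auto simp: emits_sweep config_def act_update)
  qed
  with 1 show ?thesis by blast
qed

section \<open>Histories of runs\<close>

primrec history :: "nat \<Rightarrow> 'a action rexp \<Rightarrow> ('a option \<times> nat list \<times> nat list) rexp" where
  "history k Empty = Empty"
| "history k Eps = Eps"
| "history k (Atom \<alpha>) = action_rexp k \<alpha>"
| "history k (Alt a b) = Alt (history k a) (history k b)"
| "history k (Cat a b) = Cat (history k a) (history k b)"
| "history k (Star a) = Star (history k a)"

text \<open>Every step is correct by itself, but the state after a step need not be the state before
  the next one.\<close>

definition pseudo_run :: "nat \<Rightarrow> 'a action list \<Rightarrow> ((nat \<Rightarrow> nat) \<times> (nat \<Rightarrow> nat)) list \<Rightarrow> bool" where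
  "pseudo_run k = list_all2 (\<lambda>\<alpha> (s, s'). supported k s \<and> supported k s' \<and> act \<alpha> s s')"

definition befores :: "nat \<Rightarrow> ((nat \<Rightarrow> nat) \<times> (nat \<Rightarrow> nat)) list \<Rightarrow> nat list" where
  "befores k ps = concat (map (config k \<circ> fst) ps)"

definition afters :: "nat \<Rightarrow> ((nat \<Rightarrow> nat) \<times> (nat \<Rightarrow> nat)) list \<Rightarrow> nat list" where
  "afters k ps = concat (map (config k \<circ> snd) ps)"

lemma befores_afters_simps [simp]:
  "befores k [] = []" "befores k (p # ps) = config k (fst p) @ befores k ps" "befores k (ps @ qs) = befores k ps @ befores k qs"
  "afters k [] = []" "afters k (p # ps) = config k (snd p) @ afters k ps" "afters k (ps @ qs) = afters k ps @ afters k qs"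
  by (auto simp: befores_def afters_def)

lemma pseudo_run_append:
  "pseudo_run k as ps \<Longrightarrow> pseudo_run k bs qs \<Longrightarrow> pseudo_run k (as @ bs) (ps @ qs)"
  unfolding pseudo_run_def by (rule list_all2_appendI)

lemma history_sound:
  assumes "\<forall>\<alpha>\<in>set_rexp e. register_bound k \<alpha>" "matches (history k e) xs"
  shows "\<exists>as ps. matches e as \<and> pseudo_run k as ps \<and> label_word xs = reads as \<and>
    left_word xs = afters k ps \<and> right_word xs = befores k ps"
  using assms
proof (induction e arbitrary: xs)
  case Eps
  then show ?case by (intro exI[of _ "[]"]) (auto simp: pseudo_run_def)
next
  case (Atom \<alpha>)
  then have "emits (action_rexp k \<alpha>) (label_word xs) (left_word xs) (right_word xs)"
    by (auto simp: emits_def)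
  then obtain s s' where "label_word xs = reads [\<alpha>]" "supported k s" "supported k s'" "act \<alpha> s s'"
    "left_word xs = config k s'" "right_word xs = config k s"
    using Atom by (auto simp: emits_action)
  then show ?case by (intro exI[of _ "[\<alpha>]"] exI[of _ "[(s, s')]"]) (auto simp: pseudo_run_def)
next
  case (Alt a b)
  then show ?case by simp (meson UnCI)
next
  case (Cat a b)
  then obtain ys zs where xs: "xs = ys @ zs" "matches (history k a) ys" "matches (history k b) zs" by auto
  obtain as ps where 1: "matches a as" "pseudo_run k as ps" "label_word ys = reads as"
    "left_word ys = afters k ps" "right_word ys = befores k ps"
    using Cat.IH(1)[OF _ xs(2)] Cat.prems(1) by auto
  obtain bs qs where 2: "matches b bs" "pseudo_run k bs qs" "label_word zs = reads bs"
    "left_word zs = afters k qs" "right_word zs = befores k qs"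
    using Cat.IH(2)[OF _ xs(3)] Cat.prems(1) by auto
  show ?case
    using 1 2 xs(1) by (intro exI[of _ "as @ bs"] exI[of _ "ps @ qs"]) (auto intro: pseudo_run_append)
next
  case (Star a)
  then obtain us where us: "\<forall>u\<in>set us. matches (history k a) u" "xs = concat us" by (auto simp: matches_Star)
  from us(1) have "\<exists>as ps. matches (Star a) as \<and> pseudo_run k as ps \<and> label_word (concat us) = reads as \<and>
    left_word (concat us) = afters k ps \<and> right_word (concat us) = befores k ps"
  proof (induction us)
    case Nil
    show ?case by (intro exI[of _ "[]"]) (auto simp: pseudo_run_def intro: matches.intros)
  next
    case (Cons u us)
    obtain as ps where 1: "matches a as" "pseudo_run k as ps" "label_word u = reads as"
      "left_word u = afters k ps" "right_word u = befores k ps"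
      using Star.IH[of u] Star.prems(1) Cons.prems by auto
    obtain bs qs where 2: "matches (Star a) bs" "pseudo_run k bs qs" "label_word (concat us) = reads bs"
      "left_word (concat us) = afters k qs" "right_word (concat us) = befores k qs"
      using Cons by auto
    show ?case
      using 1 2 by (intro exI[of _ "as @ bs"] exI[of _ "ps @ qs"]) (auto intro: pseudo_run_append matches.intros)
  qed
  then show ?case using us(2) by simp
qed simp

lemma history_complete:
  assumes "matches e as" "\<forall>\<alpha>\<in>set_rexp e. register_bound k \<alpha>" "pseudo_run k as ps"
  shows "\<exists>xs. matches (history k e) xs \<and> label_word xs = reads as \<and> left_word xs = afters k ps \<and> right_word xs = befores k ps"
  using assms
proof (induction arbitrary: ps rule: matches.induct)
  case Eps
  then show ?case by (intro exI[of _ "[]"]) (auto simp: pseudo_run_def)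
next
  case (Atom \<alpha>)
  then obtain s s' where "ps = [(s, s')]" "supported k s" "supported k s'" "act \<alpha> s s'"
    by (auto simp: pseudo_run_def list_all2_Cons1)
  then have "emits (action_rexp k \<alpha>) (reads [\<alpha>]) (afters k ps) (befores k ps)"
    using Atom by (auto simp: emits_action)
  then show ?case by (auto simp: emits_def)
next
  case (Cat a as b bs)
  then obtain ps1 ps2 where ps: "ps = ps1 @ ps2" "pseudo_run k as ps1" "pseudo_run k bs ps2"
    by (auto simp: pseudo_run_def list_all2_append1)
  obtain xs where 1: "matches (history k a) xs" "label_word xs = reads as" "left_word xs = afters k ps1" "right_word xs = befores k ps1"
    using Cat.IH(1)[OF _ ps(2)] Cat.prems(1) by auto
  obtain ys where 2: "matches (history k b) ys" "label_word ys = reads bs" "left_word ys = afters k ps2" "right_word ys = befores k ps2"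
    using Cat.IH(2)[OF _ ps(3)] Cat.prems(1) by auto
  show ?case using 1 2 ps(1) by (intro exI[of _ "xs @ ys"]) auto
next
  case (Star_Nil a)
  then show ?case by (intro exI[of _ "[]"]) (auto simp: pseudo_run_def intro: matches.intros)
next
  case (Star_step a as bs)
  then obtain ps1 ps2 where ps: "ps = ps1 @ ps2" "pseudo_run k as ps1" "pseudo_run k bs ps2"
    by (auto simp: pseudo_run_def list_all2_append1)
  obtain xs where 1: "matches (history k a) xs" "label_word xs = reads as" "left_word xs = afters k ps1" "right_word xs = befores k ps1"
    using Star_step.IH(1)[OF _ ps(2)] Star_step.prems(1) by auto
  obtain ys where 2: "matches (history k (Star a)) ys" "label_word ys = reads bs" "left_word ys = afters k ps2" "right_word ys = befores k ps2"
    using Star_step.IH(2)[OF _ ps(3)] Star_step.prems(1) by auto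
  show ?case using 1 2 ps(1) by (intro exI[of _ "xs @ ys"]) (auto intro: matches.intros)
next
  case (Alt1 a u b)
  then show ?case by simp (meson UnCI)
next
  case (Alt2 b u a)
  then show ?case by simp (meson UnCI)
qed

text \<open>By the prefix code property the leading configurations of both sides agree, so the first
  step does start in \<open>s\<close>. Removing them leaves the same equation with the state after
  that step in the role of \<open>s\<close>.\<close>

lemma pseudo_run_imp_run:
  assumes "pseudo_run k as ps" "supported k s" "supported k t"
    "config k s @ afters k ps = befores k ps @ config k t"
  shows "run as s t"
  using assms
proof (induction as arbitrary: s ps)
  case Nil
  then have "s = t" using config_inject[of k s t "[]" "[]"] by (auto simp: pseudo_run_def)
  then show ?case by simp
next
  case (Cons \<alpha> as)
  then obtain q q' qs where ps: "ps = (q, q') # qs" "supported k q" "supported k q'" "act \<alpha> q q'" "pseudo_run k as qs"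
    by (auto simp: pseudo_run_def list_all2_Cons1)
  with Cons.prems have "config k s @ (config k q' @ afters k qs) = config k q @ (befores k qs @ config k t)" by simp
  from config_inject[OF Cons.prems(2) ps(2) this] have "s = q" "config k q' @ afters k qs = befores k qs @ config k t"
    by auto
  with Cons.IH[OF ps(5,3) Cons.prems(3)] ps(4) show ?case by auto
qed

lemma act_supported: "register_bound k \<alpha> \<Longrightarrow> supported k s \<Longrightarrow> act \<alpha> s s' \<Longrightarrow> supported k s'"
  by (cases \<alpha>) (auto simp: supported_def)

text \<open>For a genuine run, both sides spell the sequence of all configurations from
  \<open>s\<close> to \<open>t\<close>.\<close>

lemma run_imp_pseudo_run:
  assumes "run as s t" "supported k s" "\<forall>\<alpha>\<in>set as. register_bound k \<alpha>"
  shows "\<exists>ps. pseudo_run k as ps \<and> config k s @ afters k ps = befores k ps @ config k t"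
  using assms
proof (induction as arbitrary: s)
  case Nil
  then show ?case by (intro exI[of _ "[]"]) (auto simp: pseudo_run_def)
next
  case (Cons \<alpha> as)
  then obtain q where q: "act \<alpha> s q" "run as q t" by auto
  have "supported k q" using act_supported q Cons.prems by auto
  with Cons q obtain ps where "pseudo_run k as ps" "config k q @ afters k ps = befores k ps @ config k t" by fastforce
  then show ?case using Cons.prems q \<open>supported k q\<close>
    by (intro exI[of _ "(s, q) # ps"]) (auto simp: pseudo_run_def)
qed

theorem history_equation:
  fixes E :: "'a action rexp"
  shows "\<exists>F :: ('a option \<times> nat list \<times> nat list) rexp.
    \<forall>w. sem E (\<lambda>_. 0) w (\<lambda>_. 0) \<longleftrightarrow> (\<exists>xs. matches F xs \<and> label_word xs = w \<and> left_word xs = right_word xs)"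
proof -
  have "\<exists>k. register_bound k \<alpha>" for \<alpha> :: "'a action"
    by (cases \<alpha>) auto
  then obtain b where b: "\<And>\<alpha> :: 'a action. register_bound (b \<alpha>) \<alpha>" by metis
  have "finite (set_rexp E)" by (induction E) auto
  then obtain k where k: "\<And>\<alpha>. \<alpha> \<in> set_rexp E \<Longrightarrow> b \<alpha> \<le> k"
    using finite_nat_set_iff_bounded_le[of "b ` set_rexp E"] by auto
  have mono: "register_bound m \<alpha> \<Longrightarrow> m \<le> k \<Longrightarrow> register_bound k \<alpha>" for m and \<alpha> :: "'a action"
    by (cases \<alpha>) auto
  have bound: "\<forall>\<alpha>\<in>set_rexp E. register_bound k \<alpha>" using b k mono by blast
  have zero: "supported k (\<lambda>_. 0)" by (simp add: supported_def)
  define c where "c = config k (\<lambda>_. 0)"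
  define F :: "('a option \<times> nat list \<times> nat list) rexp" where
    "F = Cat (Atom (None, c, [])) (Cat (history k E) (Atom (None, [], c)))"
  have "sem E (\<lambda>_. 0) w (\<lambda>_. 0) \<longleftrightarrow> (\<exists>xs. matches F xs \<and> label_word xs = w \<and> left_word xs = right_word xs)" for w
  proof
    assume "sem E (\<lambda>_. 0) w (\<lambda>_. 0)"
    then obtain as where as: "matches E as" "reads as = w" "run as (\<lambda>_. 0) (\<lambda>_. 0)" by (auto simp: sem_def)
    obtain ps where ps: "pseudo_run k as ps" "c @ afters k ps = befores k ps @ c"
      using run_imp_pseudo_run[OF as(3) zero] bound matches_atoms[OF as(1)] unfolding c_def by blast
    obtain xs where xs: "matches (history k E) xs" "label_word xs = w" "left_word xs = afters k ps" "right_word xs = befores k ps"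
      using history_complete[OF as(1) bound ps(1)] as(2) by auto
    have "matches F ((None, c, []) # xs @ [(None, [], c)])"
      using xs(1) by (auto simp: F_def)
    with xs ps(2) show "\<exists>xs. matches F xs \<and> label_word xs = w \<and> left_word xs = right_word xs"
      by (intro exI[of _ "(None, c, []) # xs @ [(None, [], c)]"]) auto
  next
    assume "\<exists>xs. matches F xs \<and> label_word xs = w \<and> left_word xs = right_word xs"
    then obtain xs where xs: "matches (history k E) xs" "label_word xs = w" "c @ left_word xs = right_word xs @ c"
      by (auto simp: F_def)
    obtain as ps where "matches E as" "pseudo_run k as ps" "w = reads as" "c @ afters k ps = befores k ps @ c"
      using history_sound[OF bound xs(1)] xs(2,3) by auto
    then show "sem E (\<lambda>_. 0) w (\<lambda>_. 0)"
      using pseudo_run_imp_run[of k as ps "\<lambda>_. 0" "\<lambda>_. 0"] zero by (auto simp: sem_def c_def)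
  qed
  then show ?thesis by blast
qed

section \<open>A free monoid of integer matrices\<close>

lemma matches_map_rexp: "matches e xs \<Longrightarrow> matches (map_rexp f e) (map f xs)"
  by (induction rule: matches.induct) (auto intro: matches.intros)

lemma matches_map_rexpD: "matches (map_rexp f e) ys \<Longrightarrow> \<exists>xs. matches e xs \<and> ys = map f xs"
proof (induction e arbitrary: ys)
  case (Cat a b)
  then obtain us vs where "ys = us @ vs" "matches (map_rexp f a) us" "matches (map_rexp f b) vs" by auto
  with Cat.IH obtain xs zs where "matches a xs" "matches b zs" "ys = map f xs @ map f zs" by metis
  then show ?case by (intro exI[of _ "xs @ zs"]) auto
next
  case (Star a)
  then obtain us where us: "\<forall>u\<in>set us. matches (map_rexp f a) u" "ys = concat us" by (auto simp: matches_Star)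
  then obtain r where r: "\<And>u. u \<in> set us \<Longrightarrow> matches a (r u) \<and> u = map f (r u)" using Star.IH by metis
  have "map (map f) (map r us) = us" using r by (intro nth_equalityI) auto
  then have "ys = map f (concat (map r us))" using us(2) by (metis map_concat)
  moreover have "matches (Star a) (concat (map r us))" unfolding matches_Star
    using r by (intro exI[of _ "map r us"]) auto
  ultimately show ?case by blast
qed auto

text \<open>A final phase multiplies by inverses of diagonal elements \<open>g [c] [c]\<close>; the register can
  be brought back to the identity in this way if and only if its two words are equal.\<close>

theorem equation_language:
  fixes G :: "('g, 'b) monoid_scheme" and g :: "nat list \<Rightarrow> nat list \<Rightarrow> 'g"
    and F :: "('a option \<times> nat list \<times> nat list) rexp"
  assumes "group G" and closed: "\<And>u v. g u v \<in> carrier G"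
    and Nil: "g [] [] = \<one>\<^bsub>G\<^esub>" and append: "\<And>u u' v v'. g (u @ u') (v @ v') = g u v \<otimes>\<^bsub>G\<^esub> g u' v'"
    and inject: "\<And>u u' v v'. g u v = g u' v' \<Longrightarrow> u = u' \<and> v = v'"
  shows "{w. \<exists>xs. matches F xs \<and> label_word xs = w \<and> left_word xs = right_word xs} \<in> G_languages G"
proof -
  interpret group G by fact
  have "finite (set_rexp F)" by (induction F) auto
  \<comment> \<open>The alphabet of the left words suffices for the final phase, which has to
    succeed only if both words are equal.\<close>
  then have "finite (\<Union>(s, u, v)\<in>set_rexp F. set u)" by auto
  then obtain N where N: "\<And>s u v c. (s, u, v) \<in> set_rexp F \<Longrightarrow> c \<in> set u \<Longrightarrow> c < N"
    using finite_nat_set_iff_bounded[of "\<Union>(s, u, v)\<in>set_rexp F. set u"] by fastforce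
  define f where "f = (\<lambda>(s :: 'a option, u, v). (s, g u v))"
  define undo where "undo c = (None :: 'a option, inv\<^bsub>G\<^esub> g [c] [c])" for c
  define Z where "Z = Star (foldr Alt (map (\<lambda>c. Atom (undo c)) [0..<N]) Empty)"
  define E where "E = Cat (map_rexp f F) Z"
  have alt: "matches (foldr Alt (map (\<lambda>c. Atom (undo c)) cs) Empty) xs \<longleftrightarrow> (\<exists>c\<in>set cs. xs = [undo c])" for cs xs
    by (induction cs) auto
  have Z: "matches Z xs \<longleftrightarrow> (\<exists>z. set z \<subseteq> {..<N} \<and> xs = map undo z)" for xs
  proof -
    have "(\<exists>us. (\<forall>v\<in>set us. \<exists>c<N. v = [undo c]) \<and> xs = concat us) \<longleftrightarrow> (\<exists>z. set z \<subseteq> {..<N} \<and> xs = map undo z)"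
    proof
      assume "\<exists>us. (\<forall>v\<in>set us. \<exists>c<N. v = [undo c]) \<and> xs = concat us"
      then obtain us where us: "\<forall>v\<in>set us. \<exists>c<N. v = [undo c]" "xs = concat us" by blast
      then obtain r where "\<forall>v\<in>set us. r v < N \<and> v = [undo (r v)]" by metis
      then have "concat us = map undo (map r us)" "set (map r us) \<subseteq> {..<N}"
        by (induction us) auto
      then show "\<exists>z. set z \<subseteq> {..<N} \<and> xs = map undo z" using us(2) by blast
    next
      assume "\<exists>z. set z \<subseteq> {..<N} \<and> xs = map undo z"
      then obtain z where "set z \<subseteq> {..<N}" "xs = map undo z" by blast
      then show "\<exists>us. (\<forall>v\<in>set us. \<exists>c<N. v = [undo c]) \<and> xs = concat us"
        by (intro exI[of _ "map (\<lambda>c. [undo c]) z"]) auto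
    qed
    then show ?thesis unfolding Z_def matches_Star by (simp add: alt Bex_def)
  qed
  have word_f: "label_word (map f xs) = label_word xs" for xs
  proof (induction xs)
    case (Cons x xs)
    then show ?case by (cases x; cases "fst x") (simp_all add: f_def)
  qed simp
  have prod_f: "label_prod G y (map f xs) = y \<otimes>\<^bsub>G\<^esub> g (left_word xs) (right_word xs)" if "y \<in> carrier G" for y xs
    using that
  proof (induction xs arbitrary: y)
    case (Cons x xs)
    obtain s u v where x: "x = (s, u, v)" by (cases x)
    show ?case using Cons closed by (simp add: x f_def append m_assoc)
  qed (simp add: Nil)
  have word_undo: "label_word (map undo z) = []" for z
    by (induction z) (auto simp: undo_def)
  \<comment> \<open>Inversion reverses products, so undoing the letters of \<open>z\<close> one
    after another removes the word \<open>rev z\<close>.\<close>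
  have prod_undo: "label_prod G y (map undo z) = y \<otimes>\<^bsub>G\<^esub> inv\<^bsub>G\<^esub> g (rev z) (rev z)" if "y \<in> carrier G" for y z
    using that
  proof (induction z arbitrary: y)
    case (Cons c z)
    then show ?case using closed by (simp add: undo_def append inv_mult_group m_assoc)
  qed (simp add: Nil)
  have E: "\<forall>(s, m)\<in>set_rexp E. m \<in> carrier G"
  proof -
    have "set_rexp (foldr Alt (map (\<lambda>c. Atom (undo c)) cs) Empty) = undo ` set cs" for cs
      by (induction cs) auto
    then show ?thesis
      using closed by (auto simp: E_def Z_def f_def undo_def rexp.set_map)
  qed
  have "(\<exists>ys. matches E ys \<and> label_word ys = w \<and> label_prod G \<one>\<^bsub>G\<^esub> ys = \<one>\<^bsub>G\<^esub>) \<longleftrightarrow>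
      (\<exists>xs. matches F xs \<and> label_word xs = w \<and> left_word xs = right_word xs)" for w
  proof
    assume "\<exists>ys. matches E ys \<and> label_word ys = w \<and> label_prod G \<one>\<^bsub>G\<^esub> ys = \<one>\<^bsub>G\<^esub>"
    then obtain ys zs where "matches (map_rexp f F) ys" "matches Z zs" "label_word (ys @ zs) = w"
      "label_prod G \<one>\<^bsub>G\<^esub> (ys @ zs) = \<one>\<^bsub>G\<^esub>"
      by (auto simp: E_def)
    then obtain xs z where xs: "matches F xs" "label_word (map f xs @ map undo z) = w"
      "label_prod G \<one>\<^bsub>G\<^esub> (map f xs @ map undo z) = \<one>\<^bsub>G\<^esub>"
      using matches_map_rexpD Z by metis
    from xs(3) have "g (left_word xs) (right_word xs) \<otimes>\<^bsub>G\<^esub> inv\<^bsub>G\<^esub> g (rev z) (rev z) = \<one>\<^bsub>G\<^esub>"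
      using closed by (simp add: prod_f prod_undo)
    then have "g (left_word xs) (right_word xs) = g (rev z) (rev z)"
      using closed by (metis inv_closed inv_equality inv_inv)
    then show "\<exists>xs. matches F xs \<and> label_word xs = w \<and> left_word xs = right_word xs"
      using xs inject[of "left_word xs" "right_word xs"] by (auto simp: word_f word_undo)
  next
    assume "\<exists>xs. matches F xs \<and> label_word xs = w \<and> left_word xs = right_word xs"
    then obtain xs where xs: "matches F xs" "label_word xs = w" "left_word xs = right_word xs" by blast
    have "set (left_word xs) \<subseteq> {..<N}"
      using N matches_atoms[OF xs(1)] by (fastforce simp: left_word_def)
    then have "matches Z (map undo (rev (left_word xs)))"
      unfolding Z by (intro exI[of _ "rev (left_word xs)"]) simp
    then have "matches E (map f xs @ map undo (rev (left_word xs)))"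
      unfolding E_def by (intro matches.Cat matches_map_rexp xs(1))
    moreover have "label_prod G \<one>\<^bsub>G\<^esub> (map f xs @ map undo (rev (left_word xs))) = \<one>\<^bsub>G\<^esub>"
      using closed xs(3) by (simp add: prod_f prod_undo)
    ultimately show "\<exists>ys. matches E ys \<and> label_word ys = w \<and> label_prod G \<one>\<^bsub>G\<^esub> ys = \<one>\<^bsub>G\<^esub>"
      using xs(2) by (intro exI[of _ "map f xs @ map undo (rev (left_word xs))"]) (simp add: word_f word_undo)
  qed
  then show ?thesis using rexp_automaton[OF \<open>group G\<close> E] by simp
qed

section \<open>Words as integer matrices of determinant 1\<close>

type_synonym mat2 = "int \<times> int \<times> int \<times> int"

fun mult2 :: "mat2 \<Rightarrow> mat2 \<Rightarrow> mat2" where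
  "mult2 (a, b, c, d) (a', b', c', d') = (a * a' + b * c', a * b' + b * d', c * a' + d * c', c * b' + d * d')"

lemma mult2_assoc: "mult2 (mult2 X Y) Z = mult2 X (mult2 Y Z)"
  by (cases X; cases Y; cases Z) (simp add: algebra_simps)

text \<open>The matrix of the letter \<open>i\<close> is \<open>A\<^sup>i B\<close> for the elementary matrices \<open>A = (1, 1; 0, 1)\<close> and
  \<open>B = (1, 0; 1, 1)\<close>, which generate a free monoid.\<close>

primrec word_mat :: "nat list \<Rightarrow> mat2" where
  "word_mat [] = (1, 0, 0, 1)"
| "word_mat (i # u) = mult2 (mult2 (1, int i, 0, 1) (1, 0, 1, 1)) (word_mat u)"

lemma word_mat_append: "word_mat (u @ v) = mult2 (word_mat u) (word_mat v)"
proof (induction u)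
  case Nil
  show ?case by (cases "word_mat v") simp
qed (simp add: mult2_assoc del: mult2.simps)

lemma word_mat_Cons:
  "word_mat u = (p, q, r, s) \<Longrightarrow> word_mat (i # u) = (p + int i * (p + r), q + int i * (q + s), p + r, q + s)"
  by (simp add: algebra_simps)

lemma word_mat_bounds:
  obtains p q r s where "word_mat u = (p, q, r, s)" "p \<ge> 1" "q \<ge> 0" "r \<ge> 0" "s \<ge> 1"
proof (induction u arbitrary: thesis)
  case (Cons i u)
  then obtain p q r s where u: "word_mat u = (p, q, r, s)" "p \<ge> 1" "q \<ge> 0" "r \<ge> 0" "s \<ge> 1" by blast
  then have "p + int i * (p + r) \<ge> 1" "q + int i * (q + s) \<ge> 0"
    using mult_nonneg_nonneg[of "int i" "p + r"] mult_nonneg_nonneg[of "int i" "q + s"] by linarith+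
  moreover have "word_mat (i # u) = (p + int i * (p + r), q + int i * (q + s), p + r, q + s)"
    using u(1) by (rule word_mat_Cons)
  ultimately show ?case using Cons.prems u by simp
qed simp

text \<open>The first letter can be read off: the right column of the matrix of \<open>i # u\<close>
  is (q + i (q + s), q + s) with 0 <= q < q + s, so i is the quotient of its entries. The lower left
  entry p + r is positive, which separates nonempty words from the identity.\<close>

lemma word_mat_inject: "word_mat u = word_mat v \<Longrightarrow> u = v"
proof (induction u arbitrary: v)
  case Nil
  show ?case
  proof (cases v)
    case (Cons j v')
    obtain p q r s where "word_mat v' = (p, q, r, s)" "p \<ge> 1" "r \<ge> 0"
      using word_mat_bounds[of v'] by metis
    with Nil Cons show ?thesis by simp
  qed simp
next
  case (Cons i u)
  obtain p q r s where u: "word_mat u = (p, q, r, s)" "p \<ge> 1" "q \<ge> 0" "r \<ge> 0" "s \<ge> 1"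
    using word_mat_bounds[of u] by metis
  show ?case
  proof (cases v)
    case Nil
    with Cons.prems u show ?thesis by simp
  next
    case v: (Cons j v')
    obtain p' q' r' s' where v': "word_mat v' = (p', q', r', s')" "p' \<ge> 1" "q' \<ge> 0" "r' \<ge> 0" "s' \<ge> 1"
      using word_mat_bounds[of v'] by metis
    have eq: "p + int i * (p + r) = p' + int j * (p' + r')" "q + int i * (q + s) = q' + int j * (q' + s')"
      "p + r = p' + r'" "q + s = q' + s'"
      using Cons.prems unfolding v word_mat_Cons[OF u(1)] word_mat_Cons[OF v'(1)] by auto
    have "(q + int i * (q + s)) div (q + s) = int i" "(q' + int j * (q' + s')) div (q' + s') = int j"
      using u v' by (simp_all add: div_pos_pos_trivial)
    then have "i = j" using eq by (metis of_nat_eq_iff)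
    with eq have "word_mat u = word_mat v'" using u v' by simp
    with Cons.IH \<open>i = j\<close> v show ?thesis by simp
  qed
qed

definition diag_mat :: "mat2 \<Rightarrow> mat2 \<Rightarrow> int ^4 ^4" where
  "diag_mat X Y = (case (X, Y) of ((a, b, c, d), (a', b', c', d')) \<Rightarrow>
    (\<chi> i j. if i = 1 then (if j = 1 then a else if j = 2 then b else 0)
      else if i = 2 then (if j = 1 then c else if j = 2 then d else 0)
      else if i = 3 then (if j = 3 then a' else if j = 4 then b' else 0)
      else (if j = 3 then c' else if j = 4 then d' else 0)))"

lemma diag_mat_mult: "diag_mat X Y ** diag_mat X' Y' = diag_mat (mult2 X X') (mult2 Y Y')"
  by (cases X; cases Y; cases X'; cases Y')
    (simp add: diag_mat_def matrix_matrix_mult_def vec_eq_iff forall_4 sum_4)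

lemma diag_mat_inject: "diag_mat X Y = diag_mat X' Y' \<Longrightarrow> X = X' \<and> Y = Y'"
  by (cases X; cases Y; cases X'; cases Y') (simp add: diag_mat_def vec_eq_iff forall_4)

lemma diag_mat_one: "diag_mat (1, 0, 0, 1) (1, 0, 0, 1) = mat 1"
  by (simp add: diag_mat_def vec_eq_iff forall_4 mat_def)

text \<open>Each matrix arises from the identity by adding a multiple of one row to another, which
  preserves the determinant; this bypasses the expansion over all permutations of four rows.\<close>

lemma det_diag_elementary:
  "det (diag_mat (1, x, 0, 1) (1, 0, 0, 1)) = 1" "det (diag_mat (1, 0, x, 1) (1, 0, 0, 1)) = 1"
  "det (diag_mat (1, 0, 0, 1) (1, x, 0, 1)) = 1" "det (diag_mat (1, 0, 0, 1) (1, 0, x, 1)) = 1"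
proof -
  have e: "det (\<chi> k. if k = i then row i (mat 1) + x *s row j (mat 1) else row k (mat 1 :: int^4^4)) = 1"
    if "i \<noteq> j" for i j :: 4
    using that by (simp add: det_row_operation)
  have "diag_mat (1, x, 0, 1) (1, 0, 0, 1) =
      (\<chi> k. if k = 1 then row 1 (mat 1) + x *s row 2 (mat 1) else row k (mat 1 :: int^4^4))"
    "diag_mat (1, 0, x, 1) (1, 0, 0, 1) =
      (\<chi> k. if k = 2 then row 2 (mat 1) + x *s row 1 (mat 1) else row k (mat 1 :: int^4^4))"
    "diag_mat (1, 0, 0, 1) (1, x, 0, 1) =
      (\<chi> k. if k = 3 then row 3 (mat 1) + x *s row 4 (mat 1) else row k (mat 1 :: int^4^4))"
    "diag_mat (1, 0, 0, 1) (1, 0, x, 1) =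
      (\<chi> k. if k = 4 then row 4 (mat 1) + x *s row 3 (mat 1) else row k (mat 1 :: int^4^4))"
    by (simp_all add: diag_mat_def vec_eq_iff forall_4 mat_def row_def)
  then show "det (diag_mat (1, x, 0, 1) (1, 0, 0, 1)) = 1" "det (diag_mat (1, 0, x, 1) (1, 0, 0, 1)) = 1"
  "det (diag_mat (1, 0, 0, 1) (1, x, 0, 1)) = 1" "det (diag_mat (1, 0, 0, 1) (1, 0, x, 1)) = 1"
    using e by simp_all
qed

text \<open>A block diagonal matrix factors into one with trivial lower block and one with trivial
  upper block, and each of these is a product of elementary matrices.\<close>

lemma det_diag_word: "det (diag_mat (word_mat u) (word_mat v)) = 1"
proof -
  let ?I = "(1, 0, 0, 1) :: mat2"
  have I: "mult2 X ?I = X" "mult2 ?I X = X" for X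
    by (cases X; simp)+
  have left: "det (diag_mat (word_mat u) ?I) = 1"
  proof (induction u)
    case (Cons i u)
    have "diag_mat (word_mat (i # u)) ?I =
        diag_mat (1, int i, 0, 1) ?I ** diag_mat (1, 0, 1, 1) ?I ** diag_mat (word_mat u) ?I"
      unfolding diag_mat_mult I word_mat.simps ..
    then show ?case by (simp add: det_mul det_diag_elementary Cons)
  qed (simp add: diag_mat_one)
  have right: "det (diag_mat ?I (word_mat v)) = 1"
  proof (induction v)
    case (Cons i v)
    have "diag_mat ?I (word_mat (i # v)) =
        diag_mat ?I (1, int i, 0, 1) ** diag_mat ?I (1, 0, 1, 1) ** diag_mat ?I (word_mat v)"
      unfolding diag_mat_mult I word_mat.simps ..
    then show ?case by (simp add: det_mul det_diag_elementary Cons)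
  qed (simp add: diag_mat_one)
  have "diag_mat (word_mat u) (word_mat v) = diag_mat (word_mat u) ?I ** diag_mat ?I (word_mat v)"
    unfolding diag_mat_mult I ..
  then show ?thesis by (simp add: det_mul left right)
qed

theorem RE_in_G_languages:
  fixes G :: "('g, 'b) monoid_scheme" and L :: "('a::finite) list set"
  assumes "group G" and h: "h \<in> hom SL4Z G" "inj_on h (carrier SL4Z)" and "RE_lang L"
  shows "L \<in> G_languages G"
proof -
  interpret group G by fact
  define g where "g u v = h (diag_mat (word_mat u) (word_mat v))" for u v
  have carrier: "diag_mat (word_mat u) (word_mat v) \<in> carrier SL4Z" for u v
    by (simp add: SL4Z_def matrix_group_def det_diag_word)
  have closed: "g u v \<in> carrier G" for u v
    using hom_in_carrier[OF h(1) carrier] by (simp add: g_def)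
  have append: "g (u @ u') (v @ v') = g u v \<otimes>\<^bsub>G\<^esub> g u' v'" for u u' v v'
    using hom_mult[OF h(1) carrier carrier, of u v u' v']
    by (simp add: g_def word_mat_append SL4Z_def matrix_group_def diag_mat_mult)
  \<comment> \<open>A member of \<open>hom\<close> is only required to respect products, but an
    idempotent element of a group is the identity.\<close>
  have one: "g [] [] = \<one>\<^bsub>G\<^esub>"
    using append[of "[]" "[]" "[]" "[]"] closed[of "[]" "[]"] by simp
  have inject: "u = u' \<and> v = v'" if "g u v = g u' v'" for u u' v v'
  proof -
    have "diag_mat (word_mat u) (word_mat v) = diag_mat (word_mat u') (word_mat v')"
      using that inj_onD[OF h(2) _ carrier carrier] by (simp add: g_def)
    then show ?thesis using diag_mat_inject word_mat_inject by blast
  qed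
  obtain E :: "'a action rexp" where E: "\<And>w. w \<in> L \<longleftrightarrow> sem E (\<lambda>_. 0) w (\<lambda>_. 0)"
    using RE_lang_program[OF \<open>RE_lang L\<close>] by blast
  moreover obtain F :: "('a option \<times> nat list \<times> nat list) rexp" where
    "\<And>w. sem E (\<lambda>_. 0) w (\<lambda>_. 0) \<longleftrightarrow> (\<exists>xs. matches F xs \<and> label_word xs = w \<and> left_word xs = right_word xs)"
    using history_equation[of E] by blast
  ultimately have "L = {w. \<exists>xs. matches F xs \<and> label_word xs = w \<and> left_word xs = right_word xs}"
    by auto
  moreover have "{w. \<exists>xs. matches F xs \<and> label_word xs = w \<and> left_word xs = right_word xs} \<in> G_languages G"
    by (rule equation_language[where g = g, OF \<open>group G\<close> closed one append inject])
  ultimately show ?thesis by simp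
qed

theorem theorem3p16:
  fixes S :: "(real ^'n ^'n) set"
  assumes "group (matrix_group S)"
    and "\<forall>A\<in>S. \<forall>i j. computable_real (A $ i $ j)"
    and "\<exists>h. h \<in> hom SL4Z (matrix_group S) \<and> inj_on h (carrier SL4Z)"
  shows "(G_languages (matrix_group S) :: ('a::finite) list set set) = {L. RE_lang L}"
proof (intro equalityI subsetI)
  fix L :: "'a list set" assume "L \<in> G_languages (matrix_group S)"
  then show "L \<in> {L. RE_lang L}" by (auto simp: G_languages_def intro: automaton_RE)
next
  fix L :: "'a list set" assume "L \<in> {L. RE_lang L}"
  then show "L \<in> G_languages (matrix_group S)"
    using assms(1,3) RE_in_G_languages[of "matrix_group S"] by blast
qed

end
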